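(* Let $0<d<n-1$ ($d$ not necessarily an integer), let $\Gamma\subset\mathbb R^n$ be a closed $d$-dimensional Ahlfors regular set, $\Omega=\mathbb R^n\setminus\Gamma$, and let $q\in(1,\infty)$. Let $L=-\operatorname{div}A\nabla$ be a $q$-elliptic operator on $\Omega$ (with weight $\delta^{d+1-n}$, see context). For any ball $B\subset\mathbb R^n$ of radius $r$ that satisfies $3B\subset\Omega$ and any weak solution $u\in W^{1,2}_{loc}(\Omega)$ to $Lu=0$, we have $$\int_B|\nabla u|^2|u|^{q-2}\,dm\le\frac C{r^2}\int_{2B}|u|^q\,dm.$$ Moreover, the following reverse Hölder estimates hold. (i) If $q>2$, $\displaystyle\Big(\frac1{m(B)}\int_B|u|^q\,dm\Big)^{1/q}\le C\Big(\frac1{m(2B)}\int_{2B}|u|^2\,dm\Big)^{1/2}.$ (ii) If $q<2$, $\displaystyle\Big(\frac1{m(B)}\int_B|u|^2\,dm\Big)^{1/2}\le C\Big(\frac1{m(2B)}\int_{2B}|u|^q\,dm\Big)^{1/q}.$ In all three inequalities the constant $C>0$ depends only on $n$, $q$, a lower bound on the $q$-ellipticity constant $\lambda_q$, and the constant in the ellipticity and boundedness conditions on $A$.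
   Context: A closed set $\Gamma$ is $d$-Ahlfors regular if there are $C>0$ and a measure $\sigma$ on $\Gamma$ with $C^{-1}r^d\le\sigma(B(X,r))\le Cr^d$ for all $X\in\Gamma$, $r>0$. $\delta(X)=\operatorname{dist}(X,\Gamma)$ and $m(E)=\int_E\delta(X)^{d+1-n}\,dX$, i.e. $dm=\delta^{d+1-n}dX$. If $B$ has center $X$ and radius $r$, $\lambda B$ has center $X$ and radius $\lambda r$. $L=-\operatorname{div}A\nabla$ is elliptic (with weight $\delta^{d+1-n}$) if the measurable complex matrix $A$ satisfies, for some $C>0$, $\operatorname{Re}(A(X)\xi\cdot\bar\xi)\ge C^{-1}\delta(X)^{d+1-n}|\xi|^2$ and $|A(X)\xi\cdot\bar\zeta|\le C\delta(X)^{d+1-n}|\xi||\zeta|$ for $X\in\Omega$, $\xi,\zeta\in\mathbb C^n$. Put $\mathcal A=\delta^{n-d-1}A$. $L$ is $q$-elliptic if it is elliptic and there is $\lambda_q>0$ with $\operatorname{Re}(\mathcal A(X)\xi\cdot\overline{\mathcal J_q\xi})\ge\lambda_q|\xi|^2$ for a.e. $X\in\Omega$ and all $\xi\in\mathbb C^n$, where $\mathcal J_q(\alpha+i\beta)=\frac1q\alpha+\frac i{q'}\beta$ ($\alpha,\beta\in\mathbb R^n$, $\frac1q+\frac1{q'}=1$). $u\in W^{1,2}_{loc}(\Omega)$ is a weak solution to $Lu=0$ if $\int_\Omega\mathcal A\nabla u\cdot\nabla\bar\Psi\,dm=0$ for all $\Psi\in C_0^\infty(\Omega)$. The integrand $|\nabla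 u|^2|u|^{q-2}$ is understood to be $0$ where $u=0$ (there $\nabla u=0$ a.e.). *)

theory Defs
  imports "HOL-Analysis.Analysis"
begin

text \<open>The space R^n is \<open>real^'n\<close> with n = \<open>CARD('n)\<close>; the open set is always the complement
  \<open>- \<Gamma>\<close> of a closed set \<open>\<Gamma>\<close>, and \<open>\<delta>(X)\<close> is \<open>infdist X \<Gamma>\<close>.\<close>

text \<open>\<open>\<sigma>\<close> is a Borel measure on the subspace \<open>\<Gamma>\<close>, so \<open>\<sigma>(B(X,r))\<close> is
  \<open>\<sigma>(B(X,r) \<inter> \<Gamma>)\<close>. Nonemptiness is required explicitly: the measure bounds hold vacuously
  for the empty set, for which the distance \<open>\<delta>\<close> is meaningless (\<open>infdist X {} = 0\<close>).\<close>

definition ahlfors_regular :: "real \<Rightarrow> (real^'n) set \<Rightarrow> bool" where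
  "ahlfors_regular d \<Gamma> \<longleftrightarrow>
     closed \<Gamma> \<and> \<Gamma> \<noteq> {} \<and>
     (\<exists>C>0. \<exists>\<sigma>. sets \<sigma> = sets (restrict_space borel \<Gamma>) \<and>
        (\<forall>X\<in>\<Gamma>. \<forall>r>0.
           ennreal (r powr d / C) \<le> emeasure \<sigma> (ball X r \<inter> \<Gamma>) \<and>
           emeasure \<sigma> (ball X r \<inter> \<Gamma>) \<le> ennreal (C * r powr d)))"

definition weight :: "(real^'n) set \<Rightarrow> real \<Rightarrow> real^'n \<Rightarrow> real" where
  "weight \<Gamma> d X = infdist X \<Gamma> powr (d + 1 - real CARD('n))"

definition wmeasure :: "(real^'n) set \<Rightarrow> real \<Rightarrow> (real^'n) measure" where
  "wmeasure \<Gamma> d = density lebesgue (\<lambda>X. ennreal (weight \<Gamma> d X))"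

text \<open>\<open>hdot z w\<close> is the product of z with the complex conjugate of w.\<close>

definition hdot :: "complex^'n \<Rightarrow> complex^'n \<Rightarrow> complex" where
  "hdot z w = (\<Sum>i\<in>UNIV. z $ i * cnj (w $ i))"

definition elliptic_with ::
  "(real^'n) set \<Rightarrow> real \<Rightarrow> real \<Rightarrow> (real^'n \<Rightarrow> complex^'n^'n) \<Rightarrow> bool" where
  "elliptic_with \<Gamma> d K A \<longleftrightarrow>
     K > 0 \<and> A \<in> borel_measurable (lebesgue_on (- \<Gamma>)) \<and>
     (\<forall>X\<in>- \<Gamma>. \<forall>\<xi> \<zeta>.
        Re (hdot (A X *v \<xi>) \<xi>) \<ge> inverse K * weight \<Gamma> d X * (norm \<xi>)\<^sup>2 \<and>
        cmod (hdot (A X *v \<xi>) \<zeta>) \<le> K * weight \<Gamma> d X * norm \<xi> * norm \<zeta>)"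

definition normalized ::
  "(real^'n) set \<Rightarrow> real \<Rightarrow> (real^'n \<Rightarrow> complex^'n^'n) \<Rightarrow> real^'n \<Rightarrow> complex^'n^'n" where
  "normalized \<Gamma> d A X = infdist X \<Gamma> powr (real CARD('n) - d - 1) *\<^sub>R A X"

definition conj_exponent :: "real \<Rightarrow> real" where
  "conj_exponent q = q / (q - 1)"

definition J_map :: "real \<Rightarrow> complex^'n \<Rightarrow> complex^'n" where
  "J_map q \<xi> = (\<chi> i. Complex (Re (\<xi> $ i) / q) (Im (\<xi> $ i) / conj_exponent q))"

definition q_elliptic_with ::
  "(real^'n) set \<Rightarrow> real \<Rightarrow> real \<Rightarrow> real \<Rightarrow> real \<Rightarrow> (real^'n \<Rightarrow> complex^'n^'n) \<Rightarrow> bool" where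
  "q_elliptic_with \<Gamma> d q K lam A \<longleftrightarrow>
     elliptic_with \<Gamma> d K A \<and> lam > 0 \<and>
     (AE X in lebesgue_on (- \<Gamma>). \<forall>\<xi>.
        Re (hdot (normalized \<Gamma> d A X *v \<xi>) (J_map q \<xi>)) \<ge> lam * (norm \<xi>)\<^sup>2)"

definition partial :: "'n \<Rightarrow> (real^'n \<Rightarrow> complex) \<Rightarrow> real^'n \<Rightarrow> complex" where
  "partial i f X = frechet_derivative f (at X) (axis i 1)"

primrec k_smooth :: "nat \<Rightarrow> (real^'n \<Rightarrow> complex) \<Rightarrow> bool" where
  "k_smooth 0 f \<longleftrightarrow> continuous_on UNIV f"
| "k_smooth (Suc k) f \<longleftrightarrow> (\<forall>X. f differentiable (at X)) \<and> (\<forall>i. k_smooth k (partial i f))"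

definition test_function :: "(real^'n) set \<Rightarrow> (real^'n \<Rightarrow> complex) \<Rightarrow> bool" where
  "test_function \<Omega> \<phi> \<longleftrightarrow>
     (\<forall>k. k_smooth k \<phi>) \<and>
     compact (closure {X. \<phi> X \<noteq> 0}) \<and> closure {X. \<phi> X \<noteq> 0} \<subseteq> \<Omega>"

definition grad :: "(real^'n \<Rightarrow> complex) \<Rightarrow> real^'n \<Rightarrow> complex^'n" where
  "grad \<phi> X = (\<chi> i. partial i \<phi> X)"

text \<open>Local square integrability is taken with respect to Lebesgue measure. On compact subsets
  of \<open>- \<Gamma>\<close> the weight is bounded above and below, so the weighted measure gives the same space.\<close>

definition L2_loc ::
  "(real^'n) set \<Rightarrow> (real^'n \<Rightarrow> 'b::euclidean_space) \<Rightarrow> bool" where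
  "L2_loc \<Omega> f \<longleftrightarrow>
     f \<in> borel_measurable (lebesgue_on \<Omega>) \<and>
     (\<forall>S. compact S \<and> S \<subseteq> \<Omega> \<longrightarrow> set_integrable lebesgue S (\<lambda>X. (norm (f X))\<^sup>2))"

definition is_weak_gradient ::
  "(real^'n) set \<Rightarrow> (real^'n \<Rightarrow> complex) \<Rightarrow> (real^'n \<Rightarrow> complex^'n) \<Rightarrow> bool" where
  "is_weak_gradient \<Omega> u G \<longleftrightarrow>
     (\<forall>\<phi> i. test_function \<Omega> \<phi> \<longrightarrow>
        (LINT X:\<Omega>|lebesgue. u X * partial i \<phi> X) = - (LINT X:\<Omega>|lebesgue. G X $ i * \<phi> X))"

definition W12_loc :: "(real^'n) set \<Rightarrow> (real^'n \<Rightarrow> complex) \<Rightarrow> bool" where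
  "W12_loc \<Omega> u \<longleftrightarrow> L2_loc \<Omega> u \<and> (\<exists>G. L2_loc \<Omega> G \<and> is_weak_gradient \<Omega> u G)"

text \<open>A representative of the weak gradient, which is unique almost everywhere on open \<open>\<Omega>\<close>.\<close>

definition weak_grad ::
  "(real^'n) set \<Rightarrow> (real^'n \<Rightarrow> complex) \<Rightarrow> real^'n \<Rightarrow> complex^'n" where
  "weak_grad \<Omega> u = (SOME G. L2_loc \<Omega> G \<and> is_weak_gradient \<Omega> u G)"

definition weak_solution ::
  "(real^'n) set \<Rightarrow> real \<Rightarrow> (real^'n \<Rightarrow> complex^'n^'n) \<Rightarrow> (real^'n \<Rightarrow> complex) \<Rightarrow> bool" where
  "weak_solution \<Gamma> d A u \<longleftrightarrow>
     W12_loc (- \<Gamma>) u \<and>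
     (\<forall>\<Psi>. test_function (- \<Gamma>) \<Psi> \<longrightarrow>
        (LINT X:(- \<Gamma>)|wmeasure \<Gamma> d.
           hdot (normalized \<Gamma> d A X *v weak_grad (- \<Gamma>) u X) (grad \<Psi> X)) = 0)"

text \<open>Nonnegative integrands are integrated in \<open>ennreal\<close>, so that finiteness is part of an
  upper bound instead of a tacit assumption.\<close>

text \<open>Used for positive exponents only; the power of \<open>\<infinity>\<close> is then \<open>\<infinity>\<close>.\<close>

definition epowr :: "ennreal \<Rightarrow> real \<Rightarrow> ennreal" where
  "epowr x a = (if x = \<infinity> then \<infinity> else ennreal (enn2real x powr a))"

definition average :: "'a measure \<Rightarrow> 'a set \<Rightarrow> ('a \<Rightarrow> real) \<Rightarrow> ennreal" where
  "average M B f = (\<integral>\<^sup>+X\<in>B. ennreal (f X) \<partial>M) / emeasure M B"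

definition energy_density ::
  "(real^'n) set \<Rightarrow> real \<Rightarrow> (real^'n \<Rightarrow> complex) \<Rightarrow> real^'n \<Rightarrow> real" where
  "energy_density \<Omega> q u X =
     (if u X = 0 then 0 else (norm (weak_grad \<Omega> u X))\<^sup>2 * cmod (u X) powr (q - 2))"

end

theory Submission
  imports Defs
begin

text \<open>The weight oscillates by at most a dimensional factor on a ball whose triple avoids \<open>\<Gamma>\<close>, so
  the problem reduces to an unweighted uniformly elliptic one. Testing the equation with
  \<open>\<eta>\<^sup>2 \<phi>(u)\<close>, where \<open>\<phi>(u)\<close> is a Lipschitz regularization of \<open>\<bar>u\<bar>\<^bsup>q-2\<^esup> u\<close>, gives the Caccioppoli inequality:
  after rotating by the phase of \<open>u\<close>, the gradient of \<open>\<phi>(u)\<close> is a positive multiple of a convex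
  combination of the vectors that enter 2-ellipticity and q-ellipticity. For the reverse Hoelder
  inequalities no Sobolev embedding is needed. Nash's inequality
  \<open>\<parallel>w\<parallel>\<^sub>2\<^sup>2 \<le> t\<^sup>2 \<parallel>\<nabla>w\<parallel>\<^sub>2\<^sup>2 + C t\<^bsup>-n\<^esup> \<parallel>w\<parallel>\<^sub>1\<^sup>2\<close>, applied to a cutoff of \<open>\<bar>u\<bar>\<^bsup>s/2\<^esup>\<close>, together with
  Caccioppoli and Chebyshev bounds the integral of \<open>\<bar>u\<bar>\<^sup>s\<close> on a ball by a small multiple of the same
  integral on a larger ball plus a power of the integral of \<open>\<bar>u\<bar>\<^sup>p\<close>; iterating along a geometric
  sequence of radii absorbs the small multiple. Case (i) is \<open>s = q, p = 2\<close>, case (ii) is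
  \<open>s = 2, p = q\<close> and uses ellipticity only.\<close>

text \<open>The obstacle is that nothing is known about \<open>u\<close> beyond local square
  integrability of \<open>u\<close> and of its weak gradient. For q > 2 the integral of
  \<open>|u|^q\<close> may a priori be infinite, so no inequality containing it can be absorbed, and
  \<open>|u|^(q-2) u\<close> is not known to be admissible in the equation. For q < 2 the power is
  singular at the zeros of \<open>u\<close>. In the regularization, powers become factors between
  two positive constants depending on k: finiteness is then automatic, the final estimates have
  constants free of k, and k tends to infinity at the very end. No chain rule for weak gradients is
  used. The nonlinear maps are applied to C1 functions that converge to \<open>u\<close> almost
  everywhere under a square integrable majorant, and it is the integral identities and inequalities
  that pass to the limit. The constants must not depend on d; this is possible because the exponent
  of the weight stays between -n and 0.\<close>

section \<open>Smooth functions\<close>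

lemma partial_eqI:
  assumes "(f has_derivative f') (at x)"
  shows "partial i f x = f' (axis i 1)"
  using frechet_derivative_at[OF assms] by (simp add: partial_def)

lemma linear_axis_expansion:
  fixes D :: "real^'n \<Rightarrow> complex"
  assumes "linear D"
  shows "D h = (\<Sum>i\<in>UNIV. h $ i *\<^sub>R D (axis i 1))"
proof -
  have "D h = D (\<Sum>i\<in>UNIV. h $ i *\<^sub>R axis i 1)"
    using basis_expansion[of h] by (simp add: scalar_mult_eq_scaleR)
  also have "\<dots> = (\<Sum>i\<in>UNIV. h $ i *\<^sub>R D (axis i 1))"
    using assms by (simp add: linear_sum linear_scale)
  finally show ?thesis .
qed

lemma has_derivative_partial:
  fixes f :: "real^'n \<Rightarrow> complex"
  assumes "f differentiable (at x)"
  shows "(f has_derivative (\<lambda>h. \<Sum>i\<in>UNIV. h $ i *\<^sub>R partial i f x)) (at x)"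
proof -
  obtain D where D: "(f has_derivative D) (at x)"
    using assms by (auto simp: differentiable_def)
  have "D = (\<lambda>h. \<Sum>i\<in>UNIV. h $ i *\<^sub>R partial i f x)"
    unfolding partial_eqI[OF D] by (rule ext) (rule linear_axis_expansion[OF has_derivative_linear[OF D]])
  with D show ?thesis by simp
qed

lemma partial_const [simp]: "partial i (\<lambda>_. c) = (\<lambda>_. 0)"
  by (rule ext) (simp add: partial_eqI[OF has_derivative_const])

lemma partial_add:
  assumes "f differentiable (at x)" "g differentiable (at x)"
  shows "partial i (\<lambda>x. f x + g x) x = partial i f x + partial i g x"
proof -
  obtain f' g' where D: "(f has_derivative f') (at x)" "(g has_derivative g') (at x)"
    using assms by (auto simp: differentiable_def)
  from partial_eqI[OF has_derivative_add[OF this]] show ?thesis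
    by (simp add: partial_eqI[OF D(1)] partial_eqI[OF D(2)])
qed

lemma partial_mult:
  fixes f g :: "real^'n \<Rightarrow> complex"
  assumes "f differentiable (at x)" "g differentiable (at x)"
  shows "partial i (\<lambda>x. f x * g x) x = partial i f x * g x + f x * partial i g x"
proof -
  obtain f' g' where D: "(f has_derivative f') (at x)" "(g has_derivative g') (at x)"
    using assms by (auto simp: differentiable_def)
  from partial_eqI[OF has_derivative_mult[OF this]] show ?thesis
    by (simp add: partial_eqI[OF D(1)] partial_eqI[OF D(2)])
qed

lemma k_smooth_Suc_imp: "k_smooth (Suc k) f \<Longrightarrow> k_smooth k f"
proof (induction k arbitrary: f)
  case 0
  then show ?case
    by (auto intro!: continuous_at_imp_continuous_on differentiable_imp_continuous_within)
qed simp

lemma k_smooth_const [simp]: "k_smooth k (\<lambda>_. c)"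
  by (induction k arbitrary: c) simp_all

lemma k_smooth_add: "k_smooth k f \<Longrightarrow> k_smooth k g \<Longrightarrow> k_smooth k (\<lambda>x. f x + g x)"
proof (induction k arbitrary: f g)
  case (Suc k)
  then have "partial i (\<lambda>x. f x + g x) = (\<lambda>x. partial i f x + partial i g x)" for i
    by (auto simp: partial_add)
  with Suc show ?case by simp
qed (auto intro: continuous_intros)

lemma k_smooth_mult: "k_smooth k f \<Longrightarrow> k_smooth k g \<Longrightarrow> k_smooth k (\<lambda>x. f x * g x)"
proof (induction k arbitrary: f g)
  case (Suc k)
  have "partial i (\<lambda>x. f x * g x) = (\<lambda>x. partial i f x * g x + f x * partial i g x)" for i
    using Suc.prems by (auto simp: partial_mult)
  moreover have "k_smooth k f" "k_smooth k g"
    using Suc.prems k_smooth_Suc_imp by blast+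
  ultimately show ?case
    using Suc by (auto intro!: k_smooth_add)
qed (auto intro: continuous_intros)

lemma k_smooth_coordinate: "k_smooth k (\<lambda>x::real^'n. complex_of_real (x $ i))"
proof (cases k)
  case (Suc m)
  have D: "((\<lambda>x::real^'n. complex_of_real (x $ i)) has_derivative (\<lambda>h. complex_of_real (h $ i))) (at x)" for x
    by (intro has_derivative_of_real bounded_linear_imp_has_derivative bounded_linear_vec_nth)
  have "partial j (\<lambda>x::real^'n. complex_of_real (x $ i)) = (\<lambda>_. complex_of_real (axis j 1 $ i))" for j
    by (rule ext) (rule partial_eqI[OF D])
  with Suc D show ?thesis by (auto simp: differentiable_def)
qed (auto intro!: continuous_intros)

section \<open>A smooth bump function\<close>

definition flat_exp :: "nat \<Rightarrow> real \<Rightarrow> real" where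
  "flat_exp m t = (if t > 0 then exp (- inverse t) * inverse t ^ m else 0)"

lemma flat_exp_tendsto_0: "(flat_exp m \<longlongrightarrow> 0) (at_right 0)"
proof -
  have "((\<lambda>t::real. inverse t ^ m / exp (inverse t)) \<longlongrightarrow> 0) (at_right 0)"
    by (rule filterlim_compose[OF tendsto_power_div_exp_0 filterlim_inverse_at_top_right])
  moreover have "eventually (\<lambda>t. inverse t ^ m / exp (inverse t) = flat_exp m t) (at_right 0)"
    using eventually_at_right_less[of 0]
    by eventually_elim (simp add: flat_exp_def exp_minus field_simps)
  ultimately show ?thesis
    by (rule Lim_transform_eventually)
qed

text \<open>The functions \<open>exp (-1/t) * (1/t)^m\<close> form a family whose span is closed
  under differentiation, so smoothness of every order follows from one induction with
  \<open>m\<close> arbitrary. At 0 the right difference quotient of \<open>flat_exp m\<close> is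
  \<open>flat_exp (Suc m)\<close>, which tends to 0.\<close>

lemma DERIV_flat_exp:
  "DERIV (flat_exp m) t :> flat_exp (m + 2) t - real m * flat_exp (m + 1) t"
proof -
  consider "t > 0" | "t < 0" | "t = 0" by linarith
  then show ?thesis
  proof cases
    case 1
    have "DERIV (\<lambda>t. exp (- inverse t) * inverse t ^ m) t :>
        flat_exp (m + 2) t - real m * flat_exp (m + 1) t"
    proof -
      have a: "DERIV (\<lambda>t. inverse t ^ m) t :> real m * (inverse t ^ (m - Suc 0) * - (inverse t ^ Suc (Suc 0)))"
        using DERIV_power[OF DERIV_inverse[of t], of m] 1 by (simp add: mult.commute)
      have b: "DERIV (\<lambda>t. exp (- inverse t)) t :> exp (- inverse t) * - (- (inverse t ^ Suc (Suc 0)))"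
        using 1 by (intro DERIV_fun_exp DERIV_minus DERIV_inverse) simp
      have "exp (- inverse t) * - (- (inverse t ^ Suc (Suc 0))) * inverse t ^ m
          + real m * (inverse t ^ (m - Suc 0) * - (inverse t ^ Suc (Suc 0))) * exp (- inverse t)
        = flat_exp (m + 2) t - real m * flat_exp (m + 1) t"
        using 1 by (cases m) (simp_all add: flat_exp_def algebra_simps)
      with DERIV_mult[OF b a] show ?thesis by simp
    qed
    moreover have "eventually (\<lambda>s. exp (- inverse s) * inverse s ^ m = flat_exp m s) (nhds t)"
      using eventually_nhds_in_open[of "{0<..}" t] 1 by (auto elim!: eventually_mono simp: flat_exp_def)
    ultimately show ?thesis
      by (subst (asm) DERIV_cong_ev[OF refl _ refl])
  next
    case 2
    have "eventually (\<lambda>s. 0 = flat_exp m s) (nhds t)"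
      using eventually_nhds_in_open[of "{..<0}" t] 2 by (auto elim!: eventually_mono simp: flat_exp_def)
    moreover have "DERIV (\<lambda>_. 0) t :> flat_exp (m + 2) t - real m * flat_exp (m + 1) t"
      using 2 by (simp add: flat_exp_def)
    ultimately show ?thesis
      by (subst (asm) DERIV_cong_ev[OF refl _ refl])
  next
    case 3
    have "((\<lambda>h. flat_exp m h / h) \<longlongrightarrow> 0) (at_right 0)"
    proof (rule Lim_transform_eventually[OF flat_exp_tendsto_0])
      show "eventually (\<lambda>t. flat_exp (Suc m) t = flat_exp m t / t) (at_right 0)"
        using eventually_at_right_less[of 0]
        by eventually_elim (simp add: flat_exp_def field_simps)
    qed
    moreover have "((\<lambda>h. flat_exp m h / h) \<longlongrightarrow> 0) (at_left 0)"
    proof (rule Lim_transform_eventually[OF tendsto_const])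
      show "eventually (\<lambda>t. 0 = flat_exp m t / t) (at_left 0)"
        unfolding eventually_at_left_field
        by (intro exI[of _ "-1"]) (simp add: flat_exp_def)
    qed
    ultimately have "((\<lambda>h. flat_exp m h / h) \<longlongrightarrow> 0) (at 0)"
      using filterlim_split_at_real by blast
    then show ?thesis
      using 3 by (simp add: DERIV_def flat_exp_def)
  qed
qed

lemma has_derivative_flat_exp_norm:
  "((\<lambda>x::real^'n. complex_of_real (flat_exp m (r - (norm x)\<^sup>2))) has_derivative
    (\<lambda>h. complex_of_real ((flat_exp (m + 2) (r - (norm x)\<^sup>2) - real m * flat_exp (m + 1) (r - (norm x)\<^sup>2))
       * (- (2 * (x \<bullet> h)))))) (at x)"
proof -
  have "((\<lambda>x::real^'n. r - x \<bullet> x) has_derivative (\<lambda>h. - (2 * (x \<bullet> h)))) (at x)"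
    by (auto intro!: derivative_eq_intros simp: inner_commute)
  from has_derivative_compose[OF this DERIV_flat_exp[THEN has_field_derivative_imp_has_derivative]]
  show ?thesis
    by (intro has_derivative_of_real) (simp add: power2_norm_eq_inner)
qed

lemma k_smooth_flat_exp_norm:
  "k_smooth k (\<lambda>x::real^'n. complex_of_real (flat_exp m (r - (norm x)\<^sup>2)))"
proof (induction k arbitrary: m)
  case 0
  show ?case
    using has_derivative_continuous[OF has_derivative_flat_exp_norm[where 'n='n, of m r]]
    unfolding k_smooth.simps by (intro continuous_at_imp_continuous_on ballI)
next
  case (Suc k)
  let ?e = "\<lambda>m x. complex_of_real (flat_exp m (r - (norm (x::real^'n))\<^sup>2))"
  have "partial i (?e m) = (\<lambda>x. (?e (m + 2) x + complex_of_real (- real m) * ?e (m + 1) x)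
      * (complex_of_real (- 2) * complex_of_real (x $ i)))" for i
    by (rule ext) (simp add: partial_eqI[OF has_derivative_flat_exp_norm] inner_axis)
  then show ?case
    using has_derivative_flat_exp_norm[where 'n='n, of m r]
    by (simp only: k_smooth.simps)
      (intro conjI allI k_smooth_mult k_smooth_add k_smooth_coordinate k_smooth_const Suc.IH, blast intro: differentiableI)
qed

section \<open>Mollifiers and convolution\<close>

definition supp_within :: "real \<Rightarrow> (real^'n \<Rightarrow> 'b::zero) \<Rightarrow> bool" where
  "supp_within R f \<longleftrightarrow> (\<forall>x. R < norm x \<longrightarrow> f x = 0)"

lemma supp_withinD: "supp_within R f \<Longrightarrow> R < norm x \<Longrightarrow> f x = 0"
  by (simp add: supp_within_def)

lemma integrable_continuous_bounded_support:
  fixes f :: "real^'n \<Rightarrow> 'b::euclidean_space"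
  assumes "continuous_on UNIV f" "supp_within R f"
  shows "integrable lborel f"
proof -
  have "integrable lborel (\<lambda>x. indicator (cball 0 R) x *\<^sub>R f x)"
    using assms(1) by (intro borel_integrable_compact) (auto intro: continuous_on_subset)
  moreover have "(\<lambda>x. indicator (cball 0 R) x *\<^sub>R f x) = f"
    using assms(2) by (auto simp: indicator_def not_le supp_within_def)
  ultimately show ?thesis by simp
qed

lemma bounded_continuous_bounded_support:
  fixes f :: "real^'n \<Rightarrow> 'b::real_normed_vector"
  assumes "continuous_on UNIV f" "supp_within R f"
  obtains B where "0 < B" "\<And>x. norm (f x) \<le> B"
proof -
  have "bounded (f ` cball 0 R)"
    by (intro compact_imp_bounded compact_continuous_image continuous_on_subset[OF assms(1)]) auto
  then obtain B where B: "B > 0" "\<And>y. y \<in> f ` cball 0 R \<Longrightarrow> norm y \<le> B"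
    unfolding bounded_pos by blast
  have "norm (f x) \<le> B" for x
    using B supp_withinD[OF assms(2), of x] by (cases "R < norm x") auto
  with B(1) that show ?thesis by blast
qed

lemma partial_eq_0_open:
  assumes "open T" "x \<in> T" "\<And>y. y \<in> T \<Longrightarrow> f y = 0"
  shows "partial i f x = 0"
proof -
  have "(f has_derivative (\<lambda>_. 0)) (at x)"
    by (rule has_derivative_transform_within_open[OF has_derivative_const assms(1,2)])
       (simp add: assms(3))
  from partial_eqI[OF this] show ?thesis .
qed

text \<open>The exterior of a closed ball is open, so a function that vanishes there has vanishing
  derivatives there. This is why \<open>supp_within\<close> has a strict inequality.\<close>

lemma partial_bounded_support:
  fixes f :: "real^'n \<Rightarrow> complex"
  assumes "supp_within R f"
  shows "supp_within R (partial i f)"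
  unfolding supp_within_def
proof (intro allI impI)
  fix x :: "real^'n" assume x: "R < norm x"
  show "partial i f x = 0"
  proof (rule partial_eq_0_open)
    show "open {y::real^'n. R < norm y}"
      by (intro open_Collect_less continuous_intros)
  qed (use assms x in \<open>auto simp: supp_within_def\<close>)
qed

lemma mollifier_exists:
  assumes "0 < \<epsilon>"
  obtains \<eta> :: "real^'n \<Rightarrow> real"
  where "\<And>k. k_smooth k (\<lambda>x. complex_of_real (\<eta> x))" "\<And>x. 0 \<le> \<eta> x"
    "supp_within \<epsilon> \<eta>" "continuous_on UNIV \<eta>" "integral\<^sup>L lborel \<eta> = 1"
proof -
  define \<beta> :: "real^'n \<Rightarrow> real" where "\<beta> x = flat_exp 0 (\<epsilon>\<^sup>2 - (norm x)\<^sup>2)" for x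
  have sm: "k_smooth k (\<lambda>x. complex_of_real (\<beta> x))" for k
    unfolding \<beta>_def by (rule k_smooth_flat_exp_norm)
  have "continuous_on UNIV (\<lambda>x. Re (complex_of_real (\<beta> x)))"
    using sm[of 0] by (auto intro!: continuous_intros)
  then have cont: "continuous_on UNIV \<beta>" by simp
  have nn: "0 \<le> \<beta> x" for x by (simp add: \<beta>_def flat_exp_def)
  have supp: "supp_within \<epsilon> \<beta>"
    unfolding supp_within_def
  proof (intro allI impI)
    fix x :: "real^'n" assume "\<epsilon> < norm x"
    then have "\<epsilon>\<^sup>2 \<le> (norm x)\<^sup>2" using assms by (intro power_mono) auto
    then show "\<beta> x = 0" by (simp add: \<beta>_def flat_exp_def)
  qed
  \<comment> \<open>Positivity on a ball of positive measure makes the integral nonzero, so that it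
    can be divided out.\<close>
  have pos: "\<beta> x > 0" if "x \<in> ball 0 \<epsilon>" for x
    using that assms power_strict_mono[of "norm x" \<epsilon> 2] by (auto simp: \<beta>_def flat_exp_def)
  have int: "integrable lborel \<beta>"
    by (rule integrable_continuous_bounded_support[OF cont supp])
  have "integral\<^sup>L lborel \<beta> \<noteq> 0"
  proof
    assume "integral\<^sup>L lborel \<beta> = 0"
    then have "AE x in lborel. \<beta> x = 0"
      using integral_nonneg_eq_0_iff_AE[OF int] nn by simp
    then have "AE x in lborel. x \<notin> ball (0::real^'n) \<epsilon>"
      by eventually_elim (use pos in force)
    then have "emeasure lborel (ball (0::real^'n) \<epsilon>) = 0"
      by (subst (asm) AE_iff_measurable[OF _ refl]) (auto simp: ball_def)
    then show False
      using assms unit_ball_vol_pos[of "real CARD('n)"] zero_less_power[of \<epsilon> "CARD('n)"]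
      by (auto simp: emeasure_ball ennreal_eq_0_iff mult_le_0_iff not_le[symmetric])
  qed
  moreover have "0 \<le> integral\<^sup>L lborel \<beta>" using nn by (simp add: integral_nonneg)
  ultimately have I: "0 < integral\<^sup>L lborel \<beta>" by linarith
  show thesis
  proof
    show "k_smooth k (\<lambda>x. complex_of_real (\<beta> x / integral\<^sup>L lborel \<beta>))" for k
      using k_smooth_mult[OF sm k_smooth_const[of k "complex_of_real (1 / integral\<^sup>L lborel \<beta>)"]]
      by (simp add: field_simps)
    show "continuous_on UNIV (\<lambda>x. \<beta> x / integral\<^sup>L lborel \<beta>)"
      using I by (intro continuous_intros cont) auto
  qed (use nn supp I in \<open>auto simp: supp_within_def\<close>)
qed

section \<open>Convolution with a kernel of bounded support\<close>

definition conv :: "(real^'n \<Rightarrow> complex) \<Rightarrow> (real^'n \<Rightarrow> complex) \<Rightarrow> real^'n \<Rightarrow> complex" where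
  "conv f g x = (LINT y|lborel. f y * g (x - y))"

lemma distr_lborel_reflect: "distr lborel borel (\<lambda>y. x - y) = (lborel :: 'a::euclidean_space measure)"
  using lborel_affine[of "-1" x] by (simp add: density_1)

lemma integral_lborel_reflect:
  fixes f :: "'a::euclidean_space \<Rightarrow> 'b::{banach, second_countable_topology}"
  assumes [measurable]: "f \<in> borel_measurable borel"
  shows "(LINT y|lborel. f (x - y)) = integral\<^sup>L lborel f"
  using integral_distr[of "\<lambda>y. x - y" lborel borel f] by (simp add: distr_lborel_reflect)

lemma nn_integral_lborel_translate:
  fixes f :: "'a::euclidean_space \<Rightarrow> ennreal"
  assumes [measurable]: "f \<in> borel_measurable borel"
  shows "(\<integral>\<^sup>+y. f (y + c) \<partial>lborel) = integral\<^sup>N lborel f"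
  using nn_integral_distr[of "(+) c" lborel borel f] by (simp add: lborel_distr_plus add.commute)

lemma conv_commute:
  fixes f g :: "real^'n \<Rightarrow> complex"
  assumes [measurable]: "f \<in> borel_measurable borel" "g \<in> borel_measurable borel"
  shows "conv f g x = conv g f x"
  unfolding conv_def
  using integral_lborel_reflect[of "\<lambda>y. f y * g (x - y)" x] by (simp add: mult.commute)

lemma integrable_conv_kernel:
  fixes f g :: "real^'n \<Rightarrow> complex"
  assumes f: "integrable lborel f" and g: "continuous_on UNIV g" "\<And>x. norm (g x) \<le> B"
  shows "integrable lborel (\<lambda>y. f y * g (x - y :: real^'n) :: complex)"
proof (rule Bochner_Integration.integrable_bound[where f = "\<lambda>y. B * norm (f y)"])
  have [measurable]: "f \<in> borel_measurable borel" "g \<in> borel_measurable borel"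
    using f g(1) by (auto intro: borel_measurable_continuous_onI dest: borel_measurable_integrable)
  show "(\<lambda>y. f y * g (x - y)) \<in> borel_measurable lborel" by measurable
  show "AE y in lborel. norm (f y * g (x - y)) \<le> norm (B * norm (f y))"
  proof (intro AE_I2)
    fix y
    have "0 \<le> B" using g(2)[of 0] norm_ge_zero order_trans by blast
    then show "norm (f y * g (x - y)) \<le> norm (B * norm (f y))"
      using mult_left_mono[OF g(2)[of "x - y"], of "norm (f y)"]
      by (simp add: norm_mult mult.commute)
  qed
qed (use f in simp)

lemma continuous_on_conv:
  fixes f g :: "real^'n \<Rightarrow> complex"
  assumes f: "integrable lborel f" and g: "continuous_on UNIV g" "supp_within R g"
  shows "continuous_on UNIV (conv f g)"
proof (rule continuous_at_imp_continuous_on, rule ballI)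
  fix x :: "real^'n"
  obtain B where B: "0 < B" "\<And>x. norm (g x) \<le> B"
    using bounded_continuous_bounded_support[OF g] by blast
  have [measurable]: "f \<in> borel_measurable borel" "g \<in> borel_measurable borel"
    using f g(1) by (auto intro: borel_measurable_continuous_onI dest: borel_measurable_integrable)
  show "isCont (conv f g) x"
    unfolding continuous_at_sequentially
  proof (intro allI impI)
    fix X :: "nat \<Rightarrow> real^'n" assume X: "X \<longlonglongrightarrow> x"
    show "(conv f g \<circ> X) \<longlonglongrightarrow> conv f g x"
      unfolding o_def conv_def
    proof (rule integral_dominated_convergence[where w = "\<lambda>y. B * norm (f y)"])
      show "AE y in lborel. (\<lambda>i. f y * g (X i - y)) \<longlonglongrightarrow> f y * g (x - y)"
        using g(1) by (intro AE_I2 tendsto_intros continuous_on_tendsto_compose[OF g(1)] X) auto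
      show "AE y in lborel. norm (f y * g (X i - y)) \<le> B * norm (f y)" for i
        using mult_left_mono[OF B(2), of "norm (f _)"] by (auto simp: norm_mult mult.commute)
    qed (use f in \<open>auto\<close>)
  qed
qed

text \<open>Differentiation under the integral sign. A Lipschitz constant \<open>L\<close> of
  \<open>g\<close> bounds both the difference quotient and the linear part, so
  \<open>2 * L * norm (f y)\<close> dominates the integrands \<open>Q h\<close>.\<close>

lemma conv_has_derivative:
  fixes f g :: "real^'n \<Rightarrow> complex"
  assumes f: "integrable lborel f" and g: "k_smooth (Suc 0) g" "supp_within R g"
  shows "(conv f g has_derivative (\<lambda>h. \<Sum>i\<in>UNIV. h $ i *\<^sub>R conv f (partial i g) x)) (at x)"
proof -
  let ?D = "\<lambda>z h. \<Sum>i\<in>UNIV. h $ i *\<^sub>R partial i g z"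
  have dg: "(g has_derivative ?D z) (at z)" for z
    using g(1) by (auto intro: has_derivative_partial)
  have cg: "continuous_on UNIV g" using k_smooth_Suc_imp[OF g(1)] by simp
  have cp: "continuous_on UNIV (partial i g)" for i using g(1) by simp
  have "\<exists>B. 0 < B \<and> (\<forall>x. norm (partial i g x) \<le> B)" for i
    using bounded_continuous_bounded_support[OF cp partial_bounded_support[OF g(2)]] by metis
  then obtain B where B: "\<And>i. 0 < B i" "\<And>i x. norm (partial i g x) \<le> B i" by metis
  define L where "L = sum B UNIV"
  have L: "0 \<le> L" unfolding L_def using B(1) by (simp add: sum_nonneg less_imp_le)
  have D: "norm (?D z h) \<le> L * norm h" for z h
  proof -
    have "norm (?D z h) \<le> (\<Sum>i\<in>UNIV. \<bar>h $ i\<bar> * norm (partial i g z))"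
      by (rule order_trans[OF norm_sum]) simp
    also have "\<dots> \<le> (\<Sum>i\<in>UNIV. norm h * B i)"
      by (intro sum_mono mult_mono component_le_norm_cart B) auto
    finally show ?thesis by (simp add: L_def sum_distrib_left mult.commute)
  qed
  have lip: "norm (g z - g w) \<le> L * norm (z - w)" for z w
    by (rule differentiable_bound[of UNIV, OF _ dg]) (auto intro: onorm_bound D L)
  obtain B0 where B0: "0 < B0" "\<And>x. norm (g x) \<le> B0"
    using bounded_continuous_bounded_support[OF cg g(2)] by blast
  have mf [measurable]: "f \<in> borel_measurable borel" "g \<in> borel_measurable borel"
      "\<And>i. partial i g \<in> borel_measurable borel"
    using f cg cp by (auto intro: borel_measurable_continuous_onI dest: borel_measurable_integrable)
  note i0 = integrable_conv_kernel[OF f cg B0(2)]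
  note ip = integrable_conv_kernel[OF f cp B(2)]
  define Q where "Q h y = f y * (g (x + h - y) - g (x - y) - ?D (x - y) h) /\<^sub>R norm h" for h y
  have Qint: "integral\<^sup>L lborel (Q h) =
      (conv f g (x + h) - conv f g x - (\<Sum>i\<in>UNIV. h $ i *\<^sub>R conv f (partial i g) x)) /\<^sub>R norm h" for h
  proof -
    have "Q h = (\<lambda>y. (f y * g (x + h - y) - f y * g (x - y)
        - (\<Sum>i\<in>UNIV. h $ i *\<^sub>R (f y * partial i g (x - y)))) /\<^sub>R norm h)"
      by (rule ext) (simp add: Q_def right_diff_distrib sum_distrib_left)
    then show ?thesis
      unfolding conv_def
      by (simp add: integral_diff integral_sum i0 ip del: scaleR_right_diff_distrib)
  qed
  show ?thesis
    unfolding has_derivative_at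
  proof (intro conjI)
    show "bounded_linear (\<lambda>h. \<Sum>i\<in>UNIV. h $ i *\<^sub>R conv f (partial i g) x)"
      by (intro bounded_linear_sum bounded_linear_scaleR_const bounded_linear_vec_nth)
    show "(\<lambda>h. norm (conv f g (x + h) - conv f g x - (\<Sum>i\<in>UNIV. h $ i *\<^sub>R conv f (partial i g) x)) / norm h)
        \<midarrow>0\<rightarrow> 0"
      unfolding tendsto_at_iff_sequentially
    proof (intro allI impI)
      fix X :: "nat \<Rightarrow> real^'n" assume X: "\<forall>i. X i \<in> UNIV - {0}" "X \<longlonglongrightarrow> 0"
      have "(\<lambda>k. integral\<^sup>L lborel (Q (X k))) \<longlonglongrightarrow> integral\<^sup>L lborel (\<lambda>_::real^'n. 0)"
      proof (rule integral_dominated_convergence[where w = "\<lambda>y. 2 * L * norm (f y)"])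
        show "AE y in lborel. (\<lambda>k. Q (X k) y) \<longlonglongrightarrow> 0"
        proof (intro AE_I2)
          fix y
          have "(\<lambda>h. norm (g (x - y + h) - g (x - y) - ?D (x - y) h) / norm h) \<midarrow>0\<rightarrow> 0"
            using dg[of "x - y"] by (simp add: has_derivative_at)
          then have "(\<lambda>k. norm (g (x - y + X k) - g (x - y) - ?D (x - y) (X k)) / norm (X k)) \<longlonglongrightarrow> 0"
            using X unfolding tendsto_at_iff_sequentially o_def by blast
          note lim = tendsto_mult_right_zero[OF this, of "norm (f y)"]
          have e: "x + h - y = x - y + h" for h by simp
          have "norm (Q h y) = norm (f y) * (norm (g (x - y + h) - g (x - y) - ?D (x - y) h) / norm h)" for h
            unfolding Q_def e norm_scaleR norm_mult by (simp add: divide_inverse ac_simps)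
          then have "(\<lambda>k. norm (Q (X k) y)) \<longlonglongrightarrow> 0"
            using lim by simp
          then show "(\<lambda>k. Q (X k) y) \<longlonglongrightarrow> 0" by (rule tendsto_norm_zero_cancel)
        qed
        show "AE y in lborel. norm (Q (X k) y) \<le> 2 * L * norm (f y)" for k
        proof (intro AE_I2)
          fix y
          have Xk: "norm (X k) > 0" using X(1) by simp
          have "norm (g (x + X k - y) - g (x - y) - ?D (x - y) (X k)) \<le> L * norm (X k) + L * norm (X k)"
            using lip[of "x + X k - y" "x - y"] D[of "X k" "x - y"]
              norm_triangle_ineq4[of "g (x + X k - y) - g (x - y)" "?D (x - y) (X k)"]
            by simp
          then have "norm (g (x + X k - y) - g (x - y) - ?D (x - y) (X k)) / norm (X k) \<le> 2 * L"
            using Xk by (simp add: divide_le_eq)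
          from mult_left_mono[OF this, of "norm (f y)"]
          show "norm (Q (X k) y) \<le> 2 * L * norm (f y)"
            by (simp add: Q_def norm_mult divide_inverse mult.assoc mult.left_commute mult.commute)
        qed
        show "Q (X k) \<in> borel_measurable lborel" for k
          unfolding Q_def by measurable
      qed (use f in auto)
      then have "(\<lambda>k. norm (integral\<^sup>L lborel (Q (X k)))) \<longlonglongrightarrow> 0"
        by (simp add: tendsto_norm_zero)
      then show "((\<lambda>h. norm (conv f g (x + h) - conv f g x - (\<Sum>i\<in>UNIV. h $ i *\<^sub>R conv f (partial i g) x)) / norm h) \<circ> X)
          \<longlonglongrightarrow> 0"
        by (simp add: Qint o_def divide_inverse mult.commute)
    qed
  qed
qed

lemma partial_conv:
  fixes f g :: "real^'n \<Rightarrow> complex"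
  assumes "integrable lborel f" "k_smooth (Suc 0) g" "supp_within R g"
  shows "partial i (conv f g) = conv f (partial i g)"
proof
  fix x
  show "partial i (conv f g) x = conv f (partial i g) x"
    unfolding partial_eqI[OF conv_has_derivative[OF assms]]
    by (simp add: axis_def if_distrib[where f="\<lambda>a. a *\<^sub>R _"] cong: if_cong)
qed

lemma k_smooth_mono: "k_smooth k f \<Longrightarrow> m \<le> k \<Longrightarrow> k_smooth m f"
  by (induction k) (auto simp: le_Suc_eq dest: k_smooth_Suc_imp simp del: k_smooth.simps(2))

lemma k_smooth_conv:
  fixes f g :: "real^'n \<Rightarrow> complex"
  assumes "integrable lborel f" "k_smooth k g" "supp_within R g"
  shows "k_smooth k (conv f g)"
  using assms(2,3)
proof (induction k arbitrary: g)
  case 0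
  then show ?case using continuous_on_conv[OF assms(1)] by simp
next
  case (Suc k)
  have "k_smooth (Suc 0) g"
    using Suc.prems(1) k_smooth_mono by blast
  note * = this Suc.prems(2)
  have "k_smooth k (conv f (partial i g))" for i
    using Suc.prems by (intro Suc.IH partial_bounded_support) auto
  then show ?case
    using conv_has_derivative[OF assms(1) *] partial_conv[OF assms(1) *]
    by (auto simp: differentiable_def)
qed

section \<open>Mean-square convergence of mollifications\<close>

text \<open>The squared L2 norm, valued in \<open>ennreal\<close> so that Fubini and the triangle
  inequality carry no integrability conditions.\<close>

definition l2sq :: "(real^'n \<Rightarrow> 'b::real_normed_vector) \<Rightarrow> ennreal" where
  "l2sq f = (\<integral>\<^sup>+x. ennreal ((norm (f x))\<^sup>2) \<partial>lborel)"

lemma norm_add_squared_le: "(norm (a + b))\<^sup>2 \<le> 2 * (norm a)\<^sup>2 + 2 * (norm b)\<^sup>2"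
proof -
  have "(norm (a + b))\<^sup>2 \<le> (norm a + norm b)\<^sup>2"
    by (intro power_mono norm_triangle_ineq) simp
  also have "\<dots> \<le> 2 * (norm a)\<^sup>2 + 2 * (norm b)\<^sup>2"
    using zero_le_power2[of "norm a - norm b"] by (simp add: power2_eq_square algebra_simps)
  finally show ?thesis .
qed

lemma l2sq_add_le:
  fixes f g :: "real^'n \<Rightarrow> 'b::euclidean_space"
  assumes [measurable]: "f \<in> borel_measurable borel" "g \<in> borel_measurable borel"
  shows "l2sq (\<lambda>x. f x + g x) \<le> 2 * l2sq f + 2 * l2sq g"
proof -
  have "l2sq (\<lambda>x. f x + g x) \<le>
      (\<integral>\<^sup>+x. 2 * ennreal ((norm (f x))\<^sup>2) + 2 * ennreal ((norm (g x))\<^sup>2) \<partial>lborel)"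
    unfolding l2sq_def
  proof (rule nn_integral_mono)
    fix x
    have "ennreal ((norm (f x + g x))\<^sup>2) \<le> ennreal (2 * (norm (f x))\<^sup>2 + 2 * (norm (g x))\<^sup>2)"
      by (intro ennreal_leI norm_add_squared_le)
    then show "ennreal ((norm (f x + g x))\<^sup>2) \<le> 2 * ennreal ((norm (f x))\<^sup>2) + 2 * ennreal ((norm (g x))\<^sup>2)"
      by (simp add: ennreal_mult)
  qed
  also have "\<dots> = 2 * l2sq f + 2 * l2sq g"
    unfolding l2sq_def by (simp add: nn_integral_add nn_integral_cmult)
  finally show ?thesis .
qed

lemma integrable_if_l2sq_finite:
  fixes f :: "real^'n \<Rightarrow> 'b::euclidean_space"
  assumes [measurable]: "f \<in> borel_measurable borel" and "l2sq f < \<infinity>" "supp_within R f"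
  shows "integrable lborel f"
proof (rule Bochner_Integration.integrable_bound)
  have "integrable lborel (\<lambda>x. (norm (f x))\<^sup>2)"
    using assms(2) by (intro integrableI_nonneg) (auto simp: l2sq_def)
  then show "integrable lborel (\<lambda>x. indicat_real (cball (0::real^'n) R) x + (norm (f x))\<^sup>2)"
    by (intro Bochner_Integration.integrable_add integrable_real_indicator)
      (use emeasure_bounded_finite[of "cball (0::real^'n) R"] in auto)
  show "AE x in lborel. norm (f x) \<le> norm (indicat_real (cball (0::real^'n) R) x + (norm (f x))\<^sup>2)"
  proof (intro AE_I2)
    fix x
    have "norm (f x) \<le> 1 + (norm (f x))\<^sup>2"
    proof -
      have "2 * norm (f x) \<le> (norm (f x))\<^sup>2 + 1"
        using zero_le_power2[of "norm (f x) - 1"] unfolding power2_diff by simp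
      then show ?thesis using norm_ge_zero[of "f x"] by linarith
    qed
    then show "norm (f x) \<le> norm (indicat_real (cball (0::real^'n) R) x + (norm (f x))\<^sup>2)"
      using supp_withinD[OF assms(3), of x] by (cases "R < norm x") auto
  qed
qed simp

lemma AE_lborel_not_in_negligible:
  assumes "negligible N"
  shows "AE x in lborel. x \<notin> N"
proof -
  obtain N' where "N' \<in> null_sets lborel" "N \<subseteq> N'"
    using assms unfolding negligible_iff_null_sets null_sets_completion_iff2 by blast
  then show ?thesis by (intro AE_I'[of N']) auto
qed

text \<open>Truncation at height \<open>m\<close> reduces to bounded \<open>f\<close>. A Lebesgue
  measurable function is an almost everywhere limit of continuous ones, and once these are made
  uniformly bounded with common bounded support, dominated convergence gives the limit in
  L2.\<close>

lemma l2_dense_continuous: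
  fixes f :: "real^'n \<Rightarrow> 'b::euclidean_space"
  assumes f [measurable]: "f \<in> borel_measurable borel" and fin: "l2sq f < \<infinity>"
    and supp: "supp_within R f" and "0 < \<delta>"
  obtains g where "continuous_on UNIV g" "supp_within (R + 1) g" "l2sq (\<lambda>x. f x - g x) \<le> ennreal \<delta>"
proof -
  define F where "F m x = (if norm (f x) \<le> real m then f x else 0)" for m x
  have F [measurable]: "F m \<in> borel_measurable borel" for m unfolding F_def by measurable
  have "(\<lambda>m. \<integral>\<^sup>+x. ennreal ((norm (f x - F m x))\<^sup>2) \<partial>lborel) \<longlonglongrightarrow> (\<integral>\<^sup>+x. 0 \<partial>(lborel::(real^'n) measure))"
  proof (rule nn_integral_dominated_convergence[where w = "\<lambda>x. ennreal ((norm (f x))\<^sup>2)"])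
    show "AE x in lborel. (\<lambda>m. ennreal ((norm (f x - F m x))\<^sup>2)) \<longlonglongrightarrow> 0"
    proof (intro AE_I2)
      fix x
      obtain M where "norm (f x) \<le> real M" using real_arch_simple by blast
      then have "eventually (\<lambda>m. ennreal ((norm (f x - F m x))\<^sup>2) = 0) sequentially"
        unfolding eventually_sequentially F_def by (intro exI[of _ M]) auto
      then show "(\<lambda>m. ennreal ((norm (f x - F m x))\<^sup>2)) \<longlonglongrightarrow> 0"
        by (rule tendsto_eventually)
    qed
  qed (use fin in \<open>auto simp: l2sq_def F_def\<close>)
  then have "(\<lambda>m. l2sq (\<lambda>x. f x - F m x)) \<longlonglongrightarrow> 0" by (simp add: l2sq_def)
  from order_tendstoD(2)[OF this, of "ennreal (\<delta> / 4)"]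
  have "eventually (\<lambda>m. l2sq (\<lambda>x. f x - F m x) < ennreal (\<delta> / 4)) sequentially"
    using assms(4) by simp
  then obtain m where m: "l2sq (\<lambda>x. f x - F m x) < ennreal (\<delta> / 4)"
    unfolding eventually_sequentially by blast
  have "F m \<in> borel_measurable lebesgue"
    using F[of m] by (simp add: measurable_completion)
  then have "F m measurable_on UNIV"
    by (rule lebesgue_measurable_imp_measurable_on) simp
  then obtain N g where N: "negligible N" and g: "\<And>n. continuous_on UNIV (g n)"
    and lim: "\<And>x. x \<notin> N \<Longrightarrow> (\<lambda>n. g n x) \<longlonglongrightarrow> F m x"
    unfolding measurable_on_def by auto
  let ?c = "closest_point (cball (0::'b) (real m))"
  define cut where "cut x = max 0 (min 1 (R + 1 - norm x))" for x :: "real^'n"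
  define G where "G n x = cut x *\<^sub>R ?c (g n x)" for n x
  have [measurable]: "cball (0::real^'n) (R + 1) \<in> sets borel" by simp
  have cc: "continuous_on UNIV ?c"
    by (intro continuous_on_closest_point) auto
  have cG: "continuous_on UNIV (G n)" for n
    unfolding G_def cut_def
    by (intro continuous_intros continuous_on_compose2[OF cc g]) auto
  then have [measurable]: "G n \<in> borel_measurable borel" for n
    by (rule borel_measurable_continuous_onI)
  have sG: "supp_within (R + 1) (G n)" for n
    by (auto simp: supp_within_def G_def cut_def)
  have nc: "norm (?c y) \<le> real m" for y
    using closest_point_in_set[of "cball (0::'b) (real m)" y] by simp
  have nG: "norm (G n x) \<le> real m" for n x
  proof -
    have "norm (G n x) \<le> 1 * real m"
      unfolding G_def norm_scaleR by (intro mult_mono nc) (auto simp: cut_def)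
    then show ?thesis by simp
  qed
  have "(\<lambda>n. \<integral>\<^sup>+x. ennreal ((norm (F m x - G n x))\<^sup>2) \<partial>lborel) \<longlonglongrightarrow> (\<integral>\<^sup>+x. 0 \<partial>(lborel::(real^'n) measure))"
  proof (rule nn_integral_dominated_convergence[where
        w = "\<lambda>x. ennreal ((2 * real m)\<^sup>2) * indicator (cball 0 (R + 1)) x"])
    show "AE x in lborel. ennreal ((norm (F m x - G n x))\<^sup>2)
        \<le> ennreal ((2 * real m)\<^sup>2) * indicator (cball 0 (R + 1)) x" for n
    proof (intro AE_I2)
      fix x
      have "norm (F m x - G n x) \<le> norm (F m x) + norm (G n x)" by (rule norm_triangle_ineq4)
      also have "\<dots> \<le> 2 * real m" using nG[of n x] by (auto simp: F_def)
      finally have "(norm (F m x - G n x))\<^sup>2 \<le> (2 * real m)\<^sup>2" by (intro power_mono) auto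
      then show "ennreal ((norm (F m x - G n x))\<^sup>2)
          \<le> ennreal ((2 * real m)\<^sup>2) * indicator (cball 0 (R + 1)) x"
        using supp_withinD[OF supp, of x] supp_withinD[OF sG, of x n]
        by (cases "R + 1 < norm x") (auto simp: F_def intro!: ennreal_leI)
    qed
    show "(\<integral>\<^sup>+x. ennreal ((2 * real m)\<^sup>2) * indicator (cball (0::real^'n) (R + 1)) x \<partial>lborel) < \<infinity>"
      using emeasure_bounded_finite[of "cball (0::real^'n) (R + 1)"]
      by (simp add: nn_integral_cmult_indicator ennreal_mult_less_top)
    show "AE x in lborel. (\<lambda>n. ennreal ((norm (F m x - G n x))\<^sup>2)) \<longlonglongrightarrow> 0"
      using AE_lborel_not_in_negligible[OF N]
    proof eventually_elim
      fix x assume "x \<notin> N"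
      have "(\<lambda>n. G n x) \<longlonglongrightarrow> cut x *\<^sub>R ?c (F m x)"
        unfolding G_def
        by (intro tendsto_intros continuous_on_tendsto_compose[OF cc] lim \<open>x \<notin> N\<close>) auto
      moreover have "cut x *\<^sub>R ?c (F m x) = F m x"
        using supp_withinD[OF supp, of x] by (cases "R < norm x") (auto simp: F_def closest_point_self cut_def)
      ultimately have "(\<lambda>n. ennreal ((norm (F m x - G n x))\<^sup>2)) \<longlonglongrightarrow> ennreal ((norm (F m x - F m x))\<^sup>2)"
        by (intro tendsto_intros) auto
      then show "(\<lambda>n. ennreal ((norm (F m x - G n x))\<^sup>2)) \<longlonglongrightarrow> 0" by simp
    qed
  qed auto
  then have "(\<lambda>n. l2sq (\<lambda>x. F m x - G n x)) \<longlonglongrightarrow> 0" by (simp add: l2sq_def)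
  from order_tendstoD(2)[OF this, of "ennreal (\<delta> / 4)"]
  have "eventually (\<lambda>n. l2sq (\<lambda>x. F m x - G n x) < ennreal (\<delta> / 4)) sequentially"
    using assms(4) by simp
  then obtain n where n: "l2sq (\<lambda>x. F m x - G n x) < ennreal (\<delta> / 4)"
    unfolding eventually_sequentially by blast
  have "l2sq (\<lambda>x. f x - G n x) = l2sq (\<lambda>x. (f x - F m x) + (F m x - G n x))" by simp
  also have "\<dots> \<le> 2 * l2sq (\<lambda>x. f x - F m x) + 2 * l2sq (\<lambda>x. F m x - G n x)"
    by (rule l2sq_add_le) auto
  also have "\<dots> \<le> 2 * ennreal (\<delta> / 4) + 2 * ennreal (\<delta> / 4)"
    using m n by (intro add_mono mult_left_mono) auto
  also have "\<dots> = ennreal \<delta>"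
    using assms(4) by (simp flip: ennreal_plus ennreal_numeral ennreal_mult)
  finally show thesis using cG sG that by blast
qed

section \<open>Continuity of translations in L2\<close>

lemma l2sq_translate:
  fixes f :: "real^'n \<Rightarrow> 'b::euclidean_space"
  assumes [measurable]: "f \<in> borel_measurable borel"
  shows "l2sq (\<lambda>x. f (x - h)) = l2sq f"
  using nn_integral_lborel_translate[of "\<lambda>x. ennreal ((norm (f x))\<^sup>2)" "- h"]
  by (simp add: l2sq_def)

lemma l2_translation_continuous:
  fixes f :: "real^'n \<Rightarrow> 'b::euclidean_space"
  assumes f [measurable]: "f \<in> borel_measurable borel" and fin: "l2sq f < \<infinity>"
    and supp: "supp_within R f" and "0 < \<delta>"
  obtains e where "0 < e" "\<And>h. norm h \<le> e \<Longrightarrow> l2sq (\<lambda>x. f (x - h) - f x) \<le> ennreal \<delta>"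
proof -
  \<comment> \<open>The inequality for squares of sums is applied twice below, which gives
    \<open>2 * (1/4) + 4 * (1/16) + 4 * (1/16) = 1\<close> times \<delta>.\<close>
  obtain g where g: "continuous_on UNIV g" "supp_within (R + 1) g" "l2sq (\<lambda>x. f x - g x) \<le> ennreal (\<delta> / 16)"
    using l2_dense_continuous[OF f fin supp, of "\<delta> / 16"] assms(4) by auto
  have [measurable]: "g \<in> borel_measurable borel" by (rule borel_measurable_continuous_onI[OF g(1)])
  define v where "v = measure lborel (cball (0::real^'n) (R + 2))"
  have v: "emeasure lborel (cball (0::real^'n) (R + 2)) = ennreal v"
    unfolding v_def by (rule emeasure_eq_ennreal_measure) (use emeasure_bounded_finite[of "cball (0::real^'n) (R + 2)"] in \<open>simp add: top.not_eq_extremum\<close>)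
  \<comment> \<open>A uniform error \<open>s\<close> on a set of measure \<open>v\<close> costs
    \<open>s^2 * v\<close>; the summand 1 keeps the quotient meaningful when
    \<open>v = 0\<close>.\<close>
  define s where "s = sqrt (\<delta> / (4 * (v + 1)))"
  have v0: "0 \<le> v" by (simp add: v_def)
  have s: "0 < s" "s\<^sup>2 * v \<le> \<delta> / 4"
    using assms(4) v0 by (auto simp: s_def field_simps)
  have "uniformly_continuous_on (cball 0 (R + 3)) g"
    by (intro compact_uniformly_continuous continuous_on_subset[OF g(1)]) auto
  then obtain d where d: "0 < d" "\<And>x x'. x \<in> cball 0 (R + 3) \<Longrightarrow> x' \<in> cball 0 (R + 3) \<Longrightarrow>
      dist x' x < d \<Longrightarrow> dist (g x') (g x) < s"
    using s(1) unfolding uniformly_continuous_on_def by metis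
  have "l2sq (\<lambda>x. f (x - h) - f x) \<le> ennreal \<delta>" if h: "norm h \<le> min 1 (d / 2)" for h
  proof -
    have gs: "norm (g (x - h) - g x) \<le> s" for x
    proof (cases "norm x \<le> R + 2")
      case True
      then have "norm (x - h) \<le> R + 3" using norm_triangle_ineq4[of x h] h by simp
      then show ?thesis
        using d(2)[of x "x - h"] True h d(1) by (simp add: dist_norm norm_minus_commute[of h x])
    next
      case False
      then have "R + 1 < norm (x - h)" using norm_triangle_ineq2[of x h] h by simp
      then show ?thesis
        using supp_withinD[OF g(2)] False s(1) by simp
    qed
    have g0: "g (x - h) - g x = 0" if "R + 2 < norm x" for x
    proof -
      have "R + 1 < norm (x - h)" using norm_triangle_ineq2[of x h] h that by simp
      then show ?thesis using supp_withinD[OF g(2)] that by simp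
    qed
    have "l2sq (\<lambda>x. g (x - h) - g x) \<le> (\<integral>\<^sup>+x. ennreal (s\<^sup>2) * indicator (cball (0::real^'n) (R + 2)) x \<partial>lborel)"
      unfolding l2sq_def
    proof (rule nn_integral_mono)
      fix x
      have "(norm (g (x - h) - g x))\<^sup>2 \<le> s\<^sup>2" by (intro power_mono gs) simp
      then show "ennreal ((norm (g (x - h) - g x))\<^sup>2) \<le> ennreal (s\<^sup>2) * indicator (cball 0 (R + 2)) x"
        using g0[of x] by (cases "R + 2 < norm x") (auto intro!: ennreal_leI)
    qed
    also have "\<dots> = ennreal (s\<^sup>2 * v)"
      using v0 by (simp add: nn_integral_cmult_indicator v ennreal_mult)
    also have "\<dots> \<le> ennreal (\<delta> / 4)" using s(2) by (rule ennreal_leI)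
    finally have 1: "l2sq (\<lambda>x. g (x - h) - g x) \<le> ennreal (\<delta> / 4)" .
    have 2: "l2sq (\<lambda>x. f (x - h) - g (x - h)) \<le> ennreal (\<delta> / 16)"
      using l2sq_translate[of "\<lambda>x. f x - g x" h] g(3) by simp
    have "l2sq (\<lambda>x. g x - f x) = l2sq (\<lambda>x. f x - g x)" by (simp add: l2sq_def norm_minus_commute)
    with g(3) have 3: "l2sq (\<lambda>x. g x - f x) \<le> ennreal (\<delta> / 16)" by simp
    have "l2sq (\<lambda>x. f (x - h) - f x) = l2sq (\<lambda>x. (g (x - h) - g x) + ((f (x - h) - g (x - h)) + (g x - f x)))"
      by simp
    also have "\<dots> \<le> 2 * l2sq (\<lambda>x. g (x - h) - g x) + 2 * l2sq (\<lambda>x. (f (x - h) - g (x - h)) + (g x - f x))"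
      by (rule l2sq_add_le) auto
    also have "\<dots> \<le> 2 * l2sq (\<lambda>x. g (x - h) - g x)
        + 2 * (2 * l2sq (\<lambda>x. f (x - h) - g (x - h)) + 2 * l2sq (\<lambda>x. g x - f x))"
      by (intro add_mono mult_left_mono l2sq_add_le) auto
    also have "\<dots> \<le> 2 * ennreal (\<delta> / 4) + 2 * (2 * ennreal (\<delta> / 16) + 2 * ennreal (\<delta> / 16))"
      using 1 2 3 by (intro add_mono mult_left_mono) auto
    also have "\<dots> \<le> ennreal \<delta>"
      using assms(4) by (simp flip: ennreal_plus ennreal_numeral ennreal_mult)
    finally show ?thesis .
  qed
  then show thesis using d(1) by (intro that[of "min 1 (d / 2)"]) auto
qed


text \<open>A convolution with a real kernel whose values may lie in any Euclidean space. A function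
  and its weak gradient can thus be mollified as one pair and share one majorant.\<close>

definition moll :: "(real^'n \<Rightarrow> real) \<Rightarrow> (real^'n \<Rightarrow> 'b::euclidean_space) \<Rightarrow> real^'n \<Rightarrow> 'b" where
  "moll \<eta> f x = (LINT y|lborel. \<eta> (x - y) *\<^sub>R f y)"

definition mollifier :: "real \<Rightarrow> (real^'n \<Rightarrow> real) \<Rightarrow> bool" where
  "mollifier \<epsilon> \<eta> \<longleftrightarrow> (\<forall>k. k_smooth k (\<lambda>x. complex_of_real (\<eta> x))) \<and> (\<forall>x. 0 \<le> \<eta> x) \<and>
     supp_within \<epsilon> \<eta> \<and> continuous_on UNIV \<eta> \<and> integral\<^sup>L lborel \<eta> = 1"

lemma mollifier_integrable: "mollifier \<epsilon> \<eta> \<Longrightarrow> integrable lborel \<eta>"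
  unfolding mollifier_def by (elim conjE) (rule integrable_continuous_bounded_support)

lemma mollifier_measurable: "mollifier \<epsilon> \<eta> \<Longrightarrow> \<eta> \<in> borel_measurable borel"
  unfolding mollifier_def by (elim conjE) (rule borel_measurable_continuous_onI)

lemma integrable_moll:
  fixes f :: "real^'n \<Rightarrow> 'b::euclidean_space"
  assumes m: "mollifier \<epsilon> \<eta>" and f: "integrable lborel f"
  shows "integrable lborel (\<lambda>y. \<eta> (x - y) *\<^sub>R f y)"
proof -
  obtain B where B: "\<And>x. norm (\<eta> x) \<le> B"
    by (rule bounded_continuous_bounded_support[of \<eta> \<epsilon>]) (use m in \<open>auto simp: mollifier_def\<close>)
  have [measurable]: "\<eta> \<in> borel_measurable borel" "f \<in> borel_measurable borel"
    using mollifier_measurable[OF m] f by auto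
  show ?thesis
  proof (rule Bochner_Integration.integrable_bound[where f = "\<lambda>y. B * norm (f y)"])
    show "AE y in lborel. norm (\<eta> (x - y) *\<^sub>R f y) \<le> norm (B * norm (f y))"
    proof (intro AE_I2)
      fix y
      show "norm (\<eta> (x - y) *\<^sub>R f y) \<le> norm (B * norm (f y))"
        using mult_right_mono[OF order_trans[OF B[of "x - y"] abs_ge_self], of "norm (f y)"]
        by (simp add: abs_mult)
    qed
  qed (use f in auto)
qed

text \<open>The kernel is a probability density on the ball of radius \<epsilon>, so the error at
  \<open>x\<close> is an average of differences between translates and \<open>f\<close>.
  Cauchy-Schwarz, with the density split into two square roots, moves the square inside the average,
  and Fubini reduces to a single translation.\<close>

lemma l2sq_moll_diff_le:
  fixes f :: "real^'n \<Rightarrow> 'b::euclidean_space"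
  assumes m: "mollifier \<epsilon> \<eta>" and f: "integrable lborel f"
    and c: "\<And>h. norm h \<le> \<epsilon> \<Longrightarrow> l2sq (\<lambda>x. f (x - h) - f x) \<le> c"
  shows "l2sq (\<lambda>x. moll \<eta> f x - f x) \<le> c"
proof -
  have mm [measurable]: "\<eta> \<in> borel_measurable borel" "f \<in> borel_measurable borel"
    using mollifier_measurable[OF m] f by auto
  have nn: "0 \<le> \<eta> x" for x using m by (simp add: mollifier_def)
  have i1: "(\<integral>\<^sup>+z. ennreal (\<eta> z) \<partial>lborel) = 1"
    using m nn_integral_eq_integral[OF mollifier_integrable[OF m]] nn by (simp add: mollifier_def)
  have "ennreal ((norm (moll \<eta> f x - f x))\<^sup>2) \<le>
      (\<integral>\<^sup>+z. ennreal (\<eta> z) * ennreal ((norm (f (x - z) - f x))\<^sup>2) \<partial>lborel)" for x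
  proof -
    have a: "moll \<eta> f x = (LINT z|lborel. \<eta> z *\<^sub>R f (x - z))"
      unfolding moll_def using integral_lborel_reflect[of "\<lambda>y. \<eta> (x - y) *\<^sub>R f y" x] by simp
    have ia: "integrable lborel (\<lambda>z. \<eta> z *\<^sub>R f (x - z))"
      using integrable_distr[of "\<lambda>y. x - y" lborel borel "\<lambda>y. \<eta> (x - y) *\<^sub>R f y"]
        integrable_moll[OF m f, of x] by (simp add: distr_lborel_reflect)
    have ib: "integrable lborel (\<lambda>z. \<eta> z *\<^sub>R f x)"
      using mollifier_integrable[OF m] by simp
    have "f x = (LINT z|lborel. \<eta> z *\<^sub>R f x)"
      using m mollifier_integrable[OF m] by (simp add: mollifier_def)
    then have "moll \<eta> f x - f x = (LINT z|lborel. \<eta> z *\<^sub>R (f (x - z) - f x))"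
      using Bochner_Integration.integral_diff[OF ia ib] a by (simp add: scaleR_diff_right)
    then have "ennreal (norm (moll \<eta> f x - f x)) \<le> (\<integral>\<^sup>+z. ennreal (norm (\<eta> z *\<^sub>R (f (x - z) - f x))) \<partial>lborel)"
      using integral_norm_bound_ennreal[OF Bochner_Integration.integrable_diff[OF ia ib]]
      by (simp add: scaleR_diff_right)
    also have "\<dots> = (\<integral>\<^sup>+z. ennreal (sqrt (\<eta> z)) * ennreal (sqrt (\<eta> z) * norm (f (x - z) - f x)) \<partial>lborel)"
    proof (rule nn_integral_cong)
      fix z
      have "\<eta> z = sqrt (\<eta> z) * sqrt (\<eta> z)" using nn by simp
      then have "norm (\<eta> z *\<^sub>R (f (x - z) - f x)) = sqrt (\<eta> z) * (sqrt (\<eta> z) * norm (f (x - z) - f x))"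
        using nn[of z] by simp
      then show "ennreal (norm (\<eta> z *\<^sub>R (f (x - z) - f x))) =
          ennreal (sqrt (\<eta> z)) * ennreal (sqrt (\<eta> z) * norm (f (x - z) - f x))"
        using nn[of z] by (simp only: ennreal_mult real_sqrt_ge_zero norm_ge_zero mult_nonneg_nonneg)
    qed
    finally have "(ennreal (norm (moll \<eta> f x - f x)))\<^sup>2 \<le> \<dots>\<^sup>2"
      by (rule power_mono) simp
    also have "\<dots> \<le> (\<integral>\<^sup>+z. (ennreal (sqrt (\<eta> z)))\<^sup>2 \<partial>lborel) *
        (\<integral>\<^sup>+z. (ennreal (sqrt (\<eta> z) * norm (f (x - z) - f x)))\<^sup>2 \<partial>lborel)"
      by (rule Cauchy_Schwarz_nn_integral) auto
    also have "\<dots> = (\<integral>\<^sup>+z. ennreal (\<eta> z) * ennreal ((norm (f (x - z) - f x))\<^sup>2) \<partial>lborel)"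
      using nn i1 by (simp add: ennreal_power power_mult_distrib ennreal_mult)
    finally show ?thesis by (simp add: ennreal_power)
  qed
  then have "l2sq (\<lambda>x. moll \<eta> f x - f x) \<le>
      (\<integral>\<^sup>+x. (\<integral>\<^sup>+z. ennreal (\<eta> z) * ennreal ((norm (f (x - z) - f x))\<^sup>2) \<partial>lborel) \<partial>lborel)"
    unfolding l2sq_def by (intro nn_integral_mono)
  also have "\<dots> = (\<integral>\<^sup>+z. (\<integral>\<^sup>+x. ennreal (\<eta> z) * ennreal ((norm (f (x - z) - f x))\<^sup>2) \<partial>lborel) \<partial>lborel)"
    by (rule lborel_pair.Fubini'[symmetric]) measurable
  also have "\<dots> = (\<integral>\<^sup>+z. ennreal (\<eta> z) * l2sq (\<lambda>x. f (x - z) - f x) \<partial>lborel)"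
    unfolding l2sq_def by (intro nn_integral_cong nn_integral_cmult) measurable
  also have "\<dots> \<le> (\<integral>\<^sup>+z. ennreal (\<eta> z) * c \<partial>lborel)"
  proof (rule nn_integral_mono)
    fix z
    show "ennreal (\<eta> z) * l2sq (\<lambda>x. f (x - z) - f x) \<le> ennreal (\<eta> z) * c"
      using c[of z] m by (cases "\<epsilon> < norm z") (auto simp: mollifier_def supp_within_def intro: mult_left_mono)
  qed
  also have "\<dots> = c" by (simp add: nn_integral_multc i1)
  finally show ?thesis .
qed

text \<open>The squared errors are summable in L1, so their sum \<open>S\<close> is finite almost
  everywhere. Finiteness forces pointwise convergence, and \<open>norm (g x)\<close> plus the square
  root of \<open>S x\<close> is a square integrable majorant of the whole sequence.\<close>

lemma dominated_selection:
  fixes f :: "nat \<Rightarrow> real^'n \<Rightarrow> 'b::euclidean_space"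
  assumes [measurable]: "\<And>k. f k \<in> borel_measurable borel" "g \<in> borel_measurable borel"
    and f: "\<And>k. l2sq (\<lambda>x. f k x - g x) \<le> ennreal ((1 / 2) ^ k)" and g: "l2sq g < \<infinity>"
  obtains D where "D \<in> borel_measurable borel" "integrable lborel (\<lambda>x. (D x)\<^sup>2)" "\<And>x. 0 \<le> D x"
    "AE x in lborel. \<forall>k. norm (f k x) \<le> D x" "AE x in lborel. (\<lambda>k. f k x) \<longlonglongrightarrow> g x"
proof -
  define S where "S x = (\<Sum>k. ennreal ((norm (f k x - g x))\<^sup>2))" for x
  have [measurable]: "S \<in> borel_measurable borel"
    unfolding S_def by (intro borel_measurable_suminf_order) simp
  define D where "D x = norm (g x) + sqrt (enn2real (S x))" for x
  have mD [measurable]: "D \<in> borel_measurable borel" unfolding D_def by measurable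
  have D0: "0 \<le> D x" for x by (simp add: D_def)
  have "(\<integral>\<^sup>+x. S x \<partial>lborel) = (\<Sum>k. l2sq (\<lambda>x. f k x - g x))"
    unfolding S_def l2sq_def by (subst nn_integral_suminf) simp_all
  also have "\<dots> \<le> (\<Sum>k. ennreal ((1 / 2) ^ k))"
    by (rule suminf_le[OF f summableI summableI])
  also have "\<dots> = ennreal 2"
  proof -
    have "(\<lambda>k. (1 / 2 :: real) ^ k) sums 2"
      using geometric_sums[of "1 / 2 :: real"] by simp
    then show ?thesis
      using suminf_ennreal2[OF _ sums_summable] sums_unique
      by (metis zero_le_power zero_le_divide_1_iff zero_le_numeral)
  qed
  finally have SI: "(\<integral>\<^sup>+x. S x \<partial>lborel) < \<infinity>"
    by (rule le_less_trans) simp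
  have fin: "AE x in lborel. S x \<noteq> \<infinity>"
    using SI by (intro nn_integral_PInf_AE) auto
  have conv: "(\<lambda>k. f k x) \<longlonglongrightarrow> g x" and bd: "norm (f k x) \<le> D x" if x: "S x \<noteq> \<infinity>" for x k
  proof -
    have s: "summable (\<lambda>k. (norm (f k x - g x))\<^sup>2)"
      using x unfolding S_def by (intro summable_suminf_not_top) auto
    have "(\<lambda>k. sqrt ((norm (f k x - g x))\<^sup>2)) \<longlonglongrightarrow> sqrt 0"
      by (intro tendsto_real_sqrt summable_LIMSEQ_zero s)
    then show "(\<lambda>k. f k x) \<longlonglongrightarrow> g x"
      by (subst LIM_zero_iff[symmetric], subst tendsto_norm_zero_iff[symmetric]) simp
    have "(norm (f k x - g x))\<^sup>2 \<le> (\<Sum>k. (norm (f k x - g x))\<^sup>2)"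
      using sum_le_suminf[OF s, of "{k}"] by simp
    also have "\<dots> = enn2real (S x)"
    proof -
      have "S x = ennreal (\<Sum>k. (norm (f k x - g x))\<^sup>2)"
        unfolding S_def by (rule suminf_ennreal2[OF _ s]) simp
      then show ?thesis by (simp add: suminf_nonneg[OF s])
    qed
    finally have "norm (f k x - g x) \<le> sqrt (enn2real (S x))" by (rule real_le_rsqrt)
    then show "norm (f k x) \<le> D x"
      using norm_triangle_ineq[of "f k x - g x" "g x"] by (simp add: D_def)
  qed
  have D: "integrable lborel (\<lambda>x. (D x)\<^sup>2)"
  proof (rule Bochner_Integration.integrable_bound)
    have "integrable lborel (\<lambda>x. (norm (g x))\<^sup>2)"
      using g by (intro integrableI_nonneg) (auto simp: l2sq_def)
    moreover have "integrable lborel (\<lambda>x. enn2real (S x))"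
    proof (intro integrableI_nonneg)
      have "(\<integral>\<^sup>+x. ennreal (enn2real (S x)) \<partial>lborel) \<le> (\<integral>\<^sup>+x. S x \<partial>lborel)"
        by (intro nn_integral_mono) (simp add: ennreal_enn2real_if)
      then show "(\<integral>\<^sup>+x. ennreal (enn2real (S x)) \<partial>lborel) < \<infinity>" using SI by (rule le_less_trans)
      show "AE x in lborel. 0 \<le> enn2real (S x)" by simp
      show "(\<lambda>x. enn2real (S x)) \<in> borel_measurable lborel" by measurable
    qed
    ultimately show "integrable lborel (\<lambda>x. 2 * (norm (g x))\<^sup>2 + 2 * enn2real (S x))" by simp
    show "AE x in lborel. norm ((D x)\<^sup>2) \<le> norm (2 * (norm (g x))\<^sup>2 + 2 * enn2real (S x))"
    proof (intro AE_I2)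
      fix x
      show "norm ((D x)\<^sup>2) \<le> norm (2 * (norm (g x))\<^sup>2 + 2 * enn2real (S x))"
        using norm_add_squared_le[of "norm (g x)" "sqrt (enn2real (S x))"] by (simp add: D_def)
    qed
    show "(\<lambda>x. (D x)\<^sup>2) \<in> borel_measurable lborel" by measurable
  qed
  show thesis
  proof (rule that)
    show "D \<in> borel_measurable borel" "integrable lborel (\<lambda>x. (D x)\<^sup>2)" by (fact mD, fact D)
    show "0 \<le> D x" for x by (fact D0)
    show "AE x in lborel. \<forall>k. norm (f k x) \<le> D x" using fin by eventually_elim (intro allI bd)
    show "AE x in lborel. (\<lambda>k. f k x) \<longlonglongrightarrow> g x" using fin by eventually_elim (rule conv)
  qed
qed

text \<open>The k-th kernel is taken narrow enough for an error \<open>(1/2)^k\<close>, so no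
  subsequence has to be extracted; all kernels stay within radius \<open>e\<close>.\<close>

lemma mollification_dominated:
  fixes f :: "real^'n \<Rightarrow> 'b::euclidean_space"
  assumes f [measurable]: "f \<in> borel_measurable borel" and fin: "l2sq f < \<infinity>"
    and supp: "supp_within R f" and e: "0 < e"
  obtains \<eta> D where "\<And>k. mollifier e (\<eta> k)"
    "D \<in> borel_measurable borel" "integrable lborel (\<lambda>x. (D x)\<^sup>2)" "\<And>x. 0 \<le> D x"
    "AE x in lborel. \<forall>k. norm (moll (\<eta> k) f x) \<le> D x" "AE x in lborel. (\<lambda>k. moll (\<eta> k) f x) \<longlonglongrightarrow> f x"
proof -
  have fi: "integrable lborel f" by (rule integrable_if_l2sq_finite[OF f fin supp])
  have "\<exists>\<eta>. mollifier e \<eta> \<and> l2sq (\<lambda>x. moll \<eta> f x - f x) \<le> ennreal ((1 / 2) ^ k)" for k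
  proof -
    obtain d where d: "0 < d" "\<And>h. norm h \<le> d \<Longrightarrow> l2sq (\<lambda>x. f (x - h) - f x) \<le> ennreal ((1 / 2) ^ k)"
      using l2_translation_continuous[OF f fin supp, of "(1 / 2) ^ k"] by auto
    obtain \<eta> :: "real^'n \<Rightarrow> real" where \<eta>: "mollifier (min e d) \<eta>"
      by (rule mollifier_exists[of "min e d"]) (use e d(1) in \<open>auto simp: mollifier_def\<close>)
    then have "mollifier e \<eta>" by (auto simp: mollifier_def supp_within_def)
    moreover have "l2sq (\<lambda>x. moll \<eta> f x - f x) \<le> ennreal ((1 / 2) ^ k)"
      by (rule l2sq_moll_diff_le[OF \<eta> fi]) (use d(2) in auto)
    ultimately show ?thesis by blast
  qed
  then obtain \<eta> where \<eta>: "\<And>k. mollifier e (\<eta> k)"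
      "\<And>k. l2sq (\<lambda>x. moll (\<eta> k) f x - f x) \<le> ennreal ((1 / 2) ^ k)"
    by metis
  have [measurable]: "\<eta> k \<in> borel_measurable borel" for k
    using mollifier_measurable[OF \<eta>(1)] .
  have m: "moll (\<eta> k) f \<in> borel_measurable borel" for k
    unfolding moll_def by measurable
  obtain D where D: "D \<in> borel_measurable borel" "integrable lborel (\<lambda>x. (D x)\<^sup>2)" "\<And>x. 0 \<le> D x"
    "AE x in lborel. \<forall>k. norm (moll (\<eta> k) f x) \<le> D x" "AE x in lborel. (\<lambda>k. moll (\<eta> k) f x) \<longlonglongrightarrow> f x"
    by (rule dominated_selection[of "\<lambda>k. moll (\<eta> k) f", OF m f \<eta>(2) fin]) (rule that)
  show thesis by (rule that[OF \<eta>(1) D])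
qed

section \<open>Nash inequality and approximation of weak gradients\<close>

lemma norm_hdot_le: "cmod (hdot z w) \<le> norm z * norm w"
proof -
  have "cmod (hdot z w) \<le> (\<Sum>i\<in>UNIV. \<bar>norm (z $ i)\<bar> * \<bar>norm (w $ i)\<bar>)"
    unfolding hdot_def by (rule order_trans[OF norm_sum]) (simp add: norm_mult)
  also have "\<dots> \<le> norm z * norm w"
    unfolding norm_vec_def by (rule L2_set_mult_ineq)
  finally show ?thesis .
qed

lemma continuous_on_grad: "k_smooth (Suc 0) f \<Longrightarrow> continuous_on UNIV (grad f)"
  unfolding grad_def by (intro continuous_intros) simp

lemma supp_within_grad: "supp_within R f \<Longrightarrow> supp_within R (grad f)"
  using partial_bounded_support[of R f] by (auto simp: grad_def supp_within_def vec_eq_iff)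

lemma norm_sum_scaleR_le:
  fixes h :: "real^'n" and z :: "complex^'n"
  shows "norm (\<Sum>i\<in>UNIV. h $ i *\<^sub>R z $ i) \<le> norm h * norm z"
proof -
  have "norm (\<Sum>i\<in>UNIV. h $ i *\<^sub>R z $ i) \<le> (\<Sum>i\<in>UNIV. \<bar>norm (h $ i)\<bar> * \<bar>norm (z $ i)\<bar>)"
    by (rule order_trans[OF norm_sum]) simp
  also have "\<dots> \<le> norm h * norm z"
    unfolding norm_vec_def by (rule L2_set_mult_ineq)
  finally show ?thesis .
qed

text \<open>Fundamental theorem of calculus along the segment from \<open>x\<close> to
  \<open>x - h\<close>, then Cauchy-Schwarz on the unit interval. The indicator is written twice so
  that each factor keeps one.\<close>

lemma difference_squared_le:
  fixes w :: "real^'n \<Rightarrow> complex"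
  assumes w: "k_smooth (Suc 0) w"
  shows "ennreal ((norm (w (x - h) - w x))\<^sup>2) \<le>
    (\<integral>\<^sup>+s. indicator {0..1::real} s * ennreal ((norm h)\<^sup>2 * (norm (grad w (x - s *\<^sub>R h)))\<^sup>2) \<partial>lborel)"
proof -
  let ?g = "\<lambda>s. \<Sum>i\<in>UNIV. (- h) $ i *\<^sub>R grad w (x - s *\<^sub>R h) $ i"
  have cg: "continuous_on UNIV (\<lambda>s::real. grad w (x - s *\<^sub>R h))"
    by (intro continuous_on_compose2[OF continuous_on_grad[OF w]] continuous_intros) auto
  have [measurable]: "(\<lambda>s::real. grad w (x - s *\<^sub>R h)) \<in> borel_measurable borel"
    by (rule borel_measurable_continuous_onI[OF cg])
  have vd: "((\<lambda>s. w (x - s *\<^sub>R h)) has_vector_derivative ?g s) (at s within {0..1})" for s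
  proof -
    have "((\<lambda>s::real. x - s *\<^sub>R h) has_derivative (\<lambda>t. t *\<^sub>R (- h))) (at s)"
      by (auto intro!: derivative_eq_intros)
    moreover have "(w has_derivative (\<lambda>k. \<Sum>i\<in>UNIV. k $ i *\<^sub>R partial i w (x - s *\<^sub>R h))) (at (x - s *\<^sub>R h))"
      using w by (intro has_derivative_partial) simp
    ultimately have "((\<lambda>s. w (x - s *\<^sub>R h)) has_derivative
        (\<lambda>t. \<Sum>i\<in>UNIV. (t *\<^sub>R (- h)) $ i *\<^sub>R partial i w (x - s *\<^sub>R h))) (at s)"
      by (rule has_derivative_compose)
    moreover have "(\<lambda>t. \<Sum>i\<in>UNIV. (t *\<^sub>R (- h)) $ i *\<^sub>R partial i w (x - s *\<^sub>R h)) = (\<lambda>t. t *\<^sub>R ?g s)"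
      by (rule ext) (simp add: scaleR_sum_right grad_def)
    ultimately show ?thesis
      unfolding has_vector_derivative_def by (simp add: has_derivative_at_withinI)
  qed
  have cont: "continuous_on {0..1} ?g"
    by (intro continuous_intros continuous_on_subset[OF cg]) auto
  have i: "integral\<^sup>L lborel (\<lambda>s. indicator {0..1} s *\<^sub>R ?g s) = w (x - h) - w x"
    and int: "integrable lborel (\<lambda>s. indicator {0..1} s *\<^sub>R ?g s)"
    using has_bochner_integral_FTC_Icc[OF zero_le_one vd cont] by (simp_all add: has_bochner_integral_iff)
  have "ennreal (norm (w (x - h) - w x)) \<le> (\<integral>\<^sup>+s. ennreal (norm (indicator {0..1} s *\<^sub>R ?g s)) \<partial>lborel)"
    unfolding i[symmetric] by (rule integral_norm_bound_ennreal[OF int])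
  also have "\<dots> \<le> (\<integral>\<^sup>+s. indicator {0..1::real} s * (indicator {0..1::real} s * ennreal (norm h * norm (grad w (x - s *\<^sub>R h)))) \<partial>lborel)"
  proof (rule nn_integral_mono)
    fix s
    show "ennreal (norm (indicator {0..1} s *\<^sub>R ?g s)) \<le>
        indicator {0..1::real} s * (indicator {0..1::real} s * ennreal (norm h * norm (grad w (x - s *\<^sub>R h))))"
      using norm_sum_scaleR_le[of "- h" "grad w (x - s *\<^sub>R h)"]
      by (auto split: split_indicator intro!: ennreal_leI)
  qed
  finally have "(ennreal (norm (w (x - h) - w x)))\<^sup>2 \<le> \<dots>\<^sup>2"
    by (rule power_mono) simp
  also have "\<dots> \<le> (\<integral>\<^sup>+s. (indicator {0..1::real} s)\<^sup>2 \<partial>lborel) *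
      (\<integral>\<^sup>+s. (indicator {0..1::real} s * ennreal (norm h * norm (grad w (x - s *\<^sub>R h))))\<^sup>2 \<partial>lborel)"
    by (rule Cauchy_Schwarz_nn_integral) auto
  also have "(\<integral>\<^sup>+s. (indicator {0..1::real} s)\<^sup>2 \<partial>lborel) = (\<integral>\<^sup>+s. indicator {0..1::real} s \<partial>lborel)"
    by (rule nn_integral_cong) (auto split: split_indicator)
  also have "\<dots> = 1" by simp
  also have "(\<integral>\<^sup>+s. (indicator {0..1::real} s * ennreal (norm h * norm (grad w (x - s *\<^sub>R h))))\<^sup>2 \<partial>lborel)
      = (\<integral>\<^sup>+s. indicator {0..1::real} s * ennreal ((norm h)\<^sup>2 * (norm (grad w (x - s *\<^sub>R h)))\<^sup>2) \<partial>lborel)"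
    by (rule nn_integral_cong) (auto split: split_indicator simp: ennreal_power power_mult_distrib)
  finally show ?thesis by (simp add: ennreal_power)
qed

text \<open>After Fubini the integral over \<open>x\<close> of each shifted gradient is the same by
  translation invariance.\<close>

lemma l2sq_difference_le:
  fixes w :: "real^'n \<Rightarrow> complex"
  assumes w: "k_smooth (Suc 0) w"
  shows "l2sq (\<lambda>x. w (x - h) - w x) \<le> ennreal ((norm h)\<^sup>2) * l2sq (grad w)"
proof -
  have [measurable]: "grad w \<in> borel_measurable borel"
    by (rule borel_measurable_continuous_onI[OF continuous_on_grad[OF w]])
  have "l2sq (\<lambda>x. w (x - h) - w x) \<le> (\<integral>\<^sup>+x. (\<integral>\<^sup>+s. indicator {0..1::real} s *
      ennreal ((norm h)\<^sup>2 * (norm (grad w (x - s *\<^sub>R h)))\<^sup>2) \<partial>lborel) \<partial>lborel)"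
    unfolding l2sq_def by (intro nn_integral_mono difference_squared_le w)
  also have "\<dots> = (\<integral>\<^sup>+s. (\<integral>\<^sup>+x. indicator {0..1::real} s *
      ennreal ((norm h)\<^sup>2 * (norm (grad w (x - s *\<^sub>R h)))\<^sup>2) \<partial>lborel) \<partial>lborel)"
    by (rule lborel_pair.Fubini'[symmetric]) measurable
  also have "\<dots> = (\<integral>\<^sup>+s. indicator {0..1::real} s * (ennreal ((norm h)\<^sup>2) * l2sq (grad w)) \<partial>lborel)"
  proof (rule nn_integral_cong)
    fix s :: real
    have "(\<integral>\<^sup>+x. indicator {0..1::real} s * ennreal ((norm h)\<^sup>2 * (norm (grad w (x - s *\<^sub>R h)))\<^sup>2) \<partial>lborel)
        = indicator {0..1::real} s * (ennreal ((norm h)\<^sup>2) * l2sq (\<lambda>x. grad w (x - s *\<^sub>R h)))"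
      unfolding l2sq_def by (simp add: nn_integral_cmult ennreal_mult)
    then show "(\<integral>\<^sup>+x. indicator {0..1::real} s * ennreal ((norm h)\<^sup>2 * (norm (grad w (x - s *\<^sub>R h)))\<^sup>2) \<partial>lborel)
        = indicator {0..1::real} s * (ennreal ((norm h)\<^sup>2) * l2sq (grad w))"
      by (simp add: l2sq_translate)
  qed
  also have "\<dots> = ennreal ((norm h)\<^sup>2) * l2sq (grad w)"
    by (simp add: nn_integral_multc)
  finally show ?thesis .
qed

text \<open>Integrate \<open>\<bar>w(x)\<bar>\<^sup>2 \<le> \<bar>w(x - h) - w(x)\<bar>\<^sup>2 + 2 \<bar>w(x)\<bar> \<bar>w(x - h)\<bar>\<close> over all \<open>x\<close> and over \<open>h\<close> in a ball.\<close>

lemma nash_inequality_ennreal: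
  fixes w :: "real^'n \<Rightarrow> complex"
  assumes w: "k_smooth (Suc 0) w" and t: "0 < t"
  shows "emeasure lborel (ball (0::real^'n) t) * l2sq w \<le>
    emeasure lborel (ball (0::real^'n) t) * (ennreal (t\<^sup>2) * l2sq (grad w))
      + 2 * (\<integral>\<^sup>+x. ennreal (norm (w x)) \<partial>lborel)\<^sup>2"
proof -
  let ?B = "ball (0::real^'n) t"
  have "continuous_on UNIV w" using k_smooth_Suc_imp[OF w] by simp
  then have [measurable]: "w \<in> borel_measurable borel"
    by (rule borel_measurable_continuous_onI)
  have [measurable]: "?B \<in> sets borel" by simp
  define I where "I = (\<integral>\<^sup>+x. ennreal (norm (w x)) \<partial>lborel)"
  have pt: "ennreal ((norm (w x))\<^sup>2) \<le> ennreal ((norm (w (x - h) - w x))\<^sup>2)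
      + 2 * (ennreal (norm (w x)) * ennreal (norm (w (x - h))))" for x h
  proof -
    have "(norm (w x) - norm (w (x - h)))\<^sup>2 \<le> (norm (w (x - h) - w x))\<^sup>2"
      using norm_triangle_ineq3[of "w x" "w (x - h)"] by (simp add: abs_le_square_iff[symmetric] norm_minus_commute)
    then have "(norm (w x))\<^sup>2 \<le> (norm (w (x - h) - w x))\<^sup>2 + 2 * (norm (w x) * norm (w (x - h)))"
      using zero_le_power2[of "norm (w (x - h))"] unfolding power2_diff by linarith
    then have "ennreal ((norm (w x))\<^sup>2) \<le> ennreal ((norm (w (x - h) - w x))\<^sup>2 + 2 * (norm (w x) * norm (w (x - h))))"
      by (rule ennreal_leI)
    then show ?thesis by (simp add: ennreal_mult)
  qed
  have h: "l2sq w \<le> ennreal (t\<^sup>2) * l2sq (grad w)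
      + 2 * (\<integral>\<^sup>+x. ennreal (norm (w x)) * ennreal (norm (w (x - h))) \<partial>lborel)" if "h \<in> ?B" for h
  proof -
    have "l2sq w \<le> (\<integral>\<^sup>+x. ennreal ((norm (w (x - h) - w x))\<^sup>2)
        + 2 * (ennreal (norm (w x)) * ennreal (norm (w (x - h)))) \<partial>lborel)"
      unfolding l2sq_def by (rule nn_integral_mono) (rule pt)
    also have "\<dots> = l2sq (\<lambda>x. w (x - h) - w x)
        + 2 * (\<integral>\<^sup>+x. ennreal (norm (w x)) * ennreal (norm (w (x - h))) \<partial>lborel)"
      unfolding l2sq_def by (subst nn_integral_add) (simp_all add: nn_integral_cmult)
    also have "l2sq (\<lambda>x. w (x - h) - w x) \<le> ennreal ((norm h)\<^sup>2) * l2sq (grad w)"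
      by (rule l2sq_difference_le[OF w])
    also have "ennreal ((norm h)\<^sup>2) \<le> ennreal (t\<^sup>2)"
      using that by (intro ennreal_leI power_mono) auto
    finally show ?thesis by (simp add: add_mono mult_right_mono)
  qed
  have "emeasure lborel ?B * l2sq w = (\<integral>\<^sup>+h. l2sq w * indicator ?B h \<partial>lborel)"
    by (simp add: nn_integral_cmult_indicator mult.commute)
  \<comment> \<open>The product term is integrated over all \<open>h\<close> rather than over the
    ball, which turns it into the square of the L1 norm.\<close>
  also have "\<dots> \<le> (\<integral>\<^sup>+h. (ennreal (t\<^sup>2) * l2sq (grad w)) * indicator ?B h
      + 2 * (\<integral>\<^sup>+x. ennreal (norm (w x)) * ennreal (norm (w (x - h))) \<partial>lborel) \<partial>lborel)"
  proof (rule nn_integral_mono)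
    fix h
    show "l2sq w * indicator ?B h \<le> (ennreal (t\<^sup>2) * l2sq (grad w)) * indicator ?B h
      + 2 * (\<integral>\<^sup>+x. ennreal (norm (w x)) * ennreal (norm (w (x - h))) \<partial>lborel)"
      using h[of h] by (cases "h \<in> ?B") auto
  qed
  also have "\<dots> = (ennreal (t\<^sup>2) * l2sq (grad w)) * emeasure lborel ?B
      + 2 * (\<integral>\<^sup>+h. (\<integral>\<^sup>+x. ennreal (norm (w x)) * ennreal (norm (w (x - h))) \<partial>lborel) \<partial>lborel)"
    by (subst nn_integral_add) (auto simp: nn_integral_cmult_indicator nn_integral_cmult)
  also have "(\<integral>\<^sup>+h. (\<integral>\<^sup>+x. ennreal (norm (w x)) * ennreal (norm (w (x - h))) \<partial>lborel) \<partial>lborel)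
      = (\<integral>\<^sup>+x. (\<integral>\<^sup>+h. ennreal (norm (w x)) * ennreal (norm (w (x - h))) \<partial>lborel) \<partial>lborel)"
    by (rule lborel_pair.Fubini') measurable
  also have "\<dots> = (\<integral>\<^sup>+x. ennreal (norm (w x)) * I \<partial>lborel)"
  proof (rule nn_integral_cong)
    fix x
    have "(\<integral>\<^sup>+h. ennreal (norm (w (x - h))) \<partial>lborel) = I"
      using nn_integral_distr[of "\<lambda>y. x - y" lborel borel "\<lambda>y. ennreal (norm (w y))"]
      by (simp add: distr_lborel_reflect I_def)
    then show "(\<integral>\<^sup>+h. ennreal (norm (w x)) * ennreal (norm (w (x - h))) \<partial>lborel) = ennreal (norm (w x)) * I"
      by (simp add: nn_integral_cmult)
  qed
  also have "\<dots> = I\<^sup>2" by (simp add: nn_integral_multc I_def power2_eq_square)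
  finally show ?thesis unfolding I_def by (simp add: mult.commute mult.left_commute)
qed


section \<open>Weak gradients and their approximation by C1 functions\<close>

lemma borel_measurable_hdot:
  assumes "f \<in> borel_measurable M" "g \<in> borel_measurable M"
  shows "(\<lambda>x. hdot (f x) (g x)) \<in> borel_measurable M"
  using assms
  by (rule borel_measurable_continuous_Pair) (unfold hdot_def, intro continuous_intros)

text \<open>The notions of the theorem are stated for the completed measure, the analysis is done
  with Borel functions and \<open>lborel\<close>. This lemma and the next one pass between the
  two.\<close>

lemma borel_version_exists:
  fixes f :: "real^'n \<Rightarrow> 'b::euclidean_space"
  assumes "f \<in> borel_measurable lebesgue"
  obtains g where "g \<in> borel_measurable borel" "AE x in lborel. f x = g x"
proof -
  have "\<exists>h\<in>borel_measurable lborel. AE x in lborel. f x \<bullet> b = h x" for b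
    using assms by (intro completion_ex_borel_measurable_real) auto
  then obtain h where h: "\<And>b. h b \<in> borel_measurable lborel" "\<And>b. AE x in lborel. f x \<bullet> b = h b x"
    by metis
  define g where "g x = (\<Sum>b\<in>Basis. h b x *\<^sub>R b)" for x
  have "g \<in> borel_measurable borel"
    unfolding g_def using h(1) by (intro borel_measurable_sum borel_measurable_scaleR) auto
  moreover have "AE x in lborel. \<forall>b\<in>Basis. f x \<bullet> b = h b x"
    by (intro AE_finite_allI h(2)) simp
  then have "AE x in lborel. f x = g x"
  proof eventually_elim
    fix x assume "\<forall>b\<in>Basis. f x \<bullet> b = h b x"
    then have "(\<Sum>b\<in>Basis. (f x \<bullet> b) *\<^sub>R b) = g x"
      unfolding g_def by (intro sum.cong) auto
    then show "f x = g x" by (simp add: euclidean_representation)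
  qed
  ultimately show thesis by (rule that)
qed

lemma integral_lebesgue_eq_lborel:
  fixes f g :: "real^'n \<Rightarrow> 'b::euclidean_space"
  assumes "f \<in> borel_measurable lebesgue" "g \<in> borel_measurable borel" "AE x in lborel. f x = g x"
  shows "integral\<^sup>L lebesgue f = integral\<^sup>L lborel g"
proof -
  have "integral\<^sup>L lebesgue f = integral\<^sup>L lebesgue g"
    using assms by (intro integral_cong_AE AE_completion) (auto intro: measurable_completion)
  also have "\<dots> = integral\<^sup>L lborel g"
    using assms by (intro integral_completion) auto
  finally show ?thesis .
qed

lemma L2_loc_cut:
  fixes f :: "real^'n \<Rightarrow> 'b::euclidean_space"
  assumes f: "L2_loc \<Omega> f" and "open \<Omega>" "compact S" "S \<subseteq> \<Omega>"
  shows "(\<lambda>x. indicator S x *\<^sub>R f x) \<in> borel_measurable lebesgue"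
    and "(\<integral>\<^sup>+x. ennreal ((norm (indicator S x *\<^sub>R f x))\<^sup>2) \<partial>lebesgue) < \<infinity>"
proof -
  have \<Omega>: "\<Omega> \<in> sets lebesgue" and S [measurable]: "S \<in> sets lebesgue"
    using assms by (auto simp: borel_open borel_compact)
  have [measurable]: "(\<lambda>x. indicator \<Omega> x *\<^sub>R f x) \<in> borel_measurable lebesgue"
    using f \<Omega> borel_measurable_restrict_space_iff[of \<Omega> lebesgue f] by (simp add: L2_loc_def)
  have "(\<lambda>x. indicator S x *\<^sub>R (indicator \<Omega> x *\<^sub>R f x)) \<in> borel_measurable lebesgue" by measurable
  also have "(\<lambda>x. indicator S x *\<^sub>R (indicator \<Omega> x *\<^sub>R f x)) = (\<lambda>x. indicator S x *\<^sub>R f x)"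
    using assms(4) by (auto simp: fun_eq_iff indicator_def)
  finally show "(\<lambda>x. indicator S x *\<^sub>R f x) \<in> borel_measurable lebesgue" .
  have "integrable lebesgue (\<lambda>x. indicator S x *\<^sub>R (norm (f x))\<^sup>2)"
    using f assms(3,4) by (simp add: L2_loc_def set_integrable_def)
  then have "(\<integral>\<^sup>+x. ennreal (norm (indicator S x *\<^sub>R (norm (f x))\<^sup>2)) \<partial>lebesgue) < \<infinity>"
    by (simp add: integrable_iff_bounded)
  also have "(\<lambda>x. ennreal (norm (indicator S x *\<^sub>R (norm (f x))\<^sup>2))) = (\<lambda>x. ennreal ((norm (indicator S x *\<^sub>R f x))\<^sup>2))"
    by (auto split: split_indicator)
  finally show "(\<integral>\<^sup>+x. ennreal ((norm (indicator S x *\<^sub>R f x))\<^sup>2) \<partial>lebesgue) < \<infinity>" .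
qed

lemma partial_reflect:
  fixes g :: "real^'n \<Rightarrow> complex"
  assumes "g differentiable (at (x - y))"
  shows "(\<lambda>y. g (x - y)) differentiable (at y)"
    and "partial i (\<lambda>y. g (x - y)) y = - partial i g (x - y)"
proof -
  obtain g' where g': "(g has_derivative g') (at (x - y))"
    using assms by (auto simp: differentiable_def)
  have "((\<lambda>y. x - y) has_derivative (\<lambda>h. - h)) (at y)"
    by (auto intro!: derivative_eq_intros)
  from has_derivative_compose[OF this g'] have D: "((\<lambda>y. g (x - y)) has_derivative (\<lambda>h. g' (- h))) (at y)" .
  then show "(\<lambda>y. g (x - y)) differentiable (at y)" by (auto simp: differentiable_def)
  show "partial i (\<lambda>y. g (x - y)) y = - partial i g (x - y)"
    unfolding partial_eqI[OF D] partial_eqI[OF g']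
    by (rule linear_neg[OF has_derivative_linear[OF g']])
qed

lemma k_smooth_reflect:
  fixes g :: "real^'n \<Rightarrow> complex"
  assumes "k_smooth k g"
  shows "k_smooth k (\<lambda>y. g (x - y))"
  using assms
proof (induction k arbitrary: g)
  case 0
  then have c: "continuous_on UNIV g" by simp
  show ?case
    unfolding k_smooth.simps by (intro continuous_on_compose2[OF c] continuous_intros) auto
next
  case (Suc k)
  have "partial i (\<lambda>y. g (x - y)) = (\<lambda>y. (- 1) * partial i g (x - y))" for i
    using Suc.prems by (auto simp: partial_reflect)
  moreover have "k_smooth k (\<lambda>y. (- 1) * partial i g (x - y))" for i
    using Suc.prems by (intro k_smooth_mult k_smooth_const Suc.IH) auto
  ultimately show ?case
    using Suc.prems by (simp add: partial_reflect)
qed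

lemma moll_bounded_linear:
  fixes f :: "real^'n \<Rightarrow> 'b::euclidean_space" and T :: "'b \<Rightarrow> 'c::euclidean_space"
  assumes "mollifier e \<eta>" "integrable lborel f" "bounded_linear T"
  shows "moll \<eta> (\<lambda>y. T (f y)) x = T (moll \<eta> f x)"
  using integral_bounded_linear[OF assms(3) integrable_moll[OF assms(1,2)], of x]
  by (simp add: moll_def linear_scale[OF bounded_linear.linear[OF assms(3)]])

lemma moll_eq_conv: "moll \<eta> f = conv f (\<lambda>x. complex_of_real (\<eta> x))"
  by (rule ext) (simp add: moll_def conv_def scaleR_conv_of_real mult.commute)

lemma test_function_of_compact:
  assumes "\<And>k. k_smooth k \<phi>" "compact S" "S \<subseteq> \<Omega>" "\<And>x. x \<notin> S \<Longrightarrow> \<phi> x = 0"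
  shows "test_function \<Omega> \<phi>"
proof -
  have "closure {x. \<phi> x \<noteq> 0} \<subseteq> S"
    using assms(2,4) by (intro closure_minimal compact_imp_closed) auto
  moreover from this have "compact (closure {x. \<phi> x \<noteq> 0})"
    using compact_Int_closed[OF assms(2) closed_closure, of "{x. \<phi> x \<noteq> 0}"]
    by (simp add: inf.absorb2)
  ultimately show ?thesis using assms(1,3) by (auto simp: test_function_def)
qed

text \<open>Near a compact set, the gradient of the mollified function is the mollified weak
  gradient. Function and gradient are mollified as one function into a product space, so both
  converge along the same sequence under the same \<open>D\<close>.\<close>

lemma weak_gradient_approximation:
  fixes u :: "real^'n \<Rightarrow> complex" and G :: "real^'n \<Rightarrow> complex^'n"
  assumes \<Omega>: "open \<Omega>" and S: "compact S" "S \<subseteq> \<Omega>" and u: "L2_loc \<Omega> u" and G: "L2_loc \<Omega> G"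
    and wg: "is_weak_gradient \<Omega> u G"
  obtains U D where "\<And>k. k_smooth (Suc 0) (U k)"
    "D \<in> borel_measurable borel" "integrable lborel (\<lambda>x. (D x)\<^sup>2)" "\<And>x. 0 \<le> D x"
    "AE x in lborel. x \<in> S \<longrightarrow> (\<forall>k. norm (U k x) \<le> D x \<and> norm (grad (U k) x) \<le> D x)"
    "AE x in lborel. x \<in> S \<longrightarrow> (\<lambda>k. U k x) \<longlonglongrightarrow> u x \<and> (\<lambda>k. grad (U k) x) \<longlonglongrightarrow> G x"
proof -
  obtain e where e: "0 < e" "(\<Union>x\<in>S. cball x e) \<subseteq> \<Omega>"
    by (rule compact_subset_open_imp_cball_epsilon_subset[OF S(1) \<Omega> S(2)])
  \<comment> \<open>Kernels of radius \<open>e\<close> centered in \<open>S\<close> reach no farther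
    than this neighbourhood, which is still a compact subset of \<Omega>.\<close>
  define S' where "S' = (\<Union>x\<in>S. cball x e)"
  have S': "compact S'" "S' \<subseteq> \<Omega>"
    using compact_minkowski_sum_cball[OF S(1)] e(2) by (auto simp: S'_def)
  have [measurable]: "S' \<in> sets borel" using S'(1) by (simp add: borel_compact)
  have SS': "x \<in> S'" if "x \<in> S" for x using that e(1) by (force simp: S'_def)
  note cu = L2_loc_cut[OF u \<Omega> S'] and cG = L2_loc_cut[OF G \<Omega> S']
  define f0 where "f0 x = (indicator S' x *\<^sub>R u x, indicator S' x *\<^sub>R G x)" for x
  have f0: "f0 \<in> borel_measurable lebesgue"
    unfolding f0_def using cu(1) cG(1) by measurable
  obtain f' where f' [measurable]: "f' \<in> borel_measurable borel" and eq': "AE x in lborel. f0 x = f' x"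
    by (rule borel_version_exists[OF f0])
  \<comment> \<open>The Borel version may be nonzero outside \<open>S'\<close> on a null set;
    cutting again makes its support bounded everywhere.\<close>
  define f where "f x = indicator S' x *\<^sub>R f' x" for x
  have f [measurable]: "f \<in> borel_measurable borel" unfolding f_def by measurable
  have eq: "AE x in lborel. f0 x = f x"
    using eq' by eventually_elim (auto simp: f_def f0_def zero_prod_def split: split_indicator)
  obtain R where R: "S' \<subseteq> cball 0 R"
    using compact_imp_bounded[OF S'(1)] by (auto simp: bounded_pos subset_iff)
  have supp: "supp_within R f"
    using R by (auto simp: supp_within_def f_def split: split_indicator)
  have "l2sq f = (\<integral>\<^sup>+x. ennreal ((norm (f x))\<^sup>2) \<partial>lebesgue)"
    by (simp add: l2sq_def nn_integral_completion)
  also have "\<dots> = (\<integral>\<^sup>+x. ennreal ((norm (indicator S' x *\<^sub>R u x))\<^sup>2) + ennreal ((norm (indicator S' x *\<^sub>R G x))\<^sup>2) \<partial>lebesgue)"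
  proof (rule nn_integral_cong_AE)
    show "AE x in lebesgue. ennreal ((norm (f x))\<^sup>2)
        = ennreal ((norm (indicator S' x *\<^sub>R u x))\<^sup>2) + ennreal ((norm (indicator S' x *\<^sub>R G x))\<^sup>2)"
    proof (rule AE_completion, use eq in eventually_elim)
      fix x assume "f0 x = f x"
      then have "(norm (f x))\<^sup>2 = (norm (indicator S' x *\<^sub>R u x))\<^sup>2 + (norm (indicator S' x *\<^sub>R G x))\<^sup>2"
        by (simp only: f0_def norm_Pair flip: \<open>f0 x = f x\<close>) simp
      then show "ennreal ((norm (f x))\<^sup>2)
          = ennreal ((norm (indicator S' x *\<^sub>R u x))\<^sup>2) + ennreal ((norm (indicator S' x *\<^sub>R G x))\<^sup>2)"
        by (simp flip: ennreal_plus)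
    qed
  qed
  also have "\<dots> = (\<integral>\<^sup>+x. ennreal ((norm (indicator S' x *\<^sub>R u x))\<^sup>2) \<partial>lebesgue) + (\<integral>\<^sup>+x. ennreal ((norm (indicator S' x *\<^sub>R G x))\<^sup>2) \<partial>lebesgue)"
    by (intro nn_integral_add measurable_compose[OF _ measurable_ennreal] borel_measurable_power
        measurable_compose[OF cu(1) borel_measurable_norm] measurable_compose[OF cG(1) borel_measurable_norm])
  also have "\<dots> < \<infinity>" using cu(2) cG(2) by simp
  finally have fin: "l2sq f < \<infinity>" .
  have fi: "integrable lborel f" by (rule integrable_if_l2sq_finite[OF f fin supp])
  then have fsti: "integrable lborel (\<lambda>y. fst (f y))" and sndi: "integrable lborel (\<lambda>y. snd (f y))"
    by (auto intro: integrable_bounded_linear bounded_linear_fst bounded_linear_snd)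
  obtain \<eta> D where \<eta>: "\<And>k. mollifier e (\<eta> k)"
    and D: "D \<in> borel_measurable borel" "integrable lborel (\<lambda>x. (D x)\<^sup>2)" "\<And>x. 0 \<le> D x"
      "AE x in lborel. \<forall>k. norm (moll (\<eta> k) f x) \<le> D x"
      "AE x in lborel. (\<lambda>k. moll (\<eta> k) f x) \<longlonglongrightarrow> f x"
    by (rule mollification_dominated[OF f fin supp e(1)]) (rule that)
  let ?c = "\<lambda>k x. complex_of_real (\<eta> k x)"
  have ks: "k_smooth m (?c k)" for m k using \<eta>[of k] by (simp add: mollifier_def)
  have sc: "supp_within e (?c k)" for k using \<eta>[of k] by (simp add: mollifier_def supp_within_def)
  define U where "U k = conv (\<lambda>y. fst (f y)) (?c k)" for k
  have U: "U k x = fst (moll (\<eta> k) f x)" for k x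
    using moll_bounded_linear[OF \<eta> fi bounded_linear_fst, of k x] by (simp add: U_def moll_eq_conv)
  \<comment> \<open>For \<open>x\<close> in \<open>S\<close> the reflected kernel
    \<open>y -> eta (x - y)\<close> is itself an admissible test function. The sign from the
    reflection and the sign in the weak gradient identity cancel.\<close>
  have gU: "grad (U k) x = snd (moll (\<eta> k) f x)" if x: "x \<in> S" for k x
  proof -
    have "partial i (U k) x = snd (moll (\<eta> k) f x) $ i" for i
    proof -
      let ?\<phi> = "\<lambda>y. ?c k (x - y)"
      have d: "?c k differentiable (at z)" for z using ks[of "Suc 0" k] by simp
      have "test_function \<Omega> ?\<phi>"
      proof (rule test_function_of_compact[of _ "cball x e"])
        show "cball x e \<subseteq> \<Omega>" using x e(2) by blast
        show "?c k (x - y) = 0" if "y \<notin> cball x e" for y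
          using that by (intro supp_withinD[OF sc]) (simp add: dist_norm)
      qed (use k_smooth_reflect[OF ks] in auto)
      then have w: "(LINT y:\<Omega>|lebesgue. u y * partial i ?\<phi> y) = - (LINT y:\<Omega>|lebesgue. G y $ i * ?\<phi> y)"
        using wg by (simp add: is_weak_gradient_def)
      have off: "?\<phi> y = 0" "partial i (?c k) (x - y) = 0" if "y \<notin> S'" for y
      proof -
        have "e < norm (x - y)" using that x by (auto simp: S'_def dist_norm not_le)
        then show "?\<phi> y = 0" "partial i (?c k) (x - y) = 0"
          using sc[of k] partial_bounded_support[OF sc, of i k] by (auto simp: supp_within_def)
      qed
      have mf: "(\<lambda>y. fst (f0 y)) \<in> borel_measurable lebesgue" "(\<lambda>y. snd (f0 y) $ i) \<in> borel_measurable lebesgue"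
        by (rule measurable_compose[OF f0 borel_measurable_continuous_onI],
            intro continuous_intros)+
      have mc: "?\<phi> \<in> borel_measurable borel" "(\<lambda>y. partial i (?c k) (x - y)) \<in> borel_measurable borel"
        using k_smooth_reflect[OF ks, of 0] k_smooth_reflect[of 0 "partial i (?c k)"] ks[of "Suc 0" k]
        by (auto intro!: borel_measurable_continuous_onI)
      have "partial i (U k) x = conv (\<lambda>y. fst (f y)) (partial i (?c k)) x"
        unfolding U_def by (simp add: partial_conv[OF fsti ks sc])
      also have "\<dots> = (LINT y|lebesgue. fst (f0 y) * partial i (?c k) (x - y))"
        unfolding conv_def
      proof (rule integral_lebesgue_eq_lborel[symmetric])
        show "AE y in lborel. fst (f0 y) * partial i (?c k) (x - y) = fst (f y) * partial i (?c k) (x - y)"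
          using eq by eventually_elim simp
        show "(\<lambda>y. fst (f0 y) * partial i (?c k) (x - y)) \<in> borel_measurable lebesgue"
          by (rule borel_measurable_times[OF mf(1)]) (rule measurable_completion, use mc(2) in simp)
        show "(\<lambda>y. fst (f y) * partial i (?c k) (x - y)) \<in> borel_measurable borel"
          by (rule borel_measurable_times[OF _ mc(2)],
              rule measurable_compose[OF f borel_measurable_continuous_onI], intro continuous_intros)
      qed
      also have "\<dots> = - (LINT y:\<Omega>|lebesgue. u y * partial i ?\<phi> y)"
        unfolding set_lebesgue_integral_def integral_minus[symmetric]
      proof (rule Bochner_Integration.integral_cong[OF refl])
        fix y
        show "fst (f0 y) * partial i (?c k) (x - y) = - (indicator \<Omega> y *\<^sub>R (u y * partial i ?\<phi> y))"
          using off[of y] S'(2) by (cases "y \<in> S'") (auto simp: f0_def partial_reflect(2)[OF d])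
      qed
      also have "\<dots> = (LINT y:\<Omega>|lebesgue. G y $ i * ?\<phi> y)"
        by (simp only: w minus_minus)
      also have "\<dots> = (LINT y|lebesgue. \<eta> k (x - y) *\<^sub>R (snd (f0 y) $ i))"
        unfolding set_lebesgue_integral_def
      proof (rule Bochner_Integration.integral_cong[OF refl])
        fix y
        show "indicator \<Omega> y *\<^sub>R (G y $ i * ?\<phi> y) = \<eta> k (x - y) *\<^sub>R (snd (f0 y) $ i)"
          using off[of y] S'(2) by (cases "y \<in> S'") (auto simp: f0_def scaleR_conv_of_real mult.commute)
      qed
      also have "\<dots> = moll (\<eta> k) (\<lambda>y. snd (f y) $ i) x"
        unfolding moll_def
      proof (rule integral_lebesgue_eq_lborel)
        have [measurable]: "\<eta> k \<in> borel_measurable borel" using mollifier_measurable[OF \<eta>] .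
        have m1: "(\<lambda>y. \<eta> k (x - y)) \<in> borel_measurable borel" by measurable
        show "(\<lambda>y. \<eta> k (x - y) *\<^sub>R (snd (f0 y) $ i)) \<in> borel_measurable lebesgue"
          by (rule borel_measurable_scaleR[OF _ mf(2)]) (rule measurable_completion, use m1 in simp)
        have "(\<lambda>y. snd (f y) $ i) \<in> borel_measurable borel"
          by (rule measurable_compose[OF f borel_measurable_continuous_onI], intro continuous_intros)
        then show "(\<lambda>y. \<eta> k (x - y) *\<^sub>R (snd (f y) $ i)) \<in> borel_measurable borel"
          using m1 by (intro borel_measurable_scaleR)
        show "AE y in lborel. \<eta> k (x - y) *\<^sub>R (snd (f0 y) $ i) = \<eta> k (x - y) *\<^sub>R (snd (f y) $ i)"
          using eq by eventually_elim simp
      qed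
      also have "\<dots> = snd (moll (\<eta> k) f x) $ i"
        by (rule moll_bounded_linear[OF \<eta> fi]) (intro bounded_linear_compose[OF bounded_linear_vec_nth bounded_linear_snd])
      finally show ?thesis .
    qed
    then show ?thesis by (simp add: vec_eq_iff grad_def)
  qed
  show thesis
  proof (rule that)
    show "k_smooth (Suc 0) (U k)" for k
      unfolding U_def by (rule k_smooth_conv[OF fsti ks sc])
    show "D \<in> borel_measurable borel" "integrable lborel (\<lambda>x. (D x)\<^sup>2)" "0 \<le> D x" for x
      by (fact D)+
    show "AE x in lborel. x \<in> S \<longrightarrow> (\<forall>k. norm (U k x) \<le> D x \<and> norm (grad (U k) x) \<le> D x)"
      using D(4)
    proof eventually_elim
      fix x assume *: "\<forall>k. norm (moll (\<eta> k) f x) \<le> D x"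
      show "x \<in> S \<longrightarrow> (\<forall>k. norm (U k x) \<le> D x \<and> norm (grad (U k) x) \<le> D x)"
      proof (intro impI allI)
        fix k assume "x \<in> S"
        then show "norm (U k x) \<le> D x \<and> norm (grad (U k) x) \<le> D x"
          using *[rule_format, of k] norm_fst_le[of "fst (moll (\<eta> k) f x)" "snd (moll (\<eta> k) f x)"]
            norm_snd_le[of "snd (moll (\<eta> k) f x)" "fst (moll (\<eta> k) f x)"]
          by (simp add: U gU)
      qed
    qed
    show "AE x in lborel. x \<in> S \<longrightarrow> (\<lambda>k. U k x) \<longlonglongrightarrow> u x \<and> (\<lambda>k. grad (U k) x) \<longlonglongrightarrow> G x"
      using D(5) eq
    proof eventually_elim
      fix x assume l: "(\<lambda>k. moll (\<eta> k) f x) \<longlonglongrightarrow> f x" and fx: "f0 x = f x"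
      show "x \<in> S \<longrightarrow> (\<lambda>k. U k x) \<longlonglongrightarrow> u x \<and> (\<lambda>k. grad (U k) x) \<longlonglongrightarrow> G x"
        using tendsto_fst[OF l] tendsto_snd[OF l] SS'[of x]
        by (auto simp: U gU f0_def simp flip: fx)
    qed
  qed
qed

text \<open>Extends the equation to test functions of class C1, since the cutoffs built later are
  only known to be C1. Mollifying \<open>\<Psi>\<close> gives smooth functions supported in a
  compact neighbourhood of \<open>S\<close>, and their gradients converge under a square integrable
  majorant.\<close>

lemma weak_identity_C1:
  fixes B :: "real^'n \<Rightarrow> complex^'n"
  assumes T: "open T" and S: "compact S" "S \<subseteq> T"
    and B [measurable]: "B \<in> borel_measurable borel" and B2: "integrable lborel (\<lambda>x. (norm (B x))\<^sup>2)"
    and test: "\<And>\<Psi>. test_function T \<Psi> \<Longrightarrow> (LINT x|lborel. hdot (B x) (grad \<Psi> x)) = 0"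
    and \<Psi>: "k_smooth (Suc 0) \<Psi>" "\<And>x. x \<notin> S \<Longrightarrow> \<Psi> x = 0"
  shows "(LINT x|lborel. hdot (B x) (grad \<Psi> x)) = 0"
proof -
  obtain e where e: "0 < e" "(\<Union>x\<in>S. cball x e) \<subseteq> T"
    by (rule compact_subset_open_imp_cball_epsilon_subset[OF S(1) T S(2)])
  define S' where "S' = (\<Union>x\<in>S. cball x e)"
  have S': "compact S'" "S' \<subseteq> T"
    using compact_minkowski_sum_cball[OF S(1)] e(2) by (auto simp: S'_def)
  obtain R where "S \<subseteq> cball 0 R"
    using compact_imp_bounded[OF S(1)] by (auto simp: bounded_pos subset_iff)
  then have supp: "supp_within R \<Psi>" using \<Psi>(2) by (force simp: supp_within_def)
  have c\<Psi>: "continuous_on UNIV \<Psi>" using k_smooth_Suc_imp[OF \<Psi>(1)] by simp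
  have \<Psi>i: "integrable lborel \<Psi>" by (rule integrable_continuous_bounded_support[OF c\<Psi> supp])
  have cg: "continuous_on UNIV (grad \<Psi>)" by (rule continuous_on_grad[OF \<Psi>(1)])
  have f [measurable]: "grad \<Psi> \<in> borel_measurable borel" by (rule borel_measurable_continuous_onI[OF cg])
  have sg: "supp_within R (grad \<Psi>)" by (rule supp_within_grad[OF supp])
  have "integrable lborel (\<lambda>x. (norm (grad \<Psi> x))\<^sup>2)"
    by (rule integrable_continuous_bounded_support[where R = R])
      (use sg in \<open>auto intro!: continuous_intros cg simp: supp_within_def\<close>)
  then have fin: "l2sq (grad \<Psi>) < \<infinity>" by (simp add: integrable_iff_bounded l2sq_def)
  have gi: "integrable lborel (grad \<Psi>)" by (rule integrable_if_l2sq_finite[OF f fin sg])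
  obtain \<eta> D where \<eta>: "\<And>k. mollifier e (\<eta> k)"
    and D: "D \<in> borel_measurable borel" "integrable lborel (\<lambda>x. (D x)\<^sup>2)" "\<And>x. 0 \<le> D x"
      "AE x in lborel. \<forall>k. norm (moll (\<eta> k) (grad \<Psi>) x) \<le> D x"
      "AE x in lborel. (\<lambda>k. moll (\<eta> k) (grad \<Psi>) x) \<longlonglongrightarrow> grad \<Psi> x"
    by (rule mollification_dominated[OF f fin sg e(1)]) (rule that)
  let ?c = "\<lambda>k x. complex_of_real (\<eta> k x)"
  have ks: "k_smooth m (?c k)" for m k using \<eta>[of k] by (simp add: mollifier_def)
  have sc: "supp_within e (?c k)" for k using \<eta>[of k] by (simp add: mollifier_def supp_within_def)
  have ci: "integrable lborel (?c k)" for k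
    using ks[of 0 k] by (intro integrable_continuous_bounded_support[OF _ sc]) simp
  have m: "?c k \<in> borel_measurable borel" "\<Psi> \<in> borel_measurable borel" "partial i \<Psi> \<in> borel_measurable borel" for k i
    using ks[of 0 k] c\<Psi> \<Psi>(1) by (auto intro!: borel_measurable_continuous_onI)
  define \<Phi> where "\<Phi> k = conv \<Psi> (?c k)" for k
  have grad\<Phi>: "grad (\<Phi> k) = moll (\<eta> k) (grad \<Psi>)" for k
  proof
    fix x
    \<comment> \<open>Smoothness of \<open>\<Phi> k\<close> comes from the kernel; with the factors
      exchanged, the derivative falls on \<open>\<Psi>\<close> instead.\<close>
    have "\<Phi> k = conv (?c k) \<Psi>" unfolding \<Phi>_def using conv_commute[OF m(2,1)] by auto
    then have "partial i (\<Phi> k) x = moll (\<eta> k) (partial i \<Psi>) x" for i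
      by (simp add: partial_conv[OF ci \<Psi>(1) supp] conv_commute[OF m(1,3)] moll_eq_conv)
    moreover have "moll (\<eta> k) (partial i \<Psi>) x = moll (\<eta> k) (grad \<Psi>) x $ i" for i
      using moll_bounded_linear[OF \<eta> gi bounded_linear_vec_nth, of k i x] by (simp add: grad_def)
    ultimately show "grad (\<Phi> k) x = moll (\<eta> k) (grad \<Psi>) x"
      by (simp add: vec_eq_iff grad_def)
  qed
  have "test_function T (\<Phi> k)" for k
  proof (rule test_function_of_compact[OF _ S'])
    show "k_smooth j (\<Phi> k)" for j unfolding \<Phi>_def by (rule k_smooth_conv[OF \<Psi>i ks sc])
    show "\<Phi> k x = 0" if "x \<notin> S'" for x
    proof -
      have 0: "\<Psi> y * ?c k (x - y) = 0" for y
      proof (cases "y \<in> S")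
        case True
        then have "e < norm (x - y)" using that by (auto simp: S'_def dist_norm not_le norm_minus_commute)
        then show ?thesis using supp_withinD[OF sc] by simp
      qed (simp add: \<Psi>(2))
      show ?thesis unfolding \<Phi>_def conv_def 0 by simp
    qed
  qed
  then have z: "(LINT x|lborel. hdot (B x) (moll (\<eta> k) (grad \<Psi>) x)) = 0" for k
    using test grad\<Phi> by metis
  have mm: "moll (\<eta> k) (grad \<Psi>) \<in> borel_measurable borel" for k
  proof -
    have [measurable]: "\<eta> k \<in> borel_measurable borel" using mollifier_measurable[OF \<eta>] .
    show ?thesis unfolding moll_def by measurable
  qed
  have "(\<lambda>k. LINT x|lborel. hdot (B x) (moll (\<eta> k) (grad \<Psi>) x)) \<longlonglongrightarrow> (LINT x|lborel. hdot (B x) (grad \<Psi> x))"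
  proof (rule integral_dominated_convergence[where w = "\<lambda>x. (norm (B x))\<^sup>2 + (D x)\<^sup>2"])
    show "(\<lambda>x. hdot (B x) (moll (\<eta> k) (grad \<Psi>) x)) \<in> borel_measurable lborel" for k
      using mm by (intro borel_measurable_hdot) auto
    show "(\<lambda>x. hdot (B x) (grad \<Psi> x)) \<in> borel_measurable lborel"
      by (intro borel_measurable_hdot) auto
    show "AE x in lborel. norm (hdot (B x) (moll (\<eta> k) (grad \<Psi>) x)) \<le> (norm (B x))\<^sup>2 + (D x)\<^sup>2" for k
      using D(4)
    proof eventually_elim
      fix x assume "\<forall>k. norm (moll (\<eta> k) (grad \<Psi>) x) \<le> D x"
      then have "norm (hdot (B x) (moll (\<eta> k) (grad \<Psi>) x)) \<le> norm (B x) * D x"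
        by (intro order_trans[OF norm_hdot_le] mult_left_mono) auto
      also have "\<dots> \<le> (norm (B x))\<^sup>2 + (D x)\<^sup>2"
        using zero_le_power2[of "norm (B x) - D x"] zero_le_power2[of "norm (B x)"] zero_le_power2[of "D x"]
        unfolding power2_diff by linarith
      finally show "norm (hdot (B x) (moll (\<eta> k) (grad \<Psi>) x)) \<le> (norm (B x))\<^sup>2 + (D x)\<^sup>2" .
    qed
    show "AE x in lborel. (\<lambda>k. hdot (B x) (moll (\<eta> k) (grad \<Psi>) x)) \<longlonglongrightarrow> hdot (B x) (grad \<Psi> x)"
      using D(5) by eventually_elim (unfold hdot_def, intro tendsto_intros)
  qed (use B2 D(2) in auto)
  then show ?thesis unfolding z by (simp add: LIMSEQ_const_iff)
qed

section \<open>Regularized powers and cutoff functions\<close>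

text \<open>\<open>tpow k a s\<close> replaces \<open>s powr a\<close>; it lies between two positive constants, so that all integrals
  are finite a priori. With \<open>Q = tquot k\<close>, \<open>tker k\<close> is the logarithmic derivative \<open>Q'/Q\<close>. The point of
  the choice of \<open>Q\<close> is \<open>0 \<le> s Q'(s)/Q(s) \<le> 1\<close>: this ratio is the weight of the convex combination in
  \<open>tdiff_elliptic\<close> below. \<open>tdiff k a z v\<close> is the differential of \<open>tmap k a\<close> at \<open>z\<close>, applied to each
  component of \<open>v\<close>.\<close>

definition tquot :: "real \<Rightarrow> real \<Rightarrow> real" where
  "tquot k s = (s + 1 / k) / (1 + s / k)"

definition tpow :: "real \<Rightarrow> real \<Rightarrow> real \<Rightarrow> real" where
  "tpow k a s = tquot k s powr a"

definition tker :: "real \<Rightarrow> real \<Rightarrow> real" where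
  "tker k s = (1 - 1 / k\<^sup>2) / ((1 + s / k) * (s + 1 / k))"

definition tmap :: "real \<Rightarrow> real \<Rightarrow> complex \<Rightarrow> complex" where
  "tmap k a z = tpow k a ((norm z)\<^sup>2) *\<^sub>R z"

definition tdiff :: "real \<Rightarrow> real \<Rightarrow> complex \<Rightarrow> complex^'n \<Rightarrow> complex^'n" where
  "tdiff k a z v = (\<chi> i. tpow k a ((norm z)\<^sup>2) *\<^sub>R v $ i
     + (2 * a * tpow k a ((norm z)\<^sup>2) * tker k ((norm z)\<^sup>2) * (z \<bullet> v $ i)) *\<^sub>R z)"

lemma tquot_pos: "1 \<le> k \<Longrightarrow> 0 \<le> s \<Longrightarrow> 0 < tquot k s"
  unfolding tquot_def by (intro divide_pos_pos add_nonneg_pos add_pos_nonneg) auto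

lemma tquot_bounds:
  assumes "1 \<le> k" "0 \<le> s"
  shows "1 / k \<le> tquot k s" "tquot k s \<le> k" "tquot k s \<le> s + 1 / k"
proof -
  have p: "0 < 1 + s / k" using assms by (intro add_pos_nonneg) auto
  have "s / k\<^sup>2 \<le> s"
    using assms mult_left_mono[of 1 "k\<^sup>2" s] one_le_power[of k 2] by (simp add: field_simps)
  then have "1 / k * (1 + s / k) \<le> s + 1 / k" using assms by (simp add: field_simps power2_eq_square)
  then show "1 / k \<le> tquot k s" using p by (simp add: tquot_def pos_le_divide_eq)
  have "s + 1 / k \<le> k * (1 + s / k)" using assms by (simp add: field_simps one_le_power flip: power2_eq_square)
  then show "tquot k s \<le> k" using p by (simp add: tquot_def pos_divide_le_eq)
  have "s + 1 / k \<le> (s + 1 / k) * (1 + s / k)" using assms by (simp add: field_simps)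
  then show "tquot k s \<le> s + 1 / k" using p by (simp add: tquot_def pos_divide_le_eq)
qed

lemma tpow_pos: "1 \<le> k \<Longrightarrow> 0 \<le> s \<Longrightarrow> 0 < tpow k a s"
  using tquot_pos[of k s] by (simp add: tpow_def)

lemma tpow_le:
  assumes "1 \<le> k" "0 \<le> s"
  shows "tpow k a s \<le> k powr \<bar>a\<bar>"
proof (cases "0 \<le> a")
  case True
  then show ?thesis
    using tquot_bounds[OF assms] tquot_pos[OF assms] by (simp add: tpow_def powr_mono2)
next
  case False
  have "tquot k s powr a \<le> (1 / k) powr a"
    using False tquot_bounds[OF assms] assms by (intro powr_mono2') auto
  also have "\<dots> = k powr \<bar>a\<bar>" using False assms by (simp add: powr_divide powr_minus_divide)
  finally show ?thesis by (simp add: tpow_def)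
qed

text \<open>Lets the integral of \<open>norm u ^ 2\<close> with weight \<open>tpow k a\<close> be
  read as the squared L2 norm of \<open>tmap k (a / 2)\<close> of \<open>u\<close>, to which the
  Nash inequality applies.\<close>

lemma tpow_half: "1 \<le> k \<Longrightarrow> 0 \<le> s \<Longrightarrow> (tpow k (a / 2) s)\<^sup>2 = tpow k a s"
  by (simp add: tpow_def power2_eq_square flip: powr_add)

lemma tker_bounds:
  assumes "1 \<le> k" "0 \<le> s"
  shows "0 \<le> tker k s" "s * tker k s \<le> 1"
proof -
  have 1: "1 / k\<^sup>2 \<le> 1" using assms by (simp add: divide_le_eq one_le_power)
  have p: "0 < (1 + s / k) * (s + 1 / k)"
    using assms by (intro mult_pos_pos add_nonneg_pos add_pos_nonneg) auto
  show "0 \<le> tker k s" unfolding tker_def using 1 p by (intro divide_nonneg_pos) auto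
  have "s * (1 - 1 / k\<^sup>2) \<le> s * 1" using assms by (intro mult_left_mono) auto
  also have "\<dots> \<le> (1 + s / k) * (s + 1 / k)" using assms by (simp add: field_simps)
  finally show "s * tker k s \<le> 1" unfolding tker_def using p by (simp add: divide_le_eq)
qed

lemma DERIV_tpow:
  assumes "1 \<le> k" "0 \<le> s"
  shows "DERIV (tpow k a) s :> a * tpow k a s * tker k s"
proof -
  have p: "0 < 1 + s / k" using assms by (intro add_pos_nonneg) auto
  have p2: "0 < s + 1 / k" using assms by (intro add_nonneg_pos) auto
  have "DERIV (tquot k) s :> (1 - 1 / k\<^sup>2) / (1 + s / k)\<^sup>2"
  proof -
    have n: "DERIV (\<lambda>s. s + 1 / k) s :> 1" and m: "DERIV (\<lambda>s. 1 + s / k) s :> 1 / k"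
      using assms by (auto intro!: derivative_eq_intros)
    have "1 * (1 + s / k) - (s + 1 / k) * (1 / k) = 1 - 1 / k\<^sup>2"
      by (simp add: power2_eq_square add_divide_distrib)
    then have "(1 * (1 + s / k) - (s + 1 / k) * (1 / k)) / ((1 + s / k) * (1 + s / k)) = (1 - 1 / k\<^sup>2) / (1 + s / k)\<^sup>2"
      by (simp add: power2_eq_square)
    with DERIV_divide[OF n m] p show ?thesis by (simp add: tquot_def[abs_def])
  qed
  from DERIV_chain2[OF has_real_derivative_powr[OF tquot_pos[OF assms]] this]
  have "DERIV (\<lambda>s. tquot k s powr a) s :> a * tquot k s powr (a - 1) * ((1 - 1 / k\<^sup>2) / (1 + s / k)\<^sup>2)" .
  moreover have "a * tquot k s powr (a - 1) * ((1 - 1 / k\<^sup>2) / (1 + s / k)\<^sup>2) = a * tpow k a s * tker k s"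
  proof -
    have "tquot k s powr (a - 1) = tpow k a s * ((1 + s / k) / (s + 1 / k))"
      using tquot_pos[OF assms] by (simp add: tpow_def powr_diff) (simp add: tquot_def)
    then show ?thesis
      using p p2 by (simp add: tker_def power2_eq_square ac_simps)
  qed
  ultimately show ?thesis by (simp add: tpow_def[abs_def])
qed

lemma has_derivative_tmap:
  assumes "1 \<le> k"
  shows "(tmap k a has_derivative (\<lambda>w. tpow k a ((norm z)\<^sup>2) *\<^sub>R w
     + (2 * a * tpow k a ((norm z)\<^sup>2) * tker k ((norm z)\<^sup>2) * (z \<bullet> w)) *\<^sub>R z)) (at z)"
proof -
  have "((\<lambda>z::complex. z \<bullet> z) has_derivative (\<lambda>w. 2 * (z \<bullet> w))) (at z)"
    by (auto intro!: derivative_eq_intros simp: inner_commute)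
  from has_derivative_compose[OF this DERIV_tpow[OF assms inner_ge_zero, THEN has_field_derivative_imp_has_derivative], of a]
  have "((\<lambda>z. tpow k a (z \<bullet> z)) has_derivative (\<lambda>w. a * tpow k a (z \<bullet> z) * tker k (z \<bullet> z) * (2 * (z \<bullet> w)))) (at z)" .
  from has_derivative_scaleR[OF this has_derivative_ident]
  show ?thesis
    unfolding tmap_def[abs_def] power2_norm_eq_inner by (simp add: algebra_simps)
qed

lemma continuous_on_tpow_norm:
  assumes "1 \<le> k"
  shows "continuous_on UNIV (\<lambda>z::complex. tpow k a ((norm z)\<^sup>2))"
proof -
  have "continuous_on {0..} (tpow k a)"
    using DERIV_tpow[OF assms] by (intro continuous_at_imp_continuous_on ballI DERIV_isCont) auto
  then show ?thesis
    by (rule continuous_on_compose2) (auto intro!: continuous_intros)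
qed

lemma continuous_on_tker_norm:
  assumes "1 \<le> k"
  shows "continuous_on UNIV (\<lambda>z::complex. tker k ((norm z)\<^sup>2))"
proof -
  have "0 < 1 + (norm z)\<^sup>2 / k" "0 < (norm z)\<^sup>2 + 1 / k" for z :: complex
    using assms by (auto intro: add_nonneg_pos add_pos_nonneg)
  then show ?thesis
    unfolding tker_def using assms by (intro continuous_intros) (auto simp: less_le)
qed

lemma continuous_on_tmap: "1 \<le> k \<Longrightarrow> continuous_on UNIV (tmap k a)"
  unfolding tmap_def[abs_def] by (intro continuous_intros continuous_on_tpow_norm)

lemma continuous_on_tdiff:
  assumes k: "1 \<le> k"
  shows "continuous_on UNIV (\<lambda>p. tdiff k a (fst p) (snd p) :: complex^'n)"
  unfolding tdiff_def
  by (intro continuous_intros continuous_on_compose2[OF continuous_on_tpow_norm[OF k]]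
      continuous_on_compose2[OF continuous_on_tker_norm[OF k]]) auto

lemma grad_tmap:
  fixes U :: "real^'n \<Rightarrow> complex"
  assumes k: "1 \<le> k" and U: "k_smooth (Suc 0) U"
  shows "k_smooth (Suc 0) (\<lambda>x. tmap k a (U x))" "grad (\<lambda>x. tmap k a (U x)) = (\<lambda>x. tdiff k a (U x) (grad U x))"
proof -
  have D: "((\<lambda>x. tmap k a (U x)) has_derivative (\<lambda>h. tpow k a ((norm (U x))\<^sup>2) *\<^sub>R (\<Sum>i\<in>UNIV. h $ i *\<^sub>R partial i U x)
     + (2 * a * tpow k a ((norm (U x))\<^sup>2) * tker k ((norm (U x))\<^sup>2) * (U x \<bullet> (\<Sum>i\<in>UNIV. h $ i *\<^sub>R partial i U x))) *\<^sub>R U x)) (at x)" for x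
    by (rule has_derivative_compose[OF has_derivative_partial has_derivative_tmap[OF k]]) (use U in simp)
  have p: "partial i (\<lambda>x. tmap k a (U x)) x = tdiff k a (U x) (grad U x) $ i" for i x
    unfolding partial_eqI[OF D]
    by (simp add: axis_def tdiff_def grad_def if_distrib[where f="\<lambda>a. a *\<^sub>R _"] cong: if_cong)
  show g: "grad (\<lambda>x. tmap k a (U x)) = (\<lambda>x. tdiff k a (U x) (grad U x))"
    by (auto simp: fun_eq_iff vec_eq_iff grad_def[of "\<lambda>x. tmap k a (U x)"] p)
  have cU: "continuous_on UNIV U" using k_smooth_Suc_imp[OF U] by simp
  have "continuous_on UNIV (\<lambda>x. tdiff k a (fst (U x, grad U x)) (snd (U x, grad U x)))"
    by (rule continuous_on_compose2[OF continuous_on_tdiff[OF k]])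
      (auto intro!: continuous_intros cU continuous_on_grad[OF U])
  then have "continuous_on UNIV (\<lambda>x. tdiff k a (U x) (grad U x) $ i)" for i
    by (intro continuous_intros) simp
  then show "k_smooth (Suc 0) (\<lambda>x. tmap k a (U x))"
    using D by (auto simp: differentiable_def p cong: continuous_on_cong)
qed

lemma grad_mult:
  fixes f g :: "real^'n \<Rightarrow> complex"
  assumes "k_smooth (Suc 0) f" "k_smooth (Suc 0) g"
  shows "grad (\<lambda>x. f x * g x) = (\<lambda>x. g x *s grad f x + f x *s grad g x)"
  using assms by (auto simp: fun_eq_iff vec_eq_iff grad_def partial_mult mult.commute)

text \<open>The rank-one term contains \<open>norm z ^ 2 * tker k (norm z ^ 2)\<close>, which is at
  most 1. Hence the bound is comparable to \<open>tpow\<close> itself with a factor free of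
  \<open>k\<close>.\<close>

lemma norm_tdiff_le:
  assumes "1 \<le> k"
  shows "norm (tdiff k a z v) \<le> (1 + 2 * \<bar>a\<bar>) * tpow k a ((norm z)\<^sup>2) * norm (v :: complex^'n)"
proof -
  let ?F = "tpow k a ((norm z)\<^sup>2)" and ?K = "tker k ((norm z)\<^sup>2)"
  have F: "0 \<le> ?F" using tpow_pos[OF assms, of "(norm z)\<^sup>2" a] by simp
  note K = tker_bounds[OF assms zero_le_power2[of "norm z"]]
  have "norm (tdiff k a z v $ i) \<le> norm (((1 + 2 * \<bar>a\<bar>) * ?F) *\<^sub>R v $ i)" for i
  proof -
    have "norm ((2 * a * ?F * ?K * (z \<bullet> v $ i)) *\<^sub>R z) = 2 * \<bar>a\<bar> * ?F * ?K * \<bar>z \<bullet> v $ i\<bar> * norm z"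
      using F K by (simp add: abs_mult)
    also have "\<dots> \<le> 2 * \<bar>a\<bar> * ?F * ?K * (norm z * norm (v $ i)) * norm z"
      using F K by (intro mult_right_mono mult_left_mono Cauchy_Schwarz_ineq2) auto
    also have "\<dots> = 2 * \<bar>a\<bar> * ?F * ((norm z)\<^sup>2 * ?K) * norm (v $ i)"
      by (simp add: power2_eq_square)
    also have "\<dots> \<le> 2 * \<bar>a\<bar> * ?F * 1 * norm (v $ i)"
      using F K by (intro mult_right_mono mult_left_mono) auto
    finally have "norm ((2 * a * ?F * ?K * (z \<bullet> v $ i)) *\<^sub>R z) \<le> 2 * \<bar>a\<bar> * ?F * norm (v $ i)" by simp
    moreover have "norm (?F *\<^sub>R v $ i) = ?F * norm (v $ i)" using F by simp
    ultimately have "norm (tdiff k a z v $ i) \<le> ?F * norm (v $ i) + 2 * \<bar>a\<bar> * ?F * norm (v $ i)"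
      unfolding tdiff_def vec_lambda_beta by (intro order_trans[OF norm_triangle_ineq]) linarith
    moreover have "norm (((1 + 2 * \<bar>a\<bar>) * ?F) *\<^sub>R v $ i) = (1 + 2 * \<bar>a\<bar>) * ?F * norm (v $ i)"
      using F by (subst norm_scaleR) simp
    ultimately show ?thesis by (simp add: algebra_simps)
  qed
  then have "norm (tdiff k a z v) \<le> norm (((1 + 2 * \<bar>a\<bar>) * ?F) *\<^sub>R v)"
    by (intro norm_le_componentwise_cart) simp
  then show ?thesis using F by (simp add: abs_mult)
qed

text \<open>\<open>J_form s\<close> is \<open>s\<close> times the map \<open>J\<close> of the conjugate exponent of \<open>s\<close>.\<close>

definition J_form :: "real \<Rightarrow> complex^'n \<Rightarrow> complex^'n" where
  "J_form s \<xi> = (\<chi> i. Complex ((s - 1) * Re (\<xi> $ i)) (Im (\<xi> $ i)))"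

lemma hdot_smult: "hdot (c *s x) (c *s y) = complex_of_real ((norm c)\<^sup>2) * hdot x y"
  unfolding hdot_def sum_distrib_left
  by (intro sum.cong refl) (simp add: complex_norm_square[symmetric] mult.assoc mult.left_commute mult.commute)

lemma hdot_add_right: "hdot x (y + z) = hdot x y + hdot x z"
  by (simp add: hdot_def distrib_left sum.distrib)

lemma hdot_scaleR_right: "hdot x (r *\<^sub>R y) = r *\<^sub>R hdot x y"
  by (simp add: hdot_def scaleR_sum_right)

text \<open>In the frame rotated by the phase of \<open>z\<close>, the differential multiplies real
  parts by \<open>1 + (s - 2) * \<theta>\<close> and keeps imaginary parts, up to the positive
  factor \<open>tpow\<close>. At \<open>\<theta> = 0\<close> this is the identity, at
  \<open>\<theta> = 1\<close> it is \<open>J_form s\<close>, and it is affine in \<theta>. The form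
  \<open>hdot (M *v v) w\<close> is unchanged when both vectors are rotated by the same
  phase.\<close>

lemma tdiff_elliptic:
  fixes M :: "complex^'n^'n"
  assumes k: "1 \<le> k"
    and e2: "\<And>\<xi>. c * (norm \<xi>)\<^sup>2 \<le> Re (hdot (M *v \<xi>) \<xi>)"
    and es: "\<And>\<xi>. c * (norm \<xi>)\<^sup>2 \<le> Re (hdot (M *v \<xi>) (J_form s \<xi>))"
  shows "c * tpow k ((s - 2) / 2) ((norm z)\<^sup>2) * (norm v)\<^sup>2 \<le> Re (hdot (M *v v) (tdiff k ((s - 2) / 2) z v))"
proof -
  let ?F = "tpow k ((s - 2) / 2) ((norm z)\<^sup>2)"
  define \<theta> where "\<theta> = (norm z)\<^sup>2 * tker k ((norm z)\<^sup>2)"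
  have F: "0 \<le> ?F" using tpow_pos[OF k, of "(norm z)\<^sup>2"] by (simp add: less_imp_le)
  have \<theta>: "0 \<le> \<theta>" "\<theta> \<le> 1"
    using tker_bounds[OF k zero_le_power2[of "norm z"]] by (auto simp: \<theta>_def)
  \<comment> \<open>At \<open>z = 0\<close> any phase would do; the value 1 keeps the modulus equal
    to 1.\<close>
  define \<sigma> where "\<sigma> = (if z = 0 then 1 else sgn z)"
  have \<sigma>: "norm \<sigma> = 1" by (simp add: \<sigma>_def norm_sgn)
  have z: "z = norm z *\<^sub>R \<sigma>" by (simp add: \<sigma>_def sgn_div_norm)
  have cs: "\<sigma> * cnj \<sigma> = 1" using \<sigma> complex_norm_square[of \<sigma>] by simp
  define \<xi> where "\<xi> = cnj \<sigma> *s v"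
  have v: "v = \<sigma> *s \<xi>"
    by (simp add: \<xi>_def vec_eq_iff mult.assoc[symmetric] cs)
  have norm\<xi>: "norm v = norm \<xi>"
    by (simp add: \<xi>_def norm_vec_def norm_mult \<sigma>)
  have ip: "z \<bullet> v $ i = norm z * Re (\<xi> $ i)" for i
    by (subst z) (simp add: \<xi>_def inner_complex_def algebra_simps)
  have "tdiff k ((s - 2) / 2) z v $ i = (?F *\<^sub>R (\<sigma> *s ((1 - \<theta>) *\<^sub>R \<xi> + \<theta> *\<^sub>R J_form s \<xi>))) $ i" for i
  proof -
    have "tdiff k ((s - 2) / 2) z v $ i = ?F *\<^sub>R (v $ i + ((s - 2) * tker k ((norm z)\<^sup>2) * (z \<bullet> v $ i)) *\<^sub>R z)"
      by (simp add: tdiff_def scaleR_add_right mult.commute mult.left_commute)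
    also have "(s - 2) * tker k ((norm z)\<^sup>2) * (z \<bullet> v $ i) = (s - 2) * tker k ((norm z)\<^sup>2) * (norm z * Re (\<xi> $ i))"
      by (simp only: ip)
    also have "\<dots> *\<^sub>R z = ((s - 2) * \<theta> * Re (\<xi> $ i)) *\<^sub>R \<sigma>"
      by (subst (3) z) (simp add: \<theta>_def power2_eq_square mult.commute mult.left_commute)
    also have "v $ i + ((s - 2) * \<theta> * Re (\<xi> $ i)) *\<^sub>R \<sigma> = \<sigma> * (\<xi> $ i + complex_of_real ((s - 2) * \<theta> * Re (\<xi> $ i)))"
      by (simp add: v scaleR_conv_of_real algebra_simps)
    also have "\<xi> $ i + complex_of_real ((s - 2) * \<theta> * Re (\<xi> $ i)) = ((1 - \<theta>) *\<^sub>R \<xi> + \<theta> *\<^sub>R J_form s \<xi>) $ i"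
      by (simp add: complex_eq_iff J_form_def algebra_simps)
    finally show ?thesis by (simp add: distrib_left)
  qed
  then have td: "tdiff k ((s - 2) / 2) z v = ?F *\<^sub>R (\<sigma> *s ((1 - \<theta>) *\<^sub>R \<xi> + \<theta> *\<^sub>R J_form s \<xi>))"
    by (simp only: vec_eq_iff) simp
  have Mv: "M *v v = \<sigma> *s (M *v \<xi>)"
    by (simp add: v matrix_vector_mult_def vec_eq_iff sum_distrib_left mult.left_commute)
  have "Re (hdot (M *v v) (tdiff k ((s - 2) / 2) z v)) =
      ?F * ((1 - \<theta>) * Re (hdot (M *v \<xi>) \<xi>) + \<theta> * Re (hdot (M *v \<xi>) (J_form s \<xi>)))"
    unfolding td Mv hdot_scaleR_right hdot_smult hdot_add_right by (simp add: \<sigma>)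
  also have "\<dots> \<ge> ?F * ((1 - \<theta>) * (c * (norm \<xi>)\<^sup>2) + \<theta> * (c * (norm \<xi>)\<^sup>2))"
    using F \<theta> by (intro mult_left_mono add_mono e2 es) auto
  finally show ?thesis by (simp add: norm\<xi> algebra_simps)
qed

section \<open>Cutoff functions with explicit gradient bounds\<close>

definition half_sq :: "real \<Rightarrow> real" where "half_sq t = (max 0 t)\<^sup>2"

lemma DERIV_half_sq: "DERIV half_sq t :> 2 * max 0 t"
proof -
  consider "t > 0" | "t < 0" | "t = 0" by linarith
  then show ?thesis
  proof cases
    case 1
    have "eventually (\<lambda>s. s\<^sup>2 = half_sq s) (nhds t)"
      using eventually_nhds_in_open[of "{0<..}" t] 1 by (auto elim!: eventually_mono simp: half_sq_def)
    moreover have "DERIV (\<lambda>s. s\<^sup>2) t :> 2 * max 0 t"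
      using 1 by (auto intro!: derivative_eq_intros)
    ultimately show ?thesis by (subst (asm) DERIV_cong_ev[OF refl _ refl])
  next
    case 2
    have "eventually (\<lambda>s. 0 = half_sq s) (nhds t)"
      using eventually_nhds_in_open[of "{..<0}" t] 2 by (auto elim!: eventually_mono simp: half_sq_def)
    moreover have "DERIV (\<lambda>_. 0) t :> 2 * max 0 t" using 2 by simp
    ultimately show ?thesis by (subst (asm) DERIV_cong_ev[OF refl _ refl])
  next
    case 3
    have "(\<lambda>h. half_sq h / h) \<midarrow>0\<rightarrow> 0"
    proof (rule tendsto_rabs_zero_cancel, rule tendsto_sandwich[OF _ _ tendsto_const])
      show "(\<lambda>h::real. \<bar>h\<bar>) \<midarrow>0\<rightarrow> 0" by (rule tendsto_rabs_zero) (rule tendsto_ident_at)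
      show "\<forall>\<^sub>F h in at 0. \<bar>half_sq h / h\<bar> \<le> \<bar>h\<bar>"
        by (intro always_eventually allI) (auto simp: half_sq_def max_def power2_eq_square)
    qed simp
    then show ?thesis using 3 by (simp add: DERIV_def half_sq_def)
  qed
qed

text \<open>A profile of the squared distance to \<open>X\<close>, which is smooth also at the
  center. The slope is at most \<open>4 * 2 * R / (R^2 - \<rho>^2)\<close>, and
  \<open>R <= R + \<rho>\<close>.\<close>

lemma cutoff_exists:
  fixes X :: "real^'n"
  assumes "0 \<le> \<rho>" "\<rho> < R"
  obtains \<eta> :: "real^'n \<Rightarrow> real" where "k_smooth (Suc 0) (\<lambda>x. complex_of_real (\<eta> x))"
    "\<And>x. 0 \<le> \<eta> x" "\<And>x. \<eta> x \<le> 1" "\<And>x. x \<in> cball X \<rho> \<Longrightarrow> \<eta> x = 1" "\<And>x. x \<notin> cball X R \<Longrightarrow> \<eta> x = 0"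
    "\<And>x. norm (grad (\<lambda>x. complex_of_real (\<eta> x)) x) \<le> 8 / (R - \<rho>)"
proof -
  define d where "d = R\<^sup>2 - \<rho>\<^sup>2"
  have d: "0 < d" using assms by (simp add: d_def power_strict_mono)
  define \<tau> where "\<tau> x = (R\<^sup>2 - (x - X) \<bullet> (x - X)) / d" for x
  \<comment> \<open>Two quadratic ramps composed: 0 for \<open>t <= 0\<close>, 1 for
    \<open>t >= 1\<close>, of class C1, with slope at most \<open>2 * 2\<close>.\<close>
  define \<psi> where "\<psi> t = 1 - half_sq (1 - half_sq t)" for t
  define \<psi>' where "\<psi>' t = 4 * max 0 (1 - half_sq t) * max 0 t" for t
  have D\<psi>: "DERIV \<psi> t :> \<psi>' t" for t
    unfolding \<psi>_def[abs_def] \<psi>'_def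
    by (rule derivative_eq_intros DERIV_chain2[OF DERIV_half_sq] DERIV_half_sq refl)+ simp
  have \<psi>b: "0 \<le> \<psi> t" "\<psi> t \<le> 1" for t
    using power_mono[of "max 0 (1 - half_sq t)" 1 2] by (auto simp: \<psi>_def half_sq_def)
  have \<psi>0: "\<psi> t = 0" if "t \<le> 0" for t using that by (simp add: \<psi>_def half_sq_def)
  have \<psi>1: "\<psi> t = 1" if "1 \<le> t" for t
    using that one_le_power[of t 2] by (simp add: \<psi>_def half_sq_def)
  have \<psi>'b: "0 \<le> \<psi>' t" "\<psi>' t \<le> 4" for t
  proof -
    show "0 \<le> \<psi>' t" by (simp add: \<psi>'_def)
    show "\<psi>' t \<le> 4"
    proof (cases "t \<le> 1")
      case True
      have "max 0 (1 - half_sq t) * max 0 t \<le> 1 * 1"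
        using True by (intro mult_mono) (auto simp: half_sq_def)
      then show ?thesis by (simp add: \<psi>'_def)
    next
      case False
      then have "1 \<le> t\<^sup>2" using one_le_power[of t 2] by simp
      then show ?thesis using False by (simp add: \<psi>'_def half_sq_def)
    qed
  qed
  have D\<tau>: "(\<tau> has_derivative (\<lambda>h. - (2 * ((x - X) \<bullet> h)) / d)) (at x)" for x
    unfolding \<tau>_def using d by (auto intro!: derivative_eq_intros simp: inner_commute)
  define \<eta> where "\<eta> x = \<psi> (\<tau> x)" for x
  have D: "((\<lambda>x. complex_of_real (\<eta> x)) has_derivative
      (\<lambda>h. complex_of_real (\<psi>' (\<tau> x) * (- (2 * ((x - X) \<bullet> h)) / d)))) (at x)" for x
    unfolding \<eta>_def
    by (intro has_derivative_of_real has_derivative_compose[OF D\<tau> D\<psi>[THEN has_field_derivative_imp_has_derivative]])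
  have p: "partial i (\<lambda>x. complex_of_real (\<eta> x)) x = complex_of_real (\<psi>' (\<tau> x) * (- 2 / d) * (x - X) $ i)" for i x
    unfolding partial_eqI[OF D] of_real_eq_iff using d by (simp add: inner_axis field_simps)
  have out: "\<tau> x < 0" if "x \<notin> cball X R" for x
  proof -
    have "R\<^sup>2 < (norm (x - X))\<^sup>2"
      using that assms by (intro power_strict_mono) (auto simp: dist_norm norm_minus_commute)
    then show ?thesis using d by (simp add: \<tau>_def power2_norm_eq_inner divide_neg_pos)
  qed
  have inn: "1 \<le> \<tau> x" if "x \<in> cball X \<rho>" for x
  proof -
    have "(norm (x - X))\<^sup>2 \<le> \<rho>\<^sup>2"
      using that by (intro power_mono) (auto simp: dist_norm norm_minus_commute)
    then show ?thesis using d by (simp add: \<tau>_def power2_norm_eq_inner le_divide_eq d_def)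
  qed
  show thesis
  proof (rule that[of \<eta>])
    have "continuous_on UNIV \<tau>" unfolding \<tau>_def using d by (intro continuous_intros) auto
    then have "continuous_on UNIV (\<lambda>x. complex_of_real (\<psi>' (\<tau> x) * (- 2 / d) * (x - X) $ i))" for i
      unfolding \<psi>'_def half_sq_def using d by (intro continuous_intros) auto
    then show "k_smooth (Suc 0) (\<lambda>x. complex_of_real (\<eta> x))"
      using D by (auto simp: differentiable_def p[abs_def] simp del: of_real_mult)
    show "norm (grad (\<lambda>x. complex_of_real (\<eta> x)) x) \<le> 8 / (R - \<rho>)" for x
    proof (cases "x \<in> cball X R")
      case False
      then have "\<tau> x < 0" by (rule out)
      then show ?thesis using assms by (simp add: grad_def p \<psi>'_def vec_eq_iff zero_vec_def[symmetric])
    next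
      case True
      have "norm (grad (\<lambda>x. complex_of_real (\<eta> x)) x) = norm ((\<psi>' (\<tau> x) * (- 2 / d)) *\<^sub>R (x - X))"
      proof -
        have "norm (grad (\<lambda>x. complex_of_real (\<eta> x)) x $ i) = norm (((\<psi>' (\<tau> x) * (- 2 / d)) *\<^sub>R (x - X)) $ i)" for i
          unfolding grad_def vec_lambda_beta p norm_of_real vector_scaleR_component real_norm_def real_scaleR_def ..
        then show ?thesis unfolding norm_vec_def by simp
      qed
      also have "\<dots> = \<psi>' (\<tau> x) * (2 / d) * norm (x - X)"
        using d \<psi>'b(1)[of "\<tau> x"] by (simp add: abs_mult)
      also have "\<dots> \<le> 4 * (2 / d) * R"
        using True d \<psi>'b[of "\<tau> x"] by (intro mult_mono) (auto simp: dist_norm norm_minus_commute)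
      also have "\<dots> = 8 * R / ((R - \<rho>) * (R + \<rho>))"
        by (simp add: d_def power2_eq_square algebra_simps)
      also have "\<dots> \<le> 8 / (R - \<rho>)"
        using assms by (simp add: divide_simps)
      finally show ?thesis .
    qed
  qed (use \<psi>b \<psi>0 \<psi>1 inn less_imp_le[OF out] in \<open>auto simp: \<eta>_def\<close>)
qed

section \<open>Passage to the limit in test functions\<close>

definition cutoff :: "(real^'n) set \<Rightarrow> real \<Rightarrow> (real^'n \<Rightarrow> real) \<Rightarrow> bool" where
  "cutoff S L \<eta> \<longleftrightarrow> k_smooth (Suc 0) (\<lambda>x. complex_of_real (\<eta> x)) \<and> (\<forall>x. 0 \<le> \<eta> x \<and> \<eta> x \<le> 1) \<and>
     (\<forall>x. x \<notin> S \<longrightarrow> \<eta> x = 0) \<and> 0 \<le> L \<and> (\<forall>x. norm (grad (\<lambda>x. complex_of_real (\<eta> x)) x) \<le> L)"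

definition cut_tmap :: "real \<Rightarrow> real \<Rightarrow> (real^'n \<Rightarrow> real) \<Rightarrow> (real^'n \<Rightarrow> complex) \<Rightarrow> real^'n \<Rightarrow> complex" where
  "cut_tmap k a \<eta> u x = complex_of_real (\<eta> x) * tmap k a (u x)"

text \<open>The formal gradient of \<open>cut_tmap\<close>, with \<open>G\<close> in place of the
  gradient of \<open>u\<close>; it is the true gradient when \<open>u\<close> is C1 and
  \<open>G\<close> is \<open>grad u\<close>.\<close>

definition cut_tdiff :: "real \<Rightarrow> real \<Rightarrow> (real^'n \<Rightarrow> real) \<Rightarrow> (real^'n \<Rightarrow> complex) \<Rightarrow> (real^'n \<Rightarrow> complex^'n)
    \<Rightarrow> real^'n \<Rightarrow> complex^'n" where
  "cut_tdiff k a \<eta> u G x = tmap k a (u x) *s grad (\<lambda>x. complex_of_real (\<eta> x)) x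
     + complex_of_real (\<eta> x) *s tdiff k a (u x) (G x)"

text \<open>The formal gradient of the squared cutoff times \<open>tmap k a\<close> of
  \<open>u\<close>, computed as a product of the cutoff and \<open>cut_tmap\<close>.\<close>

definition cut_test_grad :: "real \<Rightarrow> real \<Rightarrow> (real^'n \<Rightarrow> real) \<Rightarrow> (real^'n \<Rightarrow> complex) \<Rightarrow> (real^'n \<Rightarrow> complex^'n)
    \<Rightarrow> real^'n \<Rightarrow> complex^'n" where
  "cut_test_grad k a \<eta> u G x = cut_tmap k a \<eta> u x *s grad (\<lambda>x. complex_of_real (\<eta> x)) x
     + complex_of_real (\<eta> x) *s cut_tdiff k a \<eta> u G x"

lemma cutoff_grad_outside:
  assumes "cutoff S L \<eta>" "closed S" "x \<notin> S"
  shows "grad (\<lambda>x. complex_of_real (\<eta> x)) x = 0"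
proof -
  have "partial i (\<lambda>x. complex_of_real (\<eta> x)) x = 0" for i
    by (rule partial_eq_0_open[of "- S"]) (use assms in \<open>auto simp: cutoff_def\<close>)
  then show ?thesis by (simp add: grad_def vec_eq_iff)
qed

lemma norm_smult: "norm (c *s (v :: complex^'n)) = norm c * norm v"
  by (simp add: norm_vec_def norm_mult L2_set_right_distrib)

lemma norm_smult_add_le:
  fixes g w :: "complex^'n"
  assumes "norm p \<le> y" "norm g \<le> L" "0 \<le> e" "e \<le> 1" "norm w \<le> z"
  shows "norm (p *s g + complex_of_real e *s w) \<le> y * L + z"
proof -
  have "norm p * norm g \<le> y * L"
    using assms by (intro mult_mono) (auto intro: order_trans[OF norm_ge_zero])
  moreover have "norm (complex_of_real e) * norm w \<le> 1 * z"
    using assms by (intro mult_mono) auto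
  ultimately show ?thesis
    using norm_triangle_ineq[of "p *s g" "complex_of_real e *s w"] by (simp add: norm_smult)
qed

lemma grad_cut_tmap:
  assumes "1 \<le> k" "cutoff S L \<eta>" "k_smooth (Suc 0) U"
  shows "k_smooth (Suc 0) (cut_tmap k a \<eta> U)" "grad (cut_tmap k a \<eta> U) = cut_tdiff k a \<eta> U (grad U)"
proof -
  have \<eta>: "k_smooth (Suc 0) (\<lambda>x. complex_of_real (\<eta> x))" using assms(2) by (simp add: cutoff_def)
  note t = grad_tmap[OF assms(1,3)]
  have eq: "cut_tmap k a \<eta> U = (\<lambda>x. complex_of_real (\<eta> x) * tmap k a (U x))"
    by (rule ext) (simp add: cut_tmap_def)
  show "k_smooth (Suc 0) (cut_tmap k a \<eta> U)"
    unfolding eq by (rule k_smooth_mult[OF \<eta> t(1)])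
  show "grad (cut_tmap k a \<eta> U) = cut_tdiff k a \<eta> U (grad U)"
    unfolding eq grad_mult[OF \<eta> t(1)] t(2) by (rule ext) (simp add: cut_tdiff_def)
qed

lemma norm_tmap: "1 \<le> k \<Longrightarrow> norm (tmap k a z) = tpow k a ((norm z)\<^sup>2) * norm z"
  using tpow_pos[of k "(norm z)\<^sup>2" a] by (simp add: tmap_def)

definition cut_bound :: "real \<Rightarrow> real \<Rightarrow> real \<Rightarrow> real" where
  "cut_bound k a L = k powr \<bar>a\<bar> * (L + 1 + 2 * \<bar>a\<bar>)"

text \<open>A bound linear in the majorant \<open>d\<close>, with a constant that may depend on
  \<open>k\<close>, suffices here: it only justifies limits under the integral. Bounds uniform in
  \<open>k\<close> come from the equation.\<close>

lemma cut_bounds: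
  assumes k: "1 \<le> k" and \<eta>: "cutoff S L \<eta>" "closed S"
  assumes d: "x \<in> S \<Longrightarrow> norm (u x) \<le> d" "x \<in> S \<Longrightarrow> norm (G x) \<le> d"
  shows "norm (cut_tmap k a \<eta> u x) \<le> cut_bound k a L * (indicator S x * d)"
    and "norm (cut_tdiff k a \<eta> u G x) \<le> cut_bound k a L * (indicator S x * d)"
proof -
  have \<eta>x: "0 \<le> \<eta> x" "\<eta> x \<le> 1" "norm (grad (\<lambda>x. complex_of_real (\<eta> x)) x) \<le> L" "0 \<le> L"
    using \<eta> by (auto simp: cutoff_def)
  let ?F = "tpow k a ((norm (u x))\<^sup>2)"
  have F: "0 \<le> ?F" "?F \<le> k powr \<bar>a\<bar>"
    using tpow_pos[OF k, of "(norm (u x))\<^sup>2" a] tpow_le[OF k, of "(norm (u x))\<^sup>2" a] by auto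
  have "norm (cut_tmap k a \<eta> u x) \<le> cut_bound k a L * d \<and> norm (cut_tdiff k a \<eta> u G x) \<le> cut_bound k a L * d" if x: "x \<in> S"
  proof -
    have d0: "0 \<le> d" using d(1)[OF x] norm_ge_zero order_trans by blast
    have t: "norm (tmap k a (u x)) \<le> k powr \<bar>a\<bar> * d"
      unfolding norm_tmap[OF k] using F d(1)[OF x] by (intro mult_mono) auto
    have t2: "norm (tdiff k a (u x) (G x)) \<le> (1 + 2 * \<bar>a\<bar>) * k powr \<bar>a\<bar> * d"
      using F d(2)[OF x] by (intro order_trans[OF norm_tdiff_le[OF k]] mult_mono) auto
    have "norm (cut_tmap k a \<eta> u x) \<le> 1 * (k powr \<bar>a\<bar> * d)"
      unfolding cut_tmap_def norm_mult using \<eta>x t by (intro mult_mono) auto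
    also have "\<dots> = k powr \<bar>a\<bar> * 1 * d" by simp
    also have "\<dots> \<le> k powr \<bar>a\<bar> * (L + 1 + 2 * \<bar>a\<bar>) * d"
      using \<eta>x d0 by (intro mult_right_mono mult_left_mono) auto
    finally have 1: "norm (cut_tmap k a \<eta> u x) \<le> cut_bound k a L * d" by (simp add: cut_bound_def)
    have "norm (cut_tdiff k a \<eta> u G x) \<le> (k powr \<bar>a\<bar> * d) * L + (1 + 2 * \<bar>a\<bar>) * k powr \<bar>a\<bar> * d"
      unfolding cut_tdiff_def by (rule norm_smult_add_le) (fact t \<eta>x t2)+
    also have "\<dots> = cut_bound k a L * d" by (simp add: cut_bound_def algebra_simps)
    finally show ?thesis using 1 by simp
  qed
  moreover have "cut_tmap k a \<eta> u x = 0 \<and> cut_tdiff k a \<eta> u G x = 0" if "x \<notin> S"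
    using that \<eta>(1) cutoff_grad_outside[OF \<eta> that] by (simp add: cut_tmap_def cut_tdiff_def cutoff_def)
  ultimately show "norm (cut_tmap k a \<eta> u x) \<le> cut_bound k a L * (indicator S x * d)"
      "norm (cut_tdiff k a \<eta> u G x) \<le> cut_bound k a L * (indicator S x * d)"
    by (auto split: split_indicator)
qed

lemma borel_measurable_smult:
  assumes "f \<in> borel_measurable M" "g \<in> borel_measurable M"
  shows "(\<lambda>x. f x *s (g x :: complex^'n)) \<in> borel_measurable M"
  using assms
  by (rule borel_measurable_continuous_Pair) (unfold vector_scalar_mult_def, intro continuous_intros)

lemma cutoff_measurable:
  assumes "cutoff S L \<eta>"
  shows "\<eta> \<in> borel_measurable borel" "grad (\<lambda>x. complex_of_real (\<eta> x)) \<in> borel_measurable borel"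
proof -
  have s: "k_smooth (Suc 0) (\<lambda>x. complex_of_real (\<eta> x))" using assms by (simp add: cutoff_def)
  have "continuous_on UNIV (\<lambda>x. Re (complex_of_real (\<eta> x)))"
    using k_smooth_Suc_imp[OF s] by (intro continuous_intros) simp
  then show "\<eta> \<in> borel_measurable borel" by (intro borel_measurable_continuous_onI) simp
  show "grad (\<lambda>x. complex_of_real (\<eta> x)) \<in> borel_measurable borel"
    by (rule borel_measurable_continuous_onI[OF continuous_on_grad[OF s]])
qed

lemma borel_measurable_tmap:
  "1 \<le> k \<Longrightarrow> u \<in> borel_measurable M \<Longrightarrow> (\<lambda>x. tmap k a (u x)) \<in> borel_measurable M"
  by (rule measurable_compose[OF _ borel_measurable_continuous_onI[OF continuous_on_tmap]])

lemma borel_measurable_tdiff: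
  "1 \<le> k \<Longrightarrow> u \<in> borel_measurable M \<Longrightarrow> G \<in> borel_measurable M \<Longrightarrow>
    (\<lambda>x. tdiff k a (u x) (G x :: complex^'n)) \<in> borel_measurable M"
  by (rule borel_measurable_continuous_Pair) (auto intro: continuous_on_tdiff)

lemma borel_measurable_tpow:
  assumes "1 \<le> k" "u \<in> borel_measurable M"
  shows "(\<lambda>x. tpow k a ((norm (u x :: complex))\<^sup>2)) \<in> borel_measurable M"
  by (rule measurable_compose[OF assms(2) borel_measurable_continuous_onI[OF continuous_on_tpow_norm[OF assms(1)]]])

lemma borel_measurable_cut:
  assumes k: "1 \<le> k" and \<eta>: "cutoff S L \<eta>"
    and u: "u \<in> borel_measurable borel" and G: "G \<in> borel_measurable borel"
  shows "cut_tmap k a \<eta> u \<in> borel_measurable borel" "cut_tdiff k a \<eta> u G \<in> borel_measurable borel"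
proof -
  note [measurable] = cutoff_measurable[OF \<eta>] borel_measurable_tmap[OF k u] borel_measurable_tdiff[OF k u G]
  show "cut_tmap k a \<eta> u \<in> borel_measurable borel" unfolding cut_tmap_def[abs_def] by measurable
  show "cut_tdiff k a \<eta> u G \<in> borel_measurable borel"
    unfolding cut_tdiff_def[abs_def]
    by (intro borel_measurable_add borel_measurable_smult) measurable
qed

lemma tendsto_cut:
  assumes k: "1 \<le> k" and u: "(\<lambda>j. U j x) \<longlonglongrightarrow> u x" and G: "(\<lambda>j. V j x) \<longlonglongrightarrow> G x"
  shows "(\<lambda>j. cut_tmap k a \<eta> (U j) x) \<longlonglongrightarrow> cut_tmap k a \<eta> u x"
    and "(\<lambda>j. cut_tdiff k a \<eta> (U j) (V j) x) \<longlonglongrightarrow> cut_tdiff k a \<eta> u G x"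
proof -
  have t: "(\<lambda>j. tmap k a (U j x)) \<longlonglongrightarrow> tmap k a (u x)"
    by (rule continuous_on_tendsto_compose[OF continuous_on_tmap[OF k] u]) auto
  have d: "(\<lambda>j. tdiff k a (fst (U j x, V j x)) (snd (U j x, V j x))) \<longlonglongrightarrow> tdiff k a (fst (u x, G x)) (snd (u x, G x))"
    by (rule continuous_on_tendsto_compose[OF continuous_on_tdiff[OF k] tendsto_Pair[OF u G]]) auto
  show "(\<lambda>j. cut_tmap k a \<eta> (U j) x) \<longlonglongrightarrow> cut_tmap k a \<eta> u x"
    unfolding cut_tmap_def by (intro tendsto_intros t)
  show "(\<lambda>j. cut_tdiff k a \<eta> (U j) (V j) x) \<longlonglongrightarrow> cut_tdiff k a \<eta> u G x"
    unfolding cut_tdiff_def vector_scalar_mult_def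
    by (intro tendsto_add tendsto_vec_lambda tendsto_mult tendsto_vec_nth t tendsto_const d[unfolded fst_conv snd_conv])
qed

text \<open>All that the unweighted analysis retains of the equation: Borel functions, a dominated
  C1 approximation on \<open>S\<close>, and a flux \<open>B\<close> that is pointwise an elliptic
  image of \<open>G\<close> and annihilates gradients of C1 functions vanishing off
  \<open>S\<close>. The matrix is asked for point by point, so that it need not be carried along as
  a measurable object.\<close>

locale approximable_solution =
  fixes S :: "(real^'n) set" and u :: "real^'n \<Rightarrow> complex" and G B :: "real^'n \<Rightarrow> complex^'n"
    and U :: "nat \<Rightarrow> real^'n \<Rightarrow> complex" and D :: "real^'n \<Rightarrow> real" and c \<Lambda> s :: real
  assumes S: "compact S"
    and u [measurable]: "u \<in> borel_measurable borel"
    and G [measurable]: "G \<in> borel_measurable borel"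
    and B [measurable]: "B \<in> borel_measurable borel"
    and D [measurable]: "D \<in> borel_measurable borel"
    and D2: "integrable lborel (\<lambda>x. (D x)\<^sup>2)"
    and D0: "\<And>x. 0 \<le> D x"
    and U: "\<And>j. k_smooth (Suc 0) (U j)"
    and dom: "AE x in lborel. x \<in> S \<longrightarrow> (\<forall>j. norm (U j x) \<le> D x \<and> norm (grad (U j) x) \<le> D x)"
    and lim: "AE x in lborel. x \<in> S \<longrightarrow> (\<lambda>j. U j x) \<longlonglongrightarrow> u x \<and> (\<lambda>j. grad (U j) x) \<longlonglongrightarrow> G x"
    and c: "0 < c" and \<Lambda>: "0 < \<Lambda>"
    and ell: "AE x in lborel. x \<in> S \<longrightarrow> (\<exists>M. B x = M *v G x \<and>
        (\<forall>\<xi>. c * (norm \<xi>)\<^sup>2 \<le> Re (hdot (M *v \<xi>) \<xi>)) \<and>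
        (\<forall>\<xi>. c * (norm \<xi>)\<^sup>2 \<le> Re (hdot (M *v \<xi>) (J_form s \<xi>))))"
    and bdd: "AE x in lborel. x \<in> S \<longrightarrow> norm (B x) \<le> \<Lambda> * norm (G x)"
    and weak: "\<And>\<Psi>. k_smooth (Suc 0) \<Psi> \<Longrightarrow> (\<And>x. x \<notin> S \<Longrightarrow> \<Psi> x = 0) \<Longrightarrow> (LINT x|lborel. hdot (B x) (grad \<Psi> x)) = 0"
begin

lemma S_sets [measurable]: "S \<in> sets borel"
  using S by (simp add: borel_compact)

lemma closed_S: "closed S"
  using S by (rule compact_imp_closed)

lemma solution_dom: "AE x in lborel. x \<in> S \<longrightarrow> norm (u x) \<le> D x \<and> norm (G x) \<le> D x"
  using dom lim
proof eventually_elim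
  fix x
  assume d: "x \<in> S \<longrightarrow> (\<forall>j. norm (U j x) \<le> D x \<and> norm (grad (U j) x) \<le> D x)"
    and l: "x \<in> S \<longrightarrow> (\<lambda>j. U j x) \<longlonglongrightarrow> u x \<and> (\<lambda>j. grad (U j) x) \<longlonglongrightarrow> G x"
  show "x \<in> S \<longrightarrow> norm (u x) \<le> D x \<and> norm (G x) \<le> D x"
  proof
    assume x: "x \<in> S"
    have "(\<lambda>j. norm (U j x)) \<longlonglongrightarrow> norm (u x)" "(\<lambda>j. norm (grad (U j) x)) \<longlonglongrightarrow> norm (G x)"
      using l x by (auto intro: tendsto_norm)
    then show "norm (u x) \<le> D x \<and> norm (G x) \<le> D x"
      using d x by (intro conjI LIMSEQ_le_const2) auto
  qed
qed

lemma integrable_SD2: "integrable lborel (\<lambda>x. indicator S x * (D x)\<^sup>2 :: real)"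
  using integrable_mult_indicator[OF _ D2, of S] by simp

lemma integrable_SD: "integrable lborel (\<lambda>x. indicator S x * D x :: real)"
proof (rule Bochner_Integration.integrable_bound)
  show "integrable lborel (\<lambda>x. indicat_real S x + indicator S x * (D x)\<^sup>2)"
    using emeasure_bounded_finite[OF compact_imp_bounded[OF S]]
    by (intro Bochner_Integration.integrable_add integrable_real_indicator integrable_SD2) auto
  show "AE x in lborel. norm (indicator S x * D x) \<le> norm (indicat_real S x + indicator S x * (D x)\<^sup>2)"
  proof (intro AE_I2)
    fix x
    have "D x \<le> 1 + (D x)\<^sup>2"
    proof -
      have "2 * D x \<le> (D x)\<^sup>2 + 1"
        using zero_le_power2[of "D x - 1"] unfolding power2_diff by simp
      then show ?thesis using D0[of x] by linarith
    qed
    then show "norm (indicator S x * D x) \<le> norm (indicat_real S x + indicator S x * (D x)\<^sup>2)"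
      using D0[of x] by (auto split: split_indicator)
  qed
qed measurable

context
  fixes k a L :: real and \<eta> :: "real^'n \<Rightarrow> real"
  assumes k: "1 \<le> k" and \<eta>: "cutoff S L \<eta>"
begin

abbreviation "bnd \<equiv> cut_bound k a L"

lemma bnd_nonneg: "0 \<le> bnd"
  using \<eta> by (simp add: cut_bound_def cutoff_def)

lemma cut_U_meas [measurable]: "cut_tmap k a \<eta> (U j) \<in> borel_measurable borel"
    "cut_tdiff k a \<eta> (U j) (grad (U j)) \<in> borel_measurable borel"
proof -
  have "U j \<in> borel_measurable borel" "grad (U j) \<in> borel_measurable borel"
    using k_smooth_Suc_imp[OF U[of j]] continuous_on_grad[OF U[of j]]
    by (auto intro: borel_measurable_continuous_onI)
  from borel_measurable_cut[OF k \<eta> this, of a]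
  show "cut_tmap k a \<eta> (U j) \<in> borel_measurable borel"
    "cut_tdiff k a \<eta> (U j) (grad (U j)) \<in> borel_measurable borel" .
qed

lemma cut_meas [measurable]: "cut_tmap k a \<eta> u \<in> borel_measurable borel"
    "cut_tdiff k a \<eta> u G \<in> borel_measurable borel"
  using borel_measurable_cut[OF k \<eta> u G, of a] .

lemma cut_U_dom: "AE x in lborel. \<forall>j. norm (cut_tmap k a \<eta> (U j) x) \<le> bnd * (indicator S x * D x) \<and>
    norm (cut_tdiff k a \<eta> (U j) (grad (U j)) x) \<le> bnd * (indicator S x * D x)"
  using dom
proof eventually_elim
  fix x assume d: "x \<in> S \<longrightarrow> (\<forall>j. norm (U j x) \<le> D x \<and> norm (grad (U j) x) \<le> D x)"
  show "\<forall>j. norm (cut_tmap k a \<eta> (U j) x) \<le> bnd * (indicator S x * D x) \<and>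
      norm (cut_tdiff k a \<eta> (U j) (grad (U j)) x) \<le> bnd * (indicator S x * D x)"
    by (intro allI conjI cut_bounds[OF k \<eta> closed_S]) (use d in auto)
qed

lemma cut_dom: "AE x in lborel. norm (cut_tmap k a \<eta> u x) \<le> bnd * (indicator S x * D x) \<and>
    norm (cut_tdiff k a \<eta> u G x) \<le> bnd * (indicator S x * D x)"
  using solution_dom
proof eventually_elim
  fix x assume d: "x \<in> S \<longrightarrow> norm (u x) \<le> D x \<and> norm (G x) \<le> D x"
  show "norm (cut_tmap k a \<eta> u x) \<le> bnd * (indicator S x * D x) \<and>
      norm (cut_tdiff k a \<eta> u G x) \<le> bnd * (indicator S x * D x)"
    by (intro conjI cut_bounds[OF k \<eta> closed_S]) (use d in auto)
qed

lemma cut_lim: "AE x in lborel. (\<lambda>j. cut_tmap k a \<eta> (U j) x) \<longlonglongrightarrow> cut_tmap k a \<eta> u x \<and>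
    (\<lambda>j. cut_tdiff k a \<eta> (U j) (grad (U j)) x) \<longlonglongrightarrow> cut_tdiff k a \<eta> u G x"
  using lim
proof eventually_elim
  fix x assume l: "x \<in> S \<longrightarrow> (\<lambda>j. U j x) \<longlonglongrightarrow> u x \<and> (\<lambda>j. grad (U j) x) \<longlonglongrightarrow> G x"
  show "(\<lambda>j. cut_tmap k a \<eta> (U j) x) \<longlonglongrightarrow> cut_tmap k a \<eta> u x \<and>
    (\<lambda>j. cut_tdiff k a \<eta> (U j) (grad (U j)) x) \<longlonglongrightarrow> cut_tdiff k a \<eta> u G x"
  proof (cases "x \<in> S")
    case True
    with l show ?thesis using tendsto_cut[OF k, of U x u "\<lambda>j. grad (U j)" G] by auto
  next
    case False
    then show ?thesis
      using \<eta> cutoff_grad_outside[OF \<eta> closed_S False] by (simp add: cut_tmap_def cut_tdiff_def cutoff_def)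
  qed
qed

lemma square_dom: "norm v \<le> bnd * (indicator S x * D x) \<Longrightarrow> (norm v)\<^sup>2 \<le> bnd\<^sup>2 * (indicator S x * (D x)\<^sup>2)"
proof -
  assume "norm v \<le> bnd * (indicator S x * D x)"
  then have "(norm v)\<^sup>2 \<le> (bnd * (indicator S x * D x))\<^sup>2" by (intro power_mono) auto
  then show ?thesis by (simp add: power_mult_distrib split: split_indicator_asm split_indicator)
qed

lemma cut_integrable:
  "integrable lborel (\<lambda>x. (norm (cut_tmap k a \<eta> u x))\<^sup>2)" "integrable lborel (\<lambda>x. (norm (cut_tdiff k a \<eta> u G x))\<^sup>2)"
  "integrable lborel (\<lambda>x. norm (cut_tmap k a \<eta> u x))"
proof -
  have i2: "integrable lborel (\<lambda>x. bnd\<^sup>2 * (indicator S x * (D x)\<^sup>2))"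
    by (intro integrable_mult_right integrable_SD2)
  have i1: "integrable lborel (\<lambda>x. bnd * (indicator S x * D x))"
    by (intro integrable_mult_right integrable_SD)
  show "integrable lborel (\<lambda>x. (norm (cut_tmap k a \<eta> u x))\<^sup>2)"
    by (rule Bochner_Integration.integrable_bound[OF i2], measurable)
      (use cut_dom in eventually_elim, use square_dom in fastforce)
  show "integrable lborel (\<lambda>x. (norm (cut_tdiff k a \<eta> u G x))\<^sup>2)"
    by (rule Bochner_Integration.integrable_bound[OF i2], measurable)
      (use cut_dom in eventually_elim, use square_dom in fastforce)
  show "integrable lborel (\<lambda>x. norm (cut_tmap k a \<eta> u x))"
    by (rule Bochner_Integration.integrable_bound[OF i1], measurable)
      (use cut_dom in eventually_elim, auto)
qed

lemma cut_integral_limits: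
  "(\<lambda>j. LINT x|lborel. (norm (cut_tmap k a \<eta> (U j) x))\<^sup>2) \<longlonglongrightarrow> (LINT x|lborel. (norm (cut_tmap k a \<eta> u x))\<^sup>2)"
  "(\<lambda>j. LINT x|lborel. (norm (cut_tdiff k a \<eta> (U j) (grad (U j)) x))\<^sup>2) \<longlonglongrightarrow> (LINT x|lborel. (norm (cut_tdiff k a \<eta> u G x))\<^sup>2)"
  "(\<lambda>j. LINT x|lborel. norm (cut_tmap k a \<eta> (U j) x)) \<longlonglongrightarrow> (LINT x|lborel. norm (cut_tmap k a \<eta> u x))"
proof -
  have i2: "integrable lborel (\<lambda>x. bnd\<^sup>2 * (indicator S x * (D x)\<^sup>2))"
    by (intro integrable_mult_right integrable_SD2)
  have i1: "integrable lborel (\<lambda>x. bnd * (indicator S x * D x))"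
    by (intro integrable_mult_right integrable_SD)
  show "(\<lambda>j. LINT x|lborel. (norm (cut_tmap k a \<eta> (U j) x))\<^sup>2) \<longlonglongrightarrow> (LINT x|lborel. (norm (cut_tmap k a \<eta> u x))\<^sup>2)"
  proof (rule integral_dominated_convergence[OF _ _ i2])
    show "AE x in lborel. (\<lambda>j. (norm (cut_tmap k a \<eta> (U j) x))\<^sup>2) \<longlonglongrightarrow> (norm (cut_tmap k a \<eta> u x))\<^sup>2"
      using cut_lim by eventually_elim (auto intro!: tendsto_intros)
    show "AE x in lborel. norm ((norm (cut_tmap k a \<eta> (U j) x))\<^sup>2) \<le> bnd\<^sup>2 * (indicator S x * (D x)\<^sup>2)" for j
      using cut_U_dom by eventually_elim (use square_dom in auto)
  qed measurable
  show "(\<lambda>j. LINT x|lborel. (norm (cut_tdiff k a \<eta> (U j) (grad (U j)) x))\<^sup>2) \<longlonglongrightarrow> (LINT x|lborel. (norm (cut_tdiff k a \<eta> u G x))\<^sup>2)"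
  proof (rule integral_dominated_convergence[OF _ _ i2])
    show "AE x in lborel. (\<lambda>j. (norm (cut_tdiff k a \<eta> (U j) (grad (U j)) x))\<^sup>2) \<longlonglongrightarrow> (norm (cut_tdiff k a \<eta> u G x))\<^sup>2"
      using cut_lim by eventually_elim (auto intro!: tendsto_intros)
    show "AE x in lborel. norm ((norm (cut_tdiff k a \<eta> (U j) (grad (U j)) x))\<^sup>2) \<le> bnd\<^sup>2 * (indicator S x * (D x)\<^sup>2)" for j
      using cut_U_dom by eventually_elim (use square_dom in auto)
  qed measurable
  show "(\<lambda>j. LINT x|lborel. norm (cut_tmap k a \<eta> (U j) x)) \<longlonglongrightarrow> (LINT x|lborel. norm (cut_tmap k a \<eta> u x))"
  proof (rule integral_dominated_convergence[OF _ _ i1])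
    show "AE x in lborel. (\<lambda>j. norm (cut_tmap k a \<eta> (U j) x)) \<longlonglongrightarrow> norm (cut_tmap k a \<eta> u x)"
      using cut_lim by eventually_elim (auto intro!: tendsto_intros)
    show "AE x in lborel. norm (norm (cut_tmap k a \<eta> (U j) x)) \<le> bnd * (indicator S x * D x)" for j
      using cut_U_dom by eventually_elim auto
  qed measurable
qed

text \<open>The Nash inequality is available for the C1 functions built from \<open>U j\<close>; its
  three integrals converge by domination, so the inequality survives with the formal
  gradient.\<close>

lemma cut_nash:
  assumes t: "0 < t"
  defines "v \<equiv> measure lborel (ball (0::real^'n) t)"
  shows "v * (LINT x|lborel. (norm (cut_tmap k a \<eta> u x))\<^sup>2) \<le>
    v * (t\<^sup>2 * (LINT x|lborel. (norm (cut_tdiff k a \<eta> u G x))\<^sup>2)) + 2 * (LINT x|lborel. norm (cut_tmap k a \<eta> u x))\<^sup>2"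
proof (rule LIMSEQ_le)
  show "(\<lambda>j. v * (LINT x|lborel. (norm (cut_tmap k a \<eta> (U j) x))\<^sup>2)) \<longlonglongrightarrow> v * (LINT x|lborel. (norm (cut_tmap k a \<eta> u x))\<^sup>2)"
    by (intro tendsto_intros cut_integral_limits)
  show "(\<lambda>j. v * (t\<^sup>2 * (LINT x|lborel. (norm (cut_tdiff k a \<eta> (U j) (grad (U j)) x))\<^sup>2)) + 2 * (LINT x|lborel. norm (cut_tmap k a \<eta> (U j) x))\<^sup>2)
    \<longlonglongrightarrow> v * (t\<^sup>2 * (LINT x|lborel. (norm (cut_tdiff k a \<eta> u G x))\<^sup>2)) + 2 * (LINT x|lborel. norm (cut_tmap k a \<eta> u x))\<^sup>2"
    by (intro tendsto_intros cut_integral_limits)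
  show "\<exists>N. \<forall>j\<ge>N. v * (LINT x|lborel. (norm (cut_tmap k a \<eta> (U j) x))\<^sup>2) \<le>
      v * (t\<^sup>2 * (LINT x|lborel. (norm (cut_tdiff k a \<eta> (U j) (grad (U j)) x))\<^sup>2)) + 2 * (LINT x|lborel. norm (cut_tmap k a \<eta> (U j) x))\<^sup>2"
  proof (intro exI allI impI)
    fix j
    let ?w = "cut_tmap k a \<eta> (U j)" and ?g = "cut_tdiff k a \<eta> (U j) (grad (U j))"
    have i2: "integrable lborel (\<lambda>x. bnd\<^sup>2 * (indicator S x * (D x)\<^sup>2))"
      by (intro integrable_mult_right integrable_SD2)
    have i1: "integrable lborel (\<lambda>x. bnd * (indicator S x * D x))"
      by (intro integrable_mult_right integrable_SD)
    have iw: "integrable lborel (\<lambda>x. (norm (?w x))\<^sup>2)"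
      by (rule Bochner_Integration.integrable_bound[OF i2], measurable)
        (use cut_U_dom in eventually_elim, use square_dom in fastforce)
    have ig: "integrable lborel (\<lambda>x. (norm (?g x))\<^sup>2)"
      by (rule Bochner_Integration.integrable_bound[OF i2], measurable)
        (use cut_U_dom in eventually_elim, use square_dom in fastforce)
    have iw1: "integrable lborel (\<lambda>x. norm (?w x))"
      by (rule Bochner_Integration.integrable_bound[OF i1], measurable)
        (use cut_U_dom in eventually_elim, auto intro: order_trans[OF _ abs_ge_self])
    have v: "emeasure lborel (ball (0::real^'n) t) = ennreal v"
      unfolding v_def using emeasure_bounded_finite[of "ball (0::real^'n) t"]
      by (intro emeasure_eq_ennreal_measure) (simp add: top.not_eq_extremum)
    have "0 \<le> v" by (simp add: v_def)
    have 1: "l2sq ?w = ennreal (LINT x|lborel. (norm (?w x))\<^sup>2)"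
      unfolding l2sq_def by (rule nn_integral_eq_integral[OF iw]) simp
    have 2: "l2sq ?g = ennreal (LINT x|lborel. (norm (?g x))\<^sup>2)"
      unfolding l2sq_def by (rule nn_integral_eq_integral[OF ig]) simp
    have 3: "(\<integral>\<^sup>+x. ennreal (norm (?w x)) \<partial>lborel) = ennreal (LINT x|lborel. norm (?w x))"
      by (rule nn_integral_eq_integral[OF iw1]) simp
    have "ennreal v * l2sq ?w \<le> ennreal v * (ennreal (t\<^sup>2) * l2sq ?g) + 2 * (\<integral>\<^sup>+x. ennreal (norm (?w x)) \<partial>lborel)\<^sup>2"
      using nash_inequality_ennreal[OF grad_cut_tmap(1)[OF k \<eta> U] t] grad_cut_tmap(2)[OF k \<eta> U]
      unfolding v by metis
    then have "ennreal (v * (LINT x|lborel. (norm (?w x))\<^sup>2)) \<le>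
        ennreal (v * (t\<^sup>2 * (LINT x|lborel. (norm (?g x))\<^sup>2)) + 2 * (LINT x|lborel. norm (?w x))\<^sup>2)"
      unfolding 1 2 3 using \<open>0 \<le> v\<close> by (simp add: ennreal_mult ennreal_power)
    then show "v * (LINT x|lborel. (norm (?w x))\<^sup>2) \<le>
        v * (t\<^sup>2 * (LINT x|lborel. (norm (?g x))\<^sup>2)) + 2 * (LINT x|lborel. norm (?w x))\<^sup>2"
      using \<open>0 \<le> v\<close> by (subst (asm) ennreal_le_iff) (auto intro!: add_nonneg_nonneg mult_nonneg_nonneg)
  qed
qed

abbreviation "test_grad \<equiv> cut_test_grad k a \<eta>"

lemma B_dom: "AE x in lborel. x \<in> S \<longrightarrow> norm (B x) \<le> \<Lambda> * D x"
  using bdd solution_dom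
proof eventually_elim
  fix x
  assume "x \<in> S \<longrightarrow> norm (B x) \<le> \<Lambda> * norm (G x)" "x \<in> S \<longrightarrow> norm (u x) \<le> D x \<and> norm (G x) \<le> D x"
  then show "x \<in> S \<longrightarrow> norm (B x) \<le> \<Lambda> * D x"
    using \<Lambda> by (auto intro!: order_trans[OF _ mult_left_mono[of "norm (G x)" "D x" \<Lambda>]])
qed

lemma test_grad_le:
  assumes "norm (cut_tmap k a \<eta> V x) \<le> bnd * (indicator S x * D x)"
    "norm (cut_tdiff k a \<eta> V H x) \<le> bnd * (indicator S x * D x)" and b: "x \<in> S \<longrightarrow> norm (B x) \<le> \<Lambda> * D x"
  shows "norm (hdot (B x) (test_grad V H x)) \<le> \<Lambda> * bnd * (L + 1) * (indicator S x * (D x)\<^sup>2)"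
proof -
  have \<eta>x: "0 \<le> \<eta> x" "\<eta> x \<le> 1" "norm (grad (\<lambda>x. complex_of_real (\<eta> x)) x) \<le> L" "0 \<le> L"
    using \<eta> by (auto simp: cutoff_def)
  have d: "0 \<le> bnd * (indicator S x * D x)" using bnd_nonneg D0[of x] by (simp split: split_indicator)
  have "norm (test_grad V H x) \<le> (bnd * (indicator S x * D x)) * L + bnd * (indicator S x * D x)"
    unfolding cut_test_grad_def by (rule norm_smult_add_le) (fact assms \<eta>x)+
  then have t: "norm (test_grad V H x) \<le> bnd * (L + 1) * (indicator S x * D x)" by (simp add: algebra_simps)
  show ?thesis
  proof (cases "x \<in> S")
    case True
    have "norm (hdot (B x) (test_grad V H x)) \<le> norm (B x) * norm (test_grad V H x)" by (rule norm_hdot_le)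
    also have "\<dots> \<le> (\<Lambda> * D x) * (bnd * (L + 1) * (indicator S x * D x))"
      using t b True \<Lambda> D0[of x] by (intro mult_mono) auto
    finally show ?thesis using True by (simp add: power2_eq_square algebra_simps)
  next
    case False
    then have "test_grad V H x = 0" using t by simp
    then show ?thesis using False by (simp add: hdot_def)
  qed
qed

text \<open>The flux \<open>B\<close> is that of the solution and stays fixed; only the nonlinear
  test function is approximated. The equation holds exactly for each \<open>U j\<close>, and the
  limit is taken under a multiple of the square of \<open>D\<close>.\<close>

lemma test_grad_integrable: "integrable lborel (\<lambda>x. hdot (B x) (test_grad u G x))"
  and test_grad_integral: "(LINT x|lborel. hdot (B x) (test_grad u G x)) = 0"
proof -
  have ks: "k_smooth (Suc 0) (\<lambda>x. complex_of_real (\<eta> x))" using \<eta> by (simp add: cutoff_def)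
  note m\<eta> [measurable] = cutoff_measurable[OF \<eta>]
  have i2: "integrable lborel (\<lambda>x. \<Lambda> * bnd * (L + 1) * (indicator S x * (D x)\<^sup>2))"
    by (intro integrable_mult_right integrable_SD2)
  have m1: "test_grad (U j) (grad (U j)) \<in> borel_measurable borel" for j
    unfolding cut_test_grad_def[abs_def] by (intro borel_measurable_add borel_measurable_smult) measurable
  have m2: "test_grad u G \<in> borel_measurable borel"
    unfolding cut_test_grad_def[abs_def] by (intro borel_measurable_add borel_measurable_smult) measurable
  have z: "(LINT x|lborel. hdot (B x) (test_grad (U j) (grad (U j)) x)) = 0" for j
  proof -
    let ?w = "cut_tmap k a \<eta> (U j)"
    note w = grad_cut_tmap[OF k \<eta> U, of a j]
    have "(LINT x|lborel. hdot (B x) (grad (\<lambda>x. complex_of_real (\<eta> x) * ?w x) x)) = 0"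
      by (rule weak[OF k_smooth_mult[OF ks w(1)]]) (use \<eta> in \<open>simp add: cutoff_def\<close>)
    then show ?thesis unfolding grad_mult[OF ks w(1)] w(2) cut_test_grad_def .
  qed
  have l: "(\<lambda>j. LINT x|lborel. hdot (B x) (test_grad (U j) (grad (U j)) x)) \<longlonglongrightarrow> (LINT x|lborel. hdot (B x) (test_grad u G x))"
  proof (rule integral_dominated_convergence[OF _ _ i2])
    show "AE x in lborel. norm (hdot (B x) (test_grad (U j) (grad (U j)) x)) \<le> \<Lambda> * bnd * (L + 1) * (indicator S x * (D x)\<^sup>2)" for j
      using cut_U_dom B_dom by eventually_elim (intro test_grad_le, auto)
    show "AE x in lborel. (\<lambda>j. hdot (B x) (test_grad (U j) (grad (U j)) x)) \<longlonglongrightarrow> hdot (B x) (test_grad u G x)"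
      using cut_lim
    proof eventually_elim
      fix x assume *: "(\<lambda>j. cut_tmap k a \<eta> (U j) x) \<longlonglongrightarrow> cut_tmap k a \<eta> u x \<and>
        (\<lambda>j. cut_tdiff k a \<eta> (U j) (grad (U j)) x) \<longlonglongrightarrow> cut_tdiff k a \<eta> u G x"
      then have "(\<lambda>j. test_grad (U j) (grad (U j)) x) \<longlonglongrightarrow> test_grad u G x"
        unfolding cut_test_grad_def vector_scalar_mult_def
        by (intro tendsto_add tendsto_vec_lambda tendsto_mult tendsto_vec_nth tendsto_const) auto
      then show "(\<lambda>j. hdot (B x) (test_grad (U j) (grad (U j)) x)) \<longlonglongrightarrow> hdot (B x) (test_grad u G x)"
        unfolding hdot_def by (intro tendsto_intros)
    qed
  qed (use borel_measurable_hdot[OF B m1] borel_measurable_hdot[OF B m2] in auto)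
  then show "(LINT x|lborel. hdot (B x) (test_grad u G x)) = 0"
    unfolding z by (simp add: LIMSEQ_const_iff)
  show "integrable lborel (\<lambda>x. hdot (B x) (test_grad u G x))"
  proof (rule Bochner_Integration.integrable_bound[OF i2])
    show "(\<lambda>x. hdot (B x) (test_grad u G x)) \<in> borel_measurable lborel"
      using borel_measurable_hdot[OF B m2] by simp
    show "AE x in lborel. norm (hdot (B x) (test_grad u G x)) \<le> norm (\<Lambda> * bnd * (L + 1) * (indicator S x * (D x)\<^sup>2))"
      using cut_dom B_dom by eventually_elim (unfold real_norm_def, rule order_trans[OF test_grad_le abs_ge_self], auto)
  qed
qed

end

end

section \<open>Caccioppoli inequality\<close>

lemma tpow_tendsto:
  assumes "0 < t"
  shows "(\<lambda>m. tpow (real (Suc m)) a (t\<^sup>2)) \<longlonglongrightarrow> t powr (2 * a)"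
proof -
  have "(\<lambda>m. (t\<^sup>2 + 1 / real (Suc m)) / (1 + t\<^sup>2 / real (Suc m))) \<longlonglongrightarrow> (t\<^sup>2 + 0) / (1 + 0)"
    by (intro tendsto_intros LIMSEQ_Suc[OF lim_const_over_n]) simp
  then have "(\<lambda>m. tpow (real (Suc m)) a (t\<^sup>2)) \<longlonglongrightarrow> (t\<^sup>2) powr a"
    unfolding tpow_def tquot_def using assms by (intro tendsto_powr) auto
  also have "(t\<^sup>2) powr a = t powr (2 * a)"
    using assms by (simp add: powr_powr flip: powr_numeral)
  finally show ?thesis .
qed

lemma powr_double_half:
  assumes "0 < (t::real)"
  shows "t powr (2 * ((s - 2) / 2)) * t\<^sup>2 = t powr s"
proof -
  have e: "2 * ((s - 2) / 2) = s - 2" by simp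
  show ?thesis unfolding e using assms powr_add[of t "s - 2" 2] by simp
qed

lemma tpow_mult_tendsto:
  assumes "0 \<le> t"
  shows "(\<lambda>m. tpow (real (Suc m)) ((s - 2) / 2) (t\<^sup>2) * t\<^sup>2) \<longlonglongrightarrow> t powr s"
proof (cases "t = 0")
  case False
  then have t: "0 < t" using assms by simp
  have "(\<lambda>m. tpow (real (Suc m)) ((s - 2) / 2) (t\<^sup>2) * t\<^sup>2) \<longlonglongrightarrow> t powr (2 * ((s - 2) / 2)) * t\<^sup>2"
    by (intro tendsto_mult tpow_tendsto t tendsto_const)
  also have "t powr (2 * ((s - 2) / 2)) * t\<^sup>2 = t powr s"
    by (rule powr_double_half[OF t])
  finally show ?thesis .
qed simp

lemma powr_add_one_le:
  assumes "0 \<le> (x::real)" "0 \<le> b"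
  shows "(1 + x) powr b \<le> 2 powr b * (1 + x powr b)"
proof -
  have "(1 + x) powr b \<le> (2 * max 1 x) powr b" using assms by (intro powr_mono2) auto
  also have "\<dots> = 2 powr b * max 1 x powr b" using assms by (intro powr_mult)
  also have "\<dots> \<le> 2 powr b * (1 + x powr b)"
    by (intro mult_left_mono) (auto simp: max_def)
  finally show ?thesis .
qed

text \<open>A majorant free of \<open>k\<close>, needed to let \<open>k\<close> tend to infinity by
  dominated convergence. For \<open>s >= 2\<close> it follows from
  \<open>tquot k s <= s + 1 / k\<close>; for \<open>s < 2\<close> the exponent is negative and the
  lower bound \<open>t^2 / (1 + t^2) <= tquot k (t^2)\<close> is used.\<close>

lemma tpow_mult_le:
  assumes k: "1 \<le> k" and t: "0 \<le> t"
  shows "tpow k ((s - 2) / 2) (t\<^sup>2) * t\<^sup>2 \<le> 2 powr \<bar>(s - 2) / 2\<bar> * (t powr s + t\<^sup>2)"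
proof (cases "t = 0")
  case False
  then have t: "0 < t" using t by simp
  let ?a = "(s - 2) / 2"
  have t2: "t\<^sup>2 powr b = t powr (2 * b)" for b
    using t by (simp add: powr_powr flip: powr_numeral)
  have ts: "t powr (2 * ?a) * t\<^sup>2 = t powr s"
    by (rule powr_double_half[OF t])
  have q: "0 < tquot k (t\<^sup>2)" by (rule tquot_pos[OF k]) simp
  show ?thesis
  proof (cases "0 \<le> ?a")
    case True
    have "tquot k (t\<^sup>2) \<le> 1 + t\<^sup>2"
    proof -
      have "1 / k \<le> 1" using k by simp
      then show ?thesis using tquot_bounds(3)[OF k zero_le_power2, of t] by linarith
    qed
    then have "tpow k ?a (t\<^sup>2) \<le> (1 + t\<^sup>2) powr ?a"
      unfolding tpow_def using True q by (intro powr_mono2) auto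
    also have "\<dots> \<le> 2 powr ?a * (1 + t powr (2 * ?a))"
      using powr_add_one_le[of "t\<^sup>2" ?a] True unfolding t2 by simp
    finally have "tpow k ?a (t\<^sup>2) * t\<^sup>2 \<le> 2 powr ?a * (1 + t powr (2 * ?a)) * t\<^sup>2"
      by (rule mult_right_mono) simp
    also have "\<dots> = 2 powr \<bar>?a\<bar> * (t powr s + t\<^sup>2)"
      using True unfolding ts[symmetric] by (simp add: algebra_simps)
    finally show ?thesis .
  next
    case False
    let ?b = "- ?a"
    have b: "0 \<le> ?b" using False by simp
    have "1 / tquot k (t\<^sup>2) \<le> (1 + t\<^sup>2) / t\<^sup>2"
    proof -
      have "t\<^sup>2 / k \<le> t\<^sup>2" using k mult_left_mono[of 1 k "t\<^sup>2"] by (simp add: divide_le_eq)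
      then have "t\<^sup>2 / (1 + t\<^sup>2) \<le> tquot k (t\<^sup>2)"
        unfolding tquot_def using k by (intro frac_le add_pos_nonneg) auto
      then have "1 / tquot k (t\<^sup>2) \<le> 1 / (t\<^sup>2 / (1 + t\<^sup>2))"
        using t by (intro frac_le divide_pos_pos add_pos_pos) auto
      then show ?thesis by simp
    qed
    then have "(1 / tquot k (t\<^sup>2)) powr ?b \<le> ((1 + t\<^sup>2) / t\<^sup>2) powr ?b"
      using b q by (intro powr_mono2) auto
    also have "(1 / tquot k (t\<^sup>2)) powr ?b = tpow k ?a (t\<^sup>2)"
      using q unfolding tpow_def powr_minus by (simp add: powr_divide)
    also have "((1 + t\<^sup>2) / t\<^sup>2) powr ?b = (1 + t\<^sup>2) powr ?b * t powr (2 * ?a)"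
    proof -
      have "A / t powr (2 * - a) = A * t powr (2 * a)" for A a
        by (simp add: powr_minus divide_inverse)
      then show ?thesis unfolding powr_divide t2 by blast
    qed
    finally have "tpow k ?a (t\<^sup>2) * t\<^sup>2 \<le> (1 + t\<^sup>2) powr ?b * t powr (2 * ?a) * t\<^sup>2"
      by (rule mult_right_mono) simp
    also have "\<dots> = (1 + t\<^sup>2) powr ?b * t powr s" unfolding ts[symmetric] by simp
    also have "\<dots> \<le> 2 powr ?b * (1 + t powr (2 * ?b)) * t powr s"
      using powr_add_one_le[of "t\<^sup>2" ?b] b unfolding t2 by (intro mult_right_mono) auto
    also have "\<dots> = 2 powr \<bar>?a\<bar> * (t powr s + t\<^sup>2)"
    proof -
      have e: "2 * ?b + s = 2" by (simp add: field_simps)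
      have f2: "t powr (2 * ?b) * t powr s = t\<^sup>2"
        unfolding powr_add[symmetric] e using t by simp
      have f1: "\<bar>?a\<bar> = ?b" by (rule abs_of_nonpos) (use b in linarith)
      show ?thesis unfolding f1 mult.assoc distrib_right mult_1_left f2 ..
    qed
    finally show ?thesis .
  qed
qed (simp add: tpow_def)

context approximable_solution
begin

abbreviation "Fk k x \<equiv> tpow k ((s - 2) / 2) ((norm (u x))\<^sup>2)"

lemma Fk_bounds: "1 \<le> k \<Longrightarrow> 0 \<le> Fk k x" "1 \<le> k \<Longrightarrow> Fk k x \<le> k powr \<bar>(s - 2) / 2\<bar>"
  using tpow_pos[of k "(norm (u x))\<^sup>2" "(s - 2) / 2"] tpow_le[of k "(norm (u x))\<^sup>2" "(s - 2) / 2"]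
  by (simp_all only: zero_le_power2 less_imp_le)

lemma caccioppoli_integrable:
  assumes k: "1 \<le> k" and \<eta>: "cutoff S L \<eta>"
  shows "integrable lborel (\<lambda>x. (\<eta> x)\<^sup>2 * Fk k x * (norm (G x))\<^sup>2)"
    and "integrable lborel (\<lambda>x. (norm (grad (\<lambda>x. complex_of_real (\<eta> x)) x))\<^sup>2 * (Fk k x * (norm (u x))\<^sup>2))"
    and "integrable lborel (\<lambda>x. indicator S x * (Fk k x * (norm (u x))\<^sup>2))"
proof -
  note [measurable] = cutoff_measurable[OF \<eta>] borel_measurable_tpow[OF k u]
  let ?P = "k powr \<bar>(s - 2) / 2\<bar>"
  have \<eta>x: "0 \<le> \<eta> x" "\<eta> x \<le> 1" "norm (grad (\<lambda>x. complex_of_real (\<eta> x)) x) \<le> L" "0 \<le> L" for x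
    using \<eta> by (auto simp: cutoff_def)
  have i: "integrable lborel (\<lambda>x. C * ?P * (indicator S x * (D x)\<^sup>2))" for C
    by (intro integrable_mult_right integrable_SD2)
  show "integrable lborel (\<lambda>x. (\<eta> x)\<^sup>2 * Fk k x * (norm (G x))\<^sup>2)"
  proof (rule Bochner_Integration.integrable_bound[OF i[of 1]])
    show "AE x in lborel. norm ((\<eta> x)\<^sup>2 * Fk k x * (norm (G x))\<^sup>2) \<le> norm (1 * ?P * (indicator S x * (D x)\<^sup>2))"
      using solution_dom
    proof eventually_elim
      fix x assume d: "x \<in> S \<longrightarrow> norm (u x) \<le> D x \<and> norm (G x) \<le> D x"
      show "norm ((\<eta> x)\<^sup>2 * Fk k x * (norm (G x))\<^sup>2) \<le> norm (1 * ?P * (indicator S x * (D x)\<^sup>2))"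
      proof (cases "x \<in> S")
        case True
        have "(\<eta> x)\<^sup>2 \<le> 1" using \<eta>x by (simp add: power_le_one)
        then have "(\<eta> x)\<^sup>2 * Fk k x * (norm (G x))\<^sup>2 \<le> 1 * ?P * (D x)\<^sup>2"
          using d True Fk_bounds[OF k] by (intro mult_mono power_mono) auto
        then show ?thesis using True Fk_bounds[OF k] by (simp add: abs_mult)
      qed (use \<eta> in \<open>simp add: cutoff_def\<close>)
    qed
  qed measurable
  show "integrable lborel (\<lambda>x. (norm (grad (\<lambda>x. complex_of_real (\<eta> x)) x))\<^sup>2 * (Fk k x * (norm (u x))\<^sup>2))"
  proof (rule Bochner_Integration.integrable_bound[OF i[of "L\<^sup>2"]])
    show "AE x in lborel. norm ((norm (grad (\<lambda>x. complex_of_real (\<eta> x)) x))\<^sup>2 * (Fk k x * (norm (u x))\<^sup>2))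
        \<le> norm (L\<^sup>2 * ?P * (indicator S x * (D x)\<^sup>2))"
      using solution_dom
    proof eventually_elim
      fix x assume d: "x \<in> S \<longrightarrow> norm (u x) \<le> D x \<and> norm (G x) \<le> D x"
      show "norm ((norm (grad (\<lambda>x. complex_of_real (\<eta> x)) x))\<^sup>2 * (Fk k x * (norm (u x))\<^sup>2))
          \<le> norm (L\<^sup>2 * ?P * (indicator S x * (D x)\<^sup>2))"
      proof (cases "x \<in> S")
        case True
        have "(norm (grad (\<lambda>x. complex_of_real (\<eta> x)) x))\<^sup>2 * (Fk k x * (norm (u x))\<^sup>2) \<le> L\<^sup>2 * (?P * (D x)\<^sup>2)"
          using d True Fk_bounds[OF k] \<eta>x by (intro mult_mono power_mono) auto
        then show ?thesis using True Fk_bounds[OF k] by (simp add: abs_mult)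
      qed (simp add: cutoff_grad_outside[OF \<eta> closed_S])
    qed
  qed measurable
  show "integrable lborel (\<lambda>x. indicator S x * (Fk k x * (norm (u x))\<^sup>2))"
  proof (rule Bochner_Integration.integrable_bound[OF i[of 1]])
    show "AE x in lborel. norm (indicator S x * (Fk k x * (norm (u x))\<^sup>2)) \<le> norm (1 * ?P * (indicator S x * (D x)\<^sup>2))"
      using solution_dom
    proof eventually_elim
      fix x assume d: "x \<in> S \<longrightarrow> norm (u x) \<le> D x \<and> norm (G x) \<le> D x"
      show "norm (indicator S x * (Fk k x * (norm (u x))\<^sup>2)) \<le> norm (1 * ?P * (indicator S x * (D x)\<^sup>2))"
      proof (cases "x \<in> S")
        case True
        have "Fk k x * (norm (u x))\<^sup>2 \<le> ?P * (D x)\<^sup>2"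
          using d True Fk_bounds[OF k] by (intro mult_mono power_mono) auto
        then show ?thesis using True Fk_bounds[OF k] by (simp add: abs_mult)
      qed simp
    qed
  qed measurable
qed

text \<open>The constant is free of \<open>k\<close> because the cross term carries the same factor
  \<open>Fk\<close> as the two square terms: \<open>tmap\<close> has norm
  \<open>Fk * norm u\<close>. Half of the elliptic term absorbs it.\<close>

lemma caccioppoli_truncated:
  assumes k: "1 \<le> k" and \<eta>: "cutoff S L \<eta>"
  shows "(LINT x|lborel. (\<eta> x)\<^sup>2 * Fk k x * (norm (G x))\<^sup>2) \<le>
    4 * \<Lambda>\<^sup>2 / c\<^sup>2 * (LINT x|lborel. (norm (grad (\<lambda>x. complex_of_real (\<eta> x)) x))\<^sup>2 * (Fk k x * (norm (u x))\<^sup>2))"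
proof -
  let ?a = "(s - 2) / 2" and ?g = "grad (\<lambda>x. complex_of_real (\<eta> x))"
  note i = caccioppoli_integrable[OF k \<eta>]
  let ?I1 = "\<lambda>x. (\<eta> x)\<^sup>2 * Fk k x * (norm (G x))\<^sup>2" and ?I2 = "\<lambda>x. (norm (?g x))\<^sup>2 * (Fk k x * (norm (u x))\<^sup>2)"
  let ?t = "\<lambda>x. hdot (B x) (cut_test_grad k ?a \<eta> u G x)"
  have it: "integrable lborel ?t" and zt: "integral\<^sup>L lborel ?t = 0"
    using test_grad_integrable[OF k \<eta>] test_grad_integral[OF k \<eta>] by auto
  have "AE x in lborel. c / 2 * ?I1 x \<le> Re (?t x) + 2 * \<Lambda>\<^sup>2 / c * ?I2 x"
    using ell bdd
  proof eventually_elim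
    fix x
    assume e: "x \<in> S \<longrightarrow> (\<exists>M. B x = M *v G x \<and> (\<forall>\<xi>. c * (norm \<xi>)\<^sup>2 \<le> Re (hdot (M *v \<xi>) \<xi>)) \<and>
        (\<forall>\<xi>. c * (norm \<xi>)\<^sup>2 \<le> Re (hdot (M *v \<xi>) (J_form s \<xi>))))"
      and b: "x \<in> S \<longrightarrow> norm (B x) \<le> \<Lambda> * norm (G x)"
    show "c / 2 * ?I1 x \<le> Re (?t x) + 2 * \<Lambda>\<^sup>2 / c * ?I2 x"
    proof (cases "x \<in> S")
      case False
      then have "?t x = 0"
        using \<eta> by (simp add: cut_test_grad_def cut_tmap_def cutoff_grad_outside[OF \<eta> closed_S] cutoff_def hdot_def)
      moreover have "\<eta> x = 0" using \<eta> False by (simp add: cutoff_def)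
      ultimately show ?thesis by (simp add: cutoff_grad_outside[OF \<eta> closed_S False])
    next
      case True
      have \<eta>x: "0 \<le> \<eta> x" using \<eta> by (simp add: cutoff_def)
      obtain M where M: "B x = M *v G x" "\<And>\<xi>. c * (norm \<xi>)\<^sup>2 \<le> Re (hdot (M *v \<xi>) \<xi>)"
        "\<And>\<xi>. c * (norm \<xi>)\<^sup>2 \<le> Re (hdot (M *v \<xi>) (J_form s \<xi>))"
        using e True by blast
      have el: "c * Fk k x * (norm (G x))\<^sup>2 \<le> Re (hdot (B x) (tdiff k ?a (u x) (G x)))"
        unfolding M(1) by (rule tdiff_elliptic[OF k M(2,3)])
      \<comment> \<open>The factor 2 appears because the cutoff enters the test function
        squared.\<close>
      have tg: "cut_test_grad k ?a \<eta> u G x = 2 *\<^sub>R ((complex_of_real (\<eta> x) * tmap k ?a (u x)) *s ?g x)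
          + (\<eta> x)\<^sup>2 *\<^sub>R tdiff k ?a (u x) (G x)"
        unfolding cut_test_grad_def cut_tmap_def cut_tdiff_def vec_eq_iff vector_add_component
          vector_smult_component vector_scaleR_component scaleR_conv_of_real[where 'a = complex]
        by (simp add: power2_eq_square algebra_simps)
      define w where "w = hdot (B x) ((complex_of_real (\<eta> x) * tmap k ?a (u x)) *s ?g x)"
      have "norm w \<le> norm (B x) * norm ((complex_of_real (\<eta> x) * tmap k ?a (u x)) *s ?g x)"
        unfolding w_def by (rule norm_hdot_le)
      also have "\<dots> = norm (B x) * (\<eta> x * (Fk k x * norm (u x)) * norm (?g x))"
        using \<eta>x by (simp add: norm_smult norm_mult norm_tmap[OF k])
      also have "\<dots> \<le> (\<Lambda> * norm (G x)) * (\<eta> x * (Fk k x * norm (u x)) * norm (?g x))"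
        using b True \<eta>x Fk_bounds(1)[OF k, of x] by (intro mult_right_mono) auto
      also have "\<dots> = \<Lambda> * Fk k x * ((\<eta> x * norm (G x)) * (norm (?g x) * norm (u x)))"
        by (simp add: algebra_simps)
      finally have w: "norm w \<le> \<Lambda> * Fk k x * ((\<eta> x * norm (G x)) * (norm (?g x) * norm (u x)))" .
      let ?p = "\<eta> x * norm (G x)" and ?r = "norm (?g x) * norm (u x)"
      \<comment> \<open>Young's inequality as a completed square, balanced so that exactly half of
        \<open>c * ?I1\<close> is used up. This leaves \<open>c / 2\<close> on the left against
        \<open>2 * \<Lambda>^2 / c\<close>, hence the constant
        \<open>4 * \<Lambda>^2 / c^2\<close>.\<close>
      have "0 \<le> (c * ?p - 2 * \<Lambda> * ?r)\<^sup>2 / (2 * c)" using c by simp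
      also have "\<dots> = c / 2 * ?p\<^sup>2 + 2 * \<Lambda>\<^sup>2 / c * ?r\<^sup>2 - 2 * (\<Lambda> * (?p * ?r))"
        using c by (simp add: power2_eq_square field_simps)
      finally have "2 * (\<Lambda> * (?p * ?r)) \<le> c / 2 * ?p\<^sup>2 + 2 * \<Lambda>\<^sup>2 / c * ?r\<^sup>2" by simp
      from mult_left_mono[OF this Fk_bounds(1)[OF k, of x]]
      have am: "2 * (\<Lambda> * Fk k x * (?p * ?r)) \<le> c / 2 * ?I1 x + 2 * \<Lambda>\<^sup>2 / c * ?I2 x"
        by (simp add: power_mult_distrib algebra_simps)
      have "Re (?t x) = 2 * Re w + (\<eta> x)\<^sup>2 * Re (hdot (B x) (tdiff k ?a (u x) (G x)))"
        unfolding tg hdot_add_right hdot_scaleR_right w_def by simp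
      moreover have "(\<eta> x)\<^sup>2 * (c * Fk k x * (norm (G x))\<^sup>2) \<le> (\<eta> x)\<^sup>2 * Re (hdot (B x) (tdiff k ?a (u x) (G x)))"
        by (rule mult_left_mono[OF el]) simp
      moreover have "- norm w \<le> Re w" using abs_Re_le_cmod[of w] by linarith
      moreover have "(\<eta> x)\<^sup>2 * (c * Fk k x * (norm (G x))\<^sup>2) = c * ?I1 x" by simp
      ultimately show ?thesis using w am by (simp add: field_simps)
    qed
  qed
  then have "(LINT x|lborel. c / 2 * ?I1 x) \<le> (LINT x|lborel. Re (?t x) + 2 * \<Lambda>\<^sup>2 / c * ?I2 x)"
    by (intro integral_mono_AE Bochner_Integration.integrable_add integrable_mult_right integrable_Re it i)
  also have "\<dots> = Re (integral\<^sup>L lborel ?t) + 2 * \<Lambda>\<^sup>2 / c * integral\<^sup>L lborel ?I2"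
    using it i by (subst Bochner_Integration.integral_add) (auto intro: integrable_Re)
  finally have "c / 2 * integral\<^sup>L lborel ?I1 \<le> 2 * \<Lambda>\<^sup>2 / c * integral\<^sup>L lborel ?I2" by (simp add: zt)
  then show ?thesis using c by (simp add: field_simps power2_eq_square)
qed

text \<open>The limit in \<open>k\<close> uses Fatou on the left, where no majorant is known, and
  dominated convergence on the right, where \<open>tpow_mult_le\<close> supplies one as soon as the
  right-hand side is finite.\<close>

lemma energy_estimate:
  assumes \<eta>: "cutoff S L \<eta>" and L: "0 < L" and E [measurable]: "E \<in> sets borel" and E1: "\<And>x. x \<in> E \<Longrightarrow> \<eta> x = 1"
  shows "(\<integral>\<^sup>+x. ennreal (if u x = 0 then 0 else (norm (G x))\<^sup>2 * norm (u x) powr (s - 2)) * indicator E x \<partial>lborel)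
    \<le> ennreal (4 * \<Lambda>\<^sup>2 / c\<^sup>2 * L\<^sup>2) * (\<integral>\<^sup>+x. ennreal (norm (u x) powr s) * indicator S x \<partial>lborel)"
    (is "?lhs \<le> ennreal ?C * ?R")
proof (cases "?R = \<infinity>")
  case True
  \<comment> \<open>Strict positivity matters, since \<open>0 * \<infinity> = 0\<close> in
    \<open>ennreal\<close>.\<close>
  have "0 < ?C" using L c \<Lambda> by (intro mult_pos_pos divide_pos_pos) auto
  then have "ennreal ?C * ?R = \<infinity>"
    unfolding True by (simp only: infinity_ennreal_def ennreal_mult_eq_top_iff ennreal_eq_0_iff not_le) simp
  then show ?thesis by (simp only: infinity_ennreal_def top_greatest)
next
  case False
  have C: "0 \<le> ?C" by simp
  note [measurable] = cutoff_measurable[OF \<eta>]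
  let ?k = "\<lambda>m. real (Suc m)"
  let ?f = "\<lambda>m x. ennreal (Fk (?k m) x * (norm (G x))\<^sup>2) * indicator E x"
  have k: "1 \<le> ?k m" for m by simp
  have mF [measurable]: "(\<lambda>x. Fk (?k m) x) \<in> borel_measurable borel" for m
    by (rule borel_measurable_tpow[OF k u])
  have iu: "integrable lborel (\<lambda>x. indicator S x * norm (u x) powr s)"
  proof (rule integrableI_nonneg)
    show "(\<integral>\<^sup>+x. ennreal (indicator S x * norm (u x) powr s) \<partial>lborel) < \<infinity>"
    proof -
      have "(\<integral>\<^sup>+x. ennreal (indicator S x * norm (u x) powr s) \<partial>lborel) = ?R"
        by (intro nn_integral_cong) (simp split: split_indicator)
      then show ?thesis using False by (simp add: top.not_eq_extremum)
    qed
  qed auto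
  define h where "h m = (LINT x|lborel. indicator S x * (Fk (?k m) x * (norm (u x))\<^sup>2))" for m
  have hl: "h \<longlonglongrightarrow> (LINT x|lborel. indicator S x * norm (u x) powr s)"
    unfolding h_def
  proof (rule integral_dominated_convergence[where
        w = "\<lambda>x. 2 powr \<bar>(s - 2) / 2\<bar> * (indicator S x * norm (u x) powr s + indicator S x * (D x)\<^sup>2)"])
    show "integrable lborel (\<lambda>x. 2 powr \<bar>(s - 2) / 2\<bar> * (indicator S x * norm (u x) powr s + indicator S x * (D x)\<^sup>2))"
      by (intro integrable_mult_right Bochner_Integration.integrable_add iu integrable_SD2)
    show "AE x in lborel. (\<lambda>m. indicator S x * (Fk (?k m) x * (norm (u x))\<^sup>2)) \<longlonglongrightarrow> indicator S x * norm (u x) powr s"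
      by (intro AE_I2 tendsto_mult tendsto_const tpow_mult_tendsto) simp
    show "AE x in lborel. norm (indicator S x * (Fk (?k m) x * (norm (u x))\<^sup>2))
        \<le> 2 powr \<bar>(s - 2) / 2\<bar> * (indicator S x * norm (u x) powr s + indicator S x * (D x)\<^sup>2)" for m
      using solution_dom
    proof eventually_elim
      fix x assume d: "x \<in> S \<longrightarrow> norm (u x) \<le> D x \<and> norm (G x) \<le> D x"
      show "norm (indicator S x * (Fk (?k m) x * (norm (u x))\<^sup>2))
        \<le> 2 powr \<bar>(s - 2) / 2\<bar> * (indicator S x * norm (u x) powr s + indicator S x * (D x)\<^sup>2)"
      proof (cases "x \<in> S")
        case True
        have "Fk (?k m) x * (norm (u x))\<^sup>2 \<le> 2 powr \<bar>(s - 2) / 2\<bar> * (norm (u x) powr s + (norm (u x))\<^sup>2)"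
          by (rule tpow_mult_le[OF k norm_ge_zero])
        also have "\<dots> \<le> 2 powr \<bar>(s - 2) / 2\<bar> * (norm (u x) powr s + (D x)\<^sup>2)"
          using d True by (intro mult_left_mono add_left_mono power_mono) auto
        finally show ?thesis using True Fk_bounds(1)[OF k[of m], of x] by (simp add: abs_mult)
      qed simp
    qed
  qed measurable
  have fm: "(\<integral>\<^sup>+x. ?f m x \<partial>lborel) \<le> ennreal (?C * h m)" for m
  proof -
    note i = caccioppoli_integrable[OF k[of m] \<eta>]
    have "(\<integral>\<^sup>+x. ?f m x \<partial>lborel) \<le> (\<integral>\<^sup>+x. ennreal ((\<eta> x)\<^sup>2 * Fk (?k m) x * (norm (G x))\<^sup>2) \<partial>lborel)"
      by (intro nn_integral_mono) (auto simp: E1 split: split_indicator)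
    also have "\<dots> = ennreal (LINT x|lborel. (\<eta> x)\<^sup>2 * Fk (?k m) x * (norm (G x))\<^sup>2)"
      using Fk_bounds(1)[OF k[of m]] by (intro nn_integral_eq_integral i) auto
    also have "\<dots> \<le> ennreal (?C * h m)"
    proof (rule ennreal_leI)
      have "(LINT x|lborel. (norm (grad (\<lambda>x. complex_of_real (\<eta> x)) x))\<^sup>2 * (Fk (?k m) x * (norm (u x))\<^sup>2))
          \<le> (LINT x|lborel. L\<^sup>2 * (indicator S x * (Fk (?k m) x * (norm (u x))\<^sup>2)))"
      proof (rule integral_mono[OF i(2) integrable_mult_right[OF i(3)]])
        fix x
        show "(norm (grad (\<lambda>x. complex_of_real (\<eta> x)) x))\<^sup>2 * (Fk (?k m) x * (norm (u x))\<^sup>2)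
            \<le> L\<^sup>2 * (indicator S x * (Fk (?k m) x * (norm (u x))\<^sup>2))"
          using \<eta> Fk_bounds(1)[OF k[of m], of x] cutoff_grad_outside[OF \<eta> closed_S, of x]
          by (cases "x \<in> S") (auto simp: cutoff_def intro!: mult_right_mono power_mono)
      qed
      also have "\<dots> = L\<^sup>2 * h m" by (simp add: h_def)
      finally have "4 * \<Lambda>\<^sup>2 / c\<^sup>2 * (LINT x|lborel. (norm (grad (\<lambda>x. complex_of_real (\<eta> x)) x))\<^sup>2 * (Fk (?k m) x * (norm (u x))\<^sup>2))
          \<le> 4 * \<Lambda>\<^sup>2 / c\<^sup>2 * (L\<^sup>2 * h m)"
        by (intro mult_left_mono) auto
      with caccioppoli_truncated[OF k[of m] \<eta>]
      show "(LINT x|lborel. (\<eta> x)\<^sup>2 * Fk (?k m) x * (norm (G x))\<^sup>2) \<le> ?C * h m" by simp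
    qed
    finally show ?thesis .
  qed
  have "?lhs \<le> (\<integral>\<^sup>+x. liminf (\<lambda>m. ?f m x) \<partial>lborel)"
  proof (rule nn_integral_mono)
    fix x
    show "ennreal (if u x = 0 then 0 else (norm (G x))\<^sup>2 * norm (u x) powr (s - 2)) * indicator E x \<le> liminf (\<lambda>m. ?f m x)"
    proof (cases "u x = 0 \<or> x \<notin> E")
      case False
      have e: "2 * ((s - 2) / 2) = s - 2" by simp
      have "(\<lambda>m. Fk (?k m) x * (norm (G x))\<^sup>2) \<longlonglongrightarrow> norm (u x) powr (s - 2) * (norm (G x))\<^sup>2"
        using False by (intro tendsto_mult tpow_tendsto[of _ "(s - 2) / 2", unfolded e] tendsto_const) auto
      then have "(\<lambda>m. ?f m x) \<longlonglongrightarrow> ennreal (norm (u x) powr (s - 2) * (norm (G x))\<^sup>2)"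
        using False by (auto intro!: tendsto_ennrealI)
      from lim_imp_Liminf[OF _ this] show ?thesis using False by (simp add: mult.commute)
    qed auto
  qed
  also have "\<dots> \<le> liminf (\<lambda>m. \<integral>\<^sup>+x. ?f m x \<partial>lborel)"
    by (rule nn_integral_liminf) measurable
  also have "\<dots> \<le> liminf (\<lambda>m. ennreal (?C * h m))"
    by (intro Liminf_mono always_eventually allI fm)
  also have "\<dots> = ennreal (?C * (LINT x|lborel. indicator S x * norm (u x) powr s))"
    by (rule lim_imp_Liminf, simp) (rule tendsto_ennrealI, rule tendsto_mult[OF tendsto_const hl])
  also have "\<dots> = ennreal ?C * (\<integral>\<^sup>+x. ennreal (indicator S x * norm (u x) powr s) \<partial>lborel)"
    unfolding ennreal_mult'[OF C] by (subst nn_integral_eq_integral[OF iu]) auto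
  also have "(\<integral>\<^sup>+x. ennreal (indicator S x * norm (u x) powr s) \<partial>lborel) = ?R"
    by (intro nn_integral_cong) (simp split: split_indicator)
  finally show ?thesis .
qed

end

section \<open>Reverse Hoelder inequality on balls\<close>

text \<open>After \<open>J\<close> steps the remainder is \<open>\<theta> ^ J * h J\<close>; the
  uniform bound \<open>K\<close> sends it to 0 and then disappears from the conclusion. The
  collected error terms form a geometric series of ratio at most 1/2.\<close>

lemma hole_filling:
  fixes h :: "nat \<Rightarrow> real"
  assumes step: "\<And>j. h j \<le> \<theta> * h (Suc j) + A * \<beta> ^ j"
    and \<theta>: "0 < \<theta>" "\<theta> < 1" and \<beta>: "0 \<le> \<beta>" "\<theta> * \<beta> \<le> 1 / 2" and A: "0 \<le> A" and K: "\<And>j. h j \<le> K"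
  shows "h 0 \<le> 2 * A"
proof -
  have it: "h 0 \<le> \<theta> ^ J * h J + A * (\<Sum>j<J. (\<theta> * \<beta>) ^ j)" for J
  proof (induction J)
    case (Suc J)
    have "\<theta> ^ J * h J \<le> \<theta> ^ J * (\<theta> * h (Suc J) + A * \<beta> ^ J)"
      using \<theta> by (intro mult_left_mono step) auto
    with Suc show ?case by (simp add: algebra_simps power_mult_distrib)
  qed simp
  have sum: "(\<Sum>j<J. (\<theta> * \<beta>) ^ j) \<le> 2" for J
  proof -
    have "(\<Sum>j<J. (\<theta> * \<beta>) ^ j) \<le> (\<Sum>j<J. (1 / 2 :: real) ^ j)"
      using \<theta> \<beta> by (intro sum_mono power_mono) auto
    also have "\<dots> \<le> (\<Sum>j. (1 / 2 :: real) ^ j)"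
      by (rule sum_le_suminf) (auto intro: summable_geometric)
    also have "\<dots> = 2" by (simp add: suminf_geometric)
    finally show ?thesis .
  qed
  have "h 0 \<le> \<theta> ^ J * K + 2 * A" for J
  proof -
    have "\<theta> ^ J * h J \<le> \<theta> ^ J * K" using \<theta> by (intro mult_left_mono K) auto
    moreover have "A * (\<Sum>j<J. (\<theta> * \<beta>) ^ j) \<le> A * 2" using A by (intro mult_left_mono sum)
    ultimately show ?thesis using it[of J] by linarith
  qed
  moreover have "(\<lambda>J. \<theta> ^ J * K + 2 * A) \<longlonglongrightarrow> 0 * K + 2 * A"
    using \<theta> by (intro tendsto_intros LIMSEQ_power_zero) auto
  ultimately show ?thesis by (intro LIMSEQ_le_const[of _ "2 * A"]) auto
qed

lemma hole_step_algebra: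
  assumes "0 < (v::real)"
  shows "v * (T * (C * (8 / d)\<^sup>2 * H)) + 2 * (2 * (P * V) + 2 * (q * H))
    = v * ((64 * C * T / d\<^sup>2 + 4 * q / v) * H + 4 * P * V / v)"
proof -
  have "v * ((64 * C * T / d\<^sup>2 + 4 * q / v) * H + 4 * P * V / v)
      = v * (64 * C * T / d\<^sup>2 * H) + v * (4 * q / v) * H + v * (4 * P * V / v)"
    by (simp add: distrib_left distrib_right)
  also have "\<dots> = v * (64 * C * T / d\<^sup>2 * H) + 4 * q * H + 4 * P * V"
    using assms by simp
  finally show ?thesis by (simp add: power_divide)
qed

lemma square_add_le: "(x + y)\<^sup>2 \<le> 2 * x\<^sup>2 + 2 * (y::real)\<^sup>2"
  using zero_le_power2[of "x - y"] by (simp add: power2_eq_square algebra_simps)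

text \<open>The constant of \<open>cut_gradient_integral_le\<close>. The first summand accounts for
  the gradient of the cutoff; the second combines \<open>norm_tdiff_le\<close>, for half the
  exponent, with the Caccioppoli constant.\<close>

definition cut_const :: "real \<Rightarrow> real \<Rightarrow> real \<Rightarrow> real" where
  "cut_const c \<Lambda> s = 2 + 2 * (1 + \<bar>(s - 2) / 2\<bar>)\<^sup>2 * (4 * \<Lambda>\<^sup>2 / c\<^sup>2)"

lemma cut_const_pos: "0 < cut_const c \<Lambda> s"
  unfolding cut_const_def by (intro add_pos_nonneg) auto

text \<open>In \<open>rh_const\<close>, \<open>N\<close> is the power of the radius gap lost in one step of the iteration, \<open>\<theta>\<close> the
  contraction factor that compensates the factors \<open>2 powr N\<close>, and the square root the ratio of the Nash
  scale \<open>t\<close> to the radius gap. \<open>C\<close> is the constant \<open>cut_const\<close>.\<close>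

definition rh_const :: "nat \<Rightarrow> real \<Rightarrow> real \<Rightarrow> real \<Rightarrow> real" where
  "rh_const n s p C = (let N = real n * (1 + s / p); \<theta> = 1 / (2 * 2 powr N); \<omega> = unit_ball_vol (real n) in
     8 * 2 powr ((s - 2) / 2) * \<omega> * 2 ^ (2 * n) * (8 / (\<theta> * \<omega>)) powr (s / p) * (sqrt (\<theta> / (128 * C)) / 2) powr (- N))"

locale ball_solution = approximable_solution "cball X (2 * r)" u G B U D c \<Lambda> s
  for X :: "real^'n" and r and u :: "real^'n \<Rightarrow> complex" and G B :: "real^'n \<Rightarrow> complex^'n"
    and U :: "nat \<Rightarrow> real^'n \<Rightarrow> complex" and D :: "real^'n \<Rightarrow> real" and c \<Lambda> s :: real +
  assumes r: "0 < r" and s: "2 \<le> s"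
begin

abbreviation "Hk k \<rho> \<equiv> LINT x|lborel. indicator (cball X \<rho>) x * (Fk k x * (norm (u x))\<^sup>2)"

lemma Hk_integrable:
  assumes k: "1 \<le> k" and \<rho>: "\<rho> \<le> 2 * r"
  shows "integrable lborel (\<lambda>x. indicator (cball X \<rho>) x * (Fk k x * (norm (u x))\<^sup>2))"
proof -
  \<comment> \<open>The integrability statement used here does not mention the cutoff, so the zero
    function serves as witness.\<close>
  have "cutoff (cball X (2 * r)) 0 (\<lambda>_. 0)"
    by (simp add: cutoff_def grad_def vec_eq_iff zero_vec_def[symmetric])
  from caccioppoli_integrable(3)[OF k this]
  have "integrable lborel (\<lambda>x. indicator (cball X \<rho>) x *\<^sub>R (indicator (cball X (2 * r)) x * (Fk k x * (norm (u x))\<^sup>2)))"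
    by (rule integrable_mult_indicator[rotated]) simp
  also have "(\<lambda>x. indicator (cball X \<rho>) x *\<^sub>R (indicator (cball X (2 * r)) x * (Fk k x * (norm (u x))\<^sup>2)))
      = (\<lambda>x. indicator (cball X \<rho>) x * (Fk k x * (norm (u x))\<^sup>2))"
    using \<rho> by (auto simp: fun_eq_iff indicator_def)
  finally show ?thesis .
qed

lemma Hk_nonneg: "1 \<le> k \<Longrightarrow> 0 \<le> Hk k \<rho>"
  using Fk_bounds(1) by (intro Bochner_Integration.integral_nonneg) auto

abbreviation "C3 \<equiv> cut_const c \<Lambda> s"

text \<open>The Caccioppoli inequality belongs to the ball of radius \<open>2 * r\<close> on which
  the equation is tested, while the right-hand side must be localized to radius \<open>R\<close>;
  therefore the same function is taken as a cutoff for both balls.\<close>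

lemma cut_gradient_integral_le:
  assumes k: "1 \<le> k" and R: "R \<le> 2 * r" and \<eta>: "cutoff (cball X R) L \<eta>" "cutoff (cball X (2 * r)) L \<eta>"
  shows "(LINT x|lborel. (norm (cut_tdiff k ((s - 2) / 2 / 2) \<eta> u G x))\<^sup>2) \<le> C3 * L\<^sup>2 * Hk k R"
proof -
  let ?a = "(s - 2) / 2" and ?g = "grad (\<lambda>x. complex_of_real (\<eta> x))"
  note i = caccioppoli_integrable[OF k \<eta>(2)]
  let ?I1 = "\<lambda>x. (\<eta> x)\<^sup>2 * Fk k x * (norm (G x))\<^sup>2" and ?I2 = "\<lambda>x. (norm (?g x))\<^sup>2 * (Fk k x * (norm (u x))\<^sup>2)"
  have "(LINT x|lborel. (norm (cut_tdiff k (?a / 2) \<eta> u G x))\<^sup>2)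
      \<le> (LINT x|lborel. 2 * ?I2 x + 2 * (1 + \<bar>?a\<bar>)\<^sup>2 * ?I1 x)"
  proof (rule integral_mono[OF cut_integrable(2)[OF k \<eta>(2)]])
    show "integrable lborel (\<lambda>x. 2 * ?I2 x + 2 * (1 + \<bar>?a\<bar>)\<^sup>2 * ?I1 x)"
      by (intro Bochner_Integration.integrable_add integrable_mult_right i)
    fix x
    let ?T = "tpow k (?a / 2) ((norm (u x))\<^sup>2)"
    have T: "?T\<^sup>2 = Fk k x" by (rule tpow_half[OF k]) simp
    have T0: "0 \<le> ?T" using tpow_pos[OF k, of "(norm (u x))\<^sup>2"] by (simp add: less_imp_le)
    have "norm (tdiff k (?a / 2) (u x) (G x)) \<le> (1 + \<bar>?a\<bar>) * ?T * norm (G x)"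
      using norm_tdiff_le[OF k, of "?a / 2" "u x" "G x"] by simp
    then have "(norm (tdiff k (?a / 2) (u x) (G x)))\<^sup>2 \<le> ((1 + \<bar>?a\<bar>) * ?T * norm (G x))\<^sup>2"
      by (rule power_mono) simp
    then have 1: "(norm (tdiff k (?a / 2) (u x) (G x)))\<^sup>2 \<le> (1 + \<bar>?a\<bar>)\<^sup>2 * Fk k x * (norm (G x))\<^sup>2"
      unfolding power_mult_distrib T .
    have 2: "(norm (tmap k (?a / 2) (u x)))\<^sup>2 = Fk k x * (norm (u x))\<^sup>2"
      unfolding norm_tmap[OF k] power_mult_distrib T ..
    have "(norm (cut_tdiff k (?a / 2) \<eta> u G x))\<^sup>2
        \<le> 2 * (norm (tmap k (?a / 2) (u x) *s ?g x))\<^sup>2 + 2 * (norm (complex_of_real (\<eta> x) *s tdiff k (?a / 2) (u x) (G x)))\<^sup>2"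
      unfolding cut_tdiff_def by (rule norm_add_squared_le)
    also have "\<dots> = 2 * ?I2 x + 2 * ((\<eta> x)\<^sup>2 * (norm (tdiff k (?a / 2) (u x) (G x)))\<^sup>2)"
      unfolding norm_smult power_mult_distrib 2 by (simp add: mult.commute)
    also have "\<dots> \<le> 2 * ?I2 x + 2 * ((\<eta> x)\<^sup>2 * ((1 + \<bar>?a\<bar>)\<^sup>2 * Fk k x * (norm (G x))\<^sup>2))"
      by (intro add_left_mono mult_left_mono 1) auto
    finally show "(norm (cut_tdiff k (?a / 2) \<eta> u G x))\<^sup>2 \<le> 2 * ?I2 x + 2 * (1 + \<bar>?a\<bar>)\<^sup>2 * ?I1 x"
      by (simp only: ac_simps)
  qed
  also have "\<dots> = 2 * integral\<^sup>L lborel ?I2 + 2 * (1 + \<bar>?a\<bar>)\<^sup>2 * integral\<^sup>L lborel ?I1"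
    using i by (subst Bochner_Integration.integral_add) (simp_all only: integral_mult_right_zero integrable_mult_right)
  also have "\<dots> \<le> 2 * integral\<^sup>L lborel ?I2 + 2 * (1 + \<bar>?a\<bar>)\<^sup>2 * (4 * \<Lambda>\<^sup>2 / c\<^sup>2 * integral\<^sup>L lborel ?I2)"
    by (intro add_left_mono mult_left_mono caccioppoli_truncated[OF k \<eta>(2)]) simp
  also have "\<dots> = C3 * integral\<^sup>L lborel ?I2"
    unfolding cut_const_def distrib_right mult.assoc ..
  also have "integral\<^sup>L lborel ?I2 \<le> (LINT x|lborel. L\<^sup>2 * (indicator (cball X R) x * (Fk k x * (norm (u x))\<^sup>2)))"
  proof (rule integral_mono[OF i(2) integrable_mult_right[OF Hk_integrable[OF k R]]])
    fix x
    show "?I2 x \<le> L\<^sup>2 * (indicator (cball X R) x * (Fk k x * (norm (u x))\<^sup>2))"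
    proof (cases "x \<in> cball X R")
      case True
      have "(norm (?g x))\<^sup>2 \<le> L\<^sup>2" using \<eta>(1) by (intro power_mono) (auto simp: cutoff_def)
      then have "?I2 x \<le> L\<^sup>2 * (Fk k x * (norm (u x))\<^sup>2)"
        using Fk_bounds(1)[OF k, of x] by (intro mult_right_mono) auto
      then show ?thesis using True by simp
    qed (simp add: cutoff_grad_outside[OF \<eta>(1) closed_cball])
  qed
  also have "\<dots> = L\<^sup>2 * Hk k R" by simp
  finally show ?thesis using cut_const_pos[of c \<Lambda> s] by (simp add: mult.assoc)
qed

text \<open>Split at the level \<open>\<mu>\<close> of \<open>\<bar>u\<bar>\<close>. Above the level, Cauchy-Schwarz and Chebyshev give a factor
  \<open>M / \<mu> powr p\<close> that becomes small when \<open>\<mu>\<close> is chosen large.\<close>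

lemma cut_L1_le:
  assumes k: "1 \<le> k" and R: "R \<le> 2 * r" and \<eta>: "cutoff (cball X R) L \<eta>" "cutoff (cball X (2 * r)) L \<eta>"
    and \<mu>: "0 < \<mu>" "1 / k \<le> \<mu>\<^sup>2" and p: "0 < p" and M: "0 \<le> M"
    "(\<integral>\<^sup>+x. ennreal (norm (u x) powr p) * indicator (cball X (2 * r)) x \<partial>lborel) \<le> ennreal M"
  shows "(LINT x|lborel. norm (cut_tmap k ((s - 2) / 2 / 2) \<eta> u x))\<^sup>2 \<le>
    2 * (2 powr ((s - 2) / 2) * \<mu> powr s * (measure lborel (cball X (2 * r)))\<^sup>2) + 2 * (M / \<mu> powr p * Hk k R)"
proof -
  let ?a = "(s - 2) / 2" and ?S = "cball X (2 * r)"
  let ?W = "cut_tmap k (?a / 2) \<eta> u"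
  define g where "g x = tpow k (?a / 2) ((norm (u x))\<^sup>2) * norm (u x)" for x
  define E where "E = {x \<in> ?S. \<mu> < norm (u x)}"
  \<comment> \<open>Bounds the regularized half power where \<open>norm (u x) <= \<mu>\<close>:
    there \<open>tquot\<close> is at most \<open>\<mu>^2 + 1 / k\<close>, and the assumption on
    \<open>1 / k\<close> makes this at most \<open>2 * \<mu>^2\<close>.\<close>
  define \<gamma> where "\<gamma> = (2 * \<mu>\<^sup>2) powr (?a / 2) * \<mu>"
  define V where "V = measure lborel ?S"
  have [measurable]: "cball X R \<in> sets borel" "cball X (2 * r) \<in> sets borel" by simp_all
  have E [measurable]: "E \<in> sets borel"
    unfolding E_def by measurable
  have [measurable]: "g \<in> borel_measurable borel"
    unfolding g_def using borel_measurable_tpow[OF k u] by measurable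
  have V: "emeasure lborel ?S = ennreal V"
    unfolding V_def using emeasure_bounded_finite[of ?S] by (intro emeasure_eq_ennreal_measure) (simp add: top.not_eq_extremum)
  have V0: "0 \<le> V" by (simp add: V_def)
  have g0: "0 \<le> g x" for x
    unfolding g_def using tpow_pos[OF k, of "(norm (u x))\<^sup>2"] by (simp add: less_imp_le)
  have g2: "(g x)\<^sup>2 = Fk k x * (norm (u x))\<^sup>2" for x
    unfolding g_def power_mult_distrib by (simp only: tpow_half[OF k zero_le_power2])
  have \<gamma>0: "0 \<le> \<gamma>" using \<mu> by (simp add: \<gamma>_def)
  have \<gamma>2: "\<gamma>\<^sup>2 = 2 powr ?a * \<mu> powr s"
  proof -
    have "\<gamma>\<^sup>2 = (2 * \<mu>\<^sup>2) powr ?a * \<mu>\<^sup>2"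
      unfolding \<gamma>_def power_mult_distrib by (simp add: power2_eq_square flip: powr_add)
    also have "(2 * \<mu>\<^sup>2) powr ?a = 2 powr ?a * \<mu> powr (2 * ?a)"
    proof -
      have "\<mu>\<^sup>2 powr ?a = \<mu> powr (2 * ?a)"
        using \<mu>(1) powr_powr[of \<mu> 2 ?a] by simp
      then show ?thesis using \<mu>(1) by (simp only: powr_mult)
    qed
    finally show ?thesis using powr_double_half[OF \<mu>(1), of s] by (simp only: mult.assoc)
  qed
  have W: "norm (?W x) = \<eta> x * g x" for x
    using \<eta> by (simp add: cut_tmap_def norm_mult norm_tmap[OF k] g_def cutoff_def)
  have gle: "g x \<le> \<gamma>" if "norm (u x) \<le> \<mu>" for x
  proof -
    have "(norm (u x))\<^sup>2 \<le> \<mu>\<^sup>2" using that by (intro power_mono) auto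
    then have "tquot k ((norm (u x))\<^sup>2) \<le> 2 * \<mu>\<^sup>2"
      using tquot_bounds(3)[OF k zero_le_power2, of "norm (u x)"] \<mu>(2) by linarith
    then have "tpow k (?a / 2) ((norm (u x))\<^sup>2) \<le> (2 * \<mu>\<^sup>2) powr (?a / 2)"
      unfolding tpow_def using s tquot_pos[OF k zero_le_power2, of "norm (u x)"] by (intro powr_mono2) auto
    then show ?thesis unfolding g_def \<gamma>_def using that by (intro mult_mono) auto
  qed
  \<comment> \<open>The part above the level. It stays in \<open>ennreal\<close> until
    Cauchy-Schwarz has shown that it is finite.\<close>
  define K where "K = (\<integral>\<^sup>+x. indicator E x * ennreal (indicator (cball X R) x * g x) \<partial>lborel)"
  have "ennreal (\<mu> powr p) * emeasure lborel E = (\<integral>\<^sup>+x. ennreal (\<mu> powr p) * indicator E x \<partial>lborel)"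
    by (simp add: nn_integral_cmult_indicator)
  also have "\<dots> \<le> (\<integral>\<^sup>+x. ennreal (norm (u x) powr p) * indicator ?S x \<partial>lborel)"
    using p \<mu>(1) by (intro nn_integral_mono) (auto simp: E_def split: split_indicator intro!: ennreal_leI powr_mono2)
  also have "\<dots> \<le> ennreal M" by (rule M(2))
  finally have Em: "ennreal (\<mu> powr p) * emeasure lborel E \<le> ennreal M" .
  have "E \<subseteq> ?S" by (auto simp: E_def)
  then have Elt: "emeasure lborel E < \<infinity>"
    using emeasure_bounded_finite[of E] bounded_subset[OF bounded_cball] by blast
  define m where "m = measure lborel E"
  have m: "emeasure lborel E = ennreal m" "0 \<le> m"
    unfolding m_def using Elt by (auto intro!: emeasure_eq_ennreal_measure)
  have "\<mu> powr p * m \<le> M"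
    using Em M(1) m(2) unfolding m(1) by (simp flip: ennreal_mult)
  then have mM: "m \<le> M / \<mu> powr p" using \<mu>(1) by (simp add: field_simps)
  have "K\<^sup>2 \<le> (\<integral>\<^sup>+x. (indicator E x)\<^sup>2 \<partial>lborel) * (\<integral>\<^sup>+x. (ennreal (indicator (cball X R) x * g x))\<^sup>2 \<partial>lborel)"
    unfolding K_def by (rule Cauchy_Schwarz_nn_integral) auto
  also have "(\<integral>\<^sup>+x. (indicator E x)\<^sup>2 \<partial>lborel) = (\<integral>\<^sup>+x. indicator E x \<partial>lborel)"
    by (intro nn_integral_cong) (auto split: split_indicator)
  also have "\<dots> = ennreal m" using m(1) by simp
  also have "(\<integral>\<^sup>+x. (ennreal (indicator (cball X R) x * g x))\<^sup>2 \<partial>lborel)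
      = (\<integral>\<^sup>+x. ennreal (indicator (cball X R) x * (Fk k x * (norm (u x))\<^sup>2)) \<partial>lborel)"
    by (intro nn_integral_cong) (auto simp: g0 ennreal_power g2 split: split_indicator)
  also have "\<dots> = ennreal (Hk k R)"
    using Fk_bounds(1)[OF k] by (intro nn_integral_eq_integral Hk_integrable k R) auto
  also have "ennreal m * ennreal (Hk k R) = ennreal (m * Hk k R)"
    using m(2) by (rule ennreal_mult'[symmetric])
  finally have K2: "K\<^sup>2 \<le> ennreal (m * Hk k R)" .
  then have "K\<^sup>2 < \<infinity>" by (rule le_less_trans) simp
  then have "K < \<infinity>" by (simp add: power_less_top_ennreal)
  then obtain \<kappa> where \<kappa>: "K = ennreal \<kappa>" "0 \<le> \<kappa>" by (cases K) auto
  have \<kappa>2: "\<kappa>\<^sup>2 \<le> m * Hk k R"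
    using K2 \<kappa> Hk_nonneg[OF k, of R] m(2) by (simp add: ennreal_power)
  have "ennreal (LINT x|lborel. norm (?W x)) = (\<integral>\<^sup>+x. ennreal (norm (?W x)) \<partial>lborel)"
    by (intro nn_integral_eq_integral[symmetric] cut_integrable(3)[OF k \<eta>(2)]) simp
  also have "\<dots> \<le> (\<integral>\<^sup>+x. ennreal \<gamma> * indicator ?S x + indicator E x * ennreal (indicator (cball X R) x * g x) \<partial>lborel)"
  proof (rule nn_integral_mono)
    fix x
    show "ennreal (norm (?W x)) \<le> ennreal \<gamma> * indicator ?S x + indicator E x * ennreal (indicator (cball X R) x * g x)"
    proof (cases "x \<in> cball X R")
      case True
      then have xS: "x \<in> ?S" using R by auto
      have "\<eta> x * g x \<le> 1 * g x" using \<eta>(1) g0[of x] by (intro mult_right_mono) (auto simp: cutoff_def)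
      then have Wg: "norm (?W x) \<le> g x" unfolding W by simp
      show ?thesis
      proof (cases "norm (u x) \<le> \<mu>")
        case True
        then have "ennreal (norm (?W x)) \<le> ennreal \<gamma>" using Wg gle[of x] by (intro ennreal_leI) linarith
        also have "\<dots> \<le> ennreal \<gamma> * indicator ?S x + indicator E x * ennreal (indicator (cball X R) x * g x)"
          using xS by (simp add: add_increasing2)
        finally show ?thesis .
      next
        case False
        then have "x \<in> E" using xS by (simp add: E_def)
        have "ennreal (norm (?W x)) \<le> ennreal (g x)" using Wg by (rule ennreal_leI)
        also have "\<dots> \<le> ennreal \<gamma> * indicator ?S x + indicator E x * ennreal (indicator (cball X R) x * g x)"
          using True \<open>x \<in> E\<close> by (simp add: add_increasing)
        finally show ?thesis .
      qed
    next
      case False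
      then have "norm (?W x) = 0" using \<eta>(1) unfolding W by (simp add: cutoff_def)
      then show ?thesis by (simp only: ennreal_0 zero_le)
    qed
  qed
  also have "\<dots> = ennreal \<gamma> * ennreal V + K"
    unfolding K_def by (subst nn_integral_add) (auto simp: nn_integral_cmult_indicator V)
  also have "\<dots> = ennreal (\<gamma> * V + \<kappa>)"
    unfolding \<kappa>(1) using \<gamma>0 V0 \<kappa>(2) by (simp add: ennreal_mult ennreal_plus)
  finally have "(LINT x|lborel. norm (?W x)) \<le> \<gamma> * V + \<kappa>"
    by (subst (asm) ennreal_le_iff) (use \<gamma>0 V0 \<kappa>(2) in auto)
  moreover have "0 \<le> (LINT x|lborel. norm (?W x))" by (intro Bochner_Integration.integral_nonneg) simp
  ultimately have "(LINT x|lborel. norm (?W x))\<^sup>2 \<le> (\<gamma> * V + \<kappa>)\<^sup>2" by (intro power_mono)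
  also have "\<dots> \<le> 2 * (\<gamma> * V)\<^sup>2 + 2 * \<kappa>\<^sup>2" by (rule square_add_le)
  also have "\<dots> \<le> 2 * (\<gamma> * V)\<^sup>2 + 2 * (M / \<mu> powr p * Hk k R)"
    using \<kappa>2 mult_right_mono[OF mM Hk_nonneg[OF k, of R]] by simp
  finally show ?thesis unfolding power_mult_distrib \<gamma>2 V_def .
qed

text \<open>The Nash inequality at scale \<open>t\<close> for the cut half power, divided by the
  volume of a ball of radius \<open>t\<close>. In front of \<open>Hk k R\<close> stand the gradient
  term and the contribution of large values of \<open>u\<close>; the additive term comes from the
  small values.\<close>

lemma hole_step:
  assumes k: "1 \<le> k" and \<rho>: "0 \<le> \<rho>" "\<rho> < R" "R \<le> 2 * r" and t: "0 < t"
    and \<mu>: "0 < \<mu>" "1 / k \<le> \<mu>\<^sup>2" and p: "0 < p" and M: "0 \<le> M"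
    "(\<integral>\<^sup>+x. ennreal (norm (u x) powr p) * indicator (cball X (2 * r)) x \<partial>lborel) \<le> ennreal M"
  shows "Hk k \<rho> \<le> (64 * C3 * t\<^sup>2 / (R - \<rho>)\<^sup>2 + 4 * M / (\<mu> powr p * unit_ball_vol (real CARD('n)) * t ^ CARD('n))) * Hk k R
    + 4 * 2 powr ((s - 2) / 2) * \<mu> powr s * unit_ball_vol (real CARD('n)) * (2 * r) ^ (2 * CARD('n)) / t ^ CARD('n)"
proof -
  define \<omega> where "\<omega> = unit_ball_vol (real CARD('n))"
  let ?n = "CARD('n)"
  let ?a = "(s - 2) / 2"
  let ?L = "8 / (R - \<rho>)"
  obtain \<eta> :: "real^'n \<Rightarrow> real" where \<eta>: "k_smooth (Suc 0) (\<lambda>x. complex_of_real (\<eta> x))"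
    "\<And>x. 0 \<le> \<eta> x" "\<And>x. \<eta> x \<le> 1" "\<And>x. x \<in> cball X \<rho> \<Longrightarrow> \<eta> x = 1" "\<And>x. x \<notin> cball X R \<Longrightarrow> \<eta> x = 0"
    "\<And>x. norm (grad (\<lambda>x. complex_of_real (\<eta> x)) x) \<le> ?L"
    by (rule cutoff_exists[OF \<rho>(1,2), of X]) (rule that)
  have c1: "cutoff (cball X R) ?L \<eta>"
    using \<eta> \<rho>(2) by (simp add: cutoff_def)
  have c2: "cutoff (cball X (2 * r)) ?L \<eta>"
    using \<eta> \<rho>(2,3) by (simp add: cutoff_def)
  let ?W = "cut_tmap k (?a / 2) \<eta> u"
  have W: "(norm (?W x))\<^sup>2 = (\<eta> x)\<^sup>2 * (Fk k x * (norm (u x))\<^sup>2)" for x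
    unfolding cut_tmap_def norm_mult norm_tmap[OF k] power_mult_distrib tpow_half[OF k zero_le_power2] by simp
  have "Hk k \<rho> \<le> (LINT x|lborel. (norm (?W x))\<^sup>2)"
  proof (rule integral_mono[OF Hk_integrable[OF k] cut_integrable(1)[OF k c2]])
    show "\<rho> \<le> 2 * r" using \<rho> by simp
    fix x
    show "indicator (cball X \<rho>) x * (Fk k x * (norm (u x))\<^sup>2) \<le> (norm (?W x))\<^sup>2"
      unfolding W using \<eta>(4)[of x] Fk_bounds(1)[OF k, of x] by (auto split: split_indicator)
  qed
  define v where "v = \<omega> * t ^ ?n"
  have \<omega>: "0 < \<omega>" by (simp add: \<omega>_def)
  have v: "0 < v" using t \<omega> by (simp add: v_def)
  have vm: "measure lborel (ball (0::real^'n) t) = v" using t content_ball[of t "0::real^'n"] by (simp add: v_def \<omega>_def)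
  have Vm: "measure lborel (cball X (2 * r)) = \<omega> * (2 * r) ^ ?n" using r content_cball[of "2 * r" X] by (simp add: \<omega>_def)
  let ?I = "(LINT x|lborel. norm (?W x))\<^sup>2"
  have "v * Hk k \<rho> \<le> v * (LINT x|lborel. (norm (?W x))\<^sup>2)"
    using \<open>Hk k \<rho> \<le> (LINT x|lborel. (norm (?W x))\<^sup>2)\<close> v by simp
  also have "\<dots> \<le> v * (t\<^sup>2 * (LINT x|lborel. (norm (cut_tdiff k (?a / 2) \<eta> u G x))\<^sup>2)) + 2 * ?I"
    using cut_nash[OF k c2 t, of "?a / 2"] unfolding vm .
  also have "\<dots> \<le> v * (t\<^sup>2 * (C3 * ?L\<^sup>2 * Hk k R)) + 2 * (2 * (2 powr ?a * \<mu> powr s * (\<omega> * (2 * r) ^ ?n)\<^sup>2) + 2 * (M / \<mu> powr p * Hk k R))"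
    using cut_L1_le[OF k \<rho>(3) c1 c2 \<mu> p M, unfolded Vm] less_imp_le[OF v]
    by (intro add_mono mult_left_mono cut_gradient_integral_le[OF k \<rho>(3) c1 c2])
      (assumption | rule zero_le_power2 zero_le_numeral)+
  also have "\<dots> = v * ((64 * C3 * t\<^sup>2 / (R - \<rho>)\<^sup>2 + 4 * (M / \<mu> powr p) / v) * Hk k R
      + 4 * (2 powr ?a * \<mu> powr s) * (\<omega> * (2 * r) ^ ?n)\<^sup>2 / v)"
    by (rule hole_step_algebra[OF v])
  finally have "Hk k \<rho> \<le> (64 * C3 * t\<^sup>2 / (R - \<rho>)\<^sup>2 + 4 * (M / \<mu> powr p) / v) * Hk k R
      + 4 * (2 powr ?a * \<mu> powr s) * (\<omega> * (2 * r) ^ ?n)\<^sup>2 / v"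
    by (simp only: mult_le_cancel_left_pos[OF v])
  moreover have "4 * (M / \<mu> powr p) / v = 4 * M / (\<mu> powr p * \<omega> * t ^ ?n)"
    by (simp add: v_def mult.assoc)
  moreover have "4 * (2 powr ?a * \<mu> powr s) * (\<omega> * (2 * r) ^ ?n)\<^sup>2 / v
      = 4 * 2 powr ?a * \<mu> powr s * \<omega> * (2 * r) ^ (2 * ?n) / t ^ ?n"
  proof -
    have e: "(2 * r) ^ (2 * ?n) = ((2 * r) ^ ?n)\<^sup>2" by (rule power_even_eq)
    have "A * (\<omega> * w)\<^sup>2 / (\<omega> * T) = A * \<omega> * w\<^sup>2 / T" for A w T
      using \<omega> by (simp add: power2_eq_square)
    from this[of "4 * (2 powr ?a * \<mu> powr s)"] show ?thesis
      unfolding e v_def by (simp only: mult.assoc)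
  qed
  ultimately show ?thesis by (simp only: \<omega>_def)
qed

lemma Hk_mono:
  assumes "1 \<le> k" "\<rho> \<le> R" "R \<le> 2 * r"
  shows "Hk k \<rho> \<le> Hk k R"
proof (rule integral_mono[OF Hk_integrable Hk_integrable])
  fix x
  show "indicator (cball X \<rho>) x * (Fk k x * (norm (u x))\<^sup>2) \<le> indicator (cball X R) x * (Fk k x * (norm (u x))\<^sup>2)"
    using assms Fk_bounds(1)[OF assms(1), of x] by (intro mult_right_mono) (auto split: split_indicator)
qed (use assms in auto)

text \<open>The radii are \<open>2 r - r / 2\<^sup>j\<close>; the scale \<open>t j\<close> and the level \<open>\<mu> j\<close> are chosen so that each of the two
  coefficients in \<open>hole_step\<close> equals \<open>\<theta> / 2\<close>.\<close>

lemma truncated_bound: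
  assumes p: "0 < p" and M: "0 < M"
    "(\<integral>\<^sup>+x. ennreal (norm (u x) powr p) * indicator (cball X (2 * r)) x \<partial>lborel) \<le> ennreal M"
  obtains k0 where "1 \<le> k0"
    "\<And>k. k0 \<le> k \<Longrightarrow> Hk k r \<le> rh_const CARD('n) s p C3 * M powr (s / p) * r powr (real CARD('n) - real CARD('n) * s / p)"
proof -
  let ?n = "CARD('n)" and ?a = "(s - 2) / 2"
  define N where "N = real ?n * (1 + s / p)"
  define \<beta> where "\<beta> = 2 powr N"
  define \<theta> where "\<theta> = 1 / (2 * \<beta>)"
  define \<omega> where "\<omega> = unit_ball_vol (real ?n)"
  define \<tau> where "\<tau> = sqrt (\<theta> / (128 * C3))"
  define t where "t j = \<tau> * (r / 2) * (1 / 2) ^ j" for j :: nat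
  define \<mu> where "\<mu> j = (8 * M / (\<theta> * \<omega>) / t j ^ ?n) powr (1 / p)" for j
  define \<rho> where "\<rho> j = 2 * r - r * (1 / 2) ^ j" for j :: nat
  \<comment> \<open>The additive term of \<open>hole_step\<close> at \<open>j = 0\<close>. The level
    contributes the power \<open>- n * s / p\<close> of the scale and the volume of the Nash ball
    the power \<open>- n\<close>, together \<open>- N\<close>; halving the scale therefore costs a
    factor \<open>\<beta>\<close>.\<close>
  define A where "A = 4 * 2 powr ?a * \<omega> * (2 * r) ^ (2 * ?n) * (8 * M / (\<theta> * \<omega>)) powr (s / p) * (\<tau> * (r / 2)) powr (- N)"
  have N0: "0 \<le> N" using s p by (simp add: N_def)
  have \<beta>: "1 \<le> \<beta>" unfolding \<beta>_def using N0 by (intro ge_one_powr_ge_zero) auto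
  have \<theta>: "0 < \<theta>" "\<theta> < 1" "\<theta> * \<beta> \<le> 1 / 2" using \<beta> by (auto simp: \<theta>_def)
  have \<omega>: "0 < \<omega>" by (simp add: \<omega>_def)
  have \<tau>: "0 < \<tau>" "\<tau>\<^sup>2 = \<theta> / (128 * C3)" using \<theta> cut_const_pos[of c \<Lambda> s] by (auto simp: \<tau>_def)
  have t: "0 < t j" for j using \<tau>(1) r by (simp add: t_def)
  have t0: "t j \<le> t 0" for j
    using \<tau>(1) r by (simp add: t_def mult_left_le power_le_one)
  have E0: "0 < 8 * M / (\<theta> * \<omega>)" using M \<theta> \<omega> by simp
  have \<mu>: "0 < \<mu> j" for j using M(1) \<theta>(1) \<omega> t[of j] by (simp add: \<mu>_def)
  have \<mu>p: "\<mu> j powr p = 8 * M / (\<theta> * \<omega>) / t j ^ ?n" for j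
    using p M(1) \<theta>(1) \<omega> t[of j] by (simp add: \<mu>_def powr_powr)
  have \<mu>0: "\<mu> 0 \<le> \<mu> j" for j
  proof -
    have "8 * M / (\<theta> * \<omega>) / t 0 ^ ?n \<le> 8 * M / (\<theta> * \<omega>) / t j ^ ?n"
      using E0 t by (intro divide_left_mono power_mono t0 mult_pos_pos zero_less_power) (auto intro: less_imp_le)
    moreover have "0 \<le> 8 * M / (\<theta> * \<omega>) / t 0 ^ ?n" using M(1) \<theta>(1) \<omega> t[of 0] by simp
    ultimately show ?thesis unfolding \<mu>_def using p by (intro powr_mono2) auto
  qed
  have \<rho>d: "\<rho> (Suc j) - \<rho> j = r / 2 * (1 / 2) ^ j" for j by (simp add: \<rho>_def field_simps)
  have \<rho>: "0 \<le> \<rho> j" "\<rho> j < \<rho> (Suc j)" "\<rho> j \<le> 2 * r" for j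
  proof -
    have "(1 / 2 :: real) ^ j \<le> 1" by (simp add: power_le_one)
    from mult_left_mono[OF this, of r] show "0 \<le> \<rho> j" using r by (simp add: \<rho>_def)
    have "0 < r / 2 * (1 / 2) ^ j" using r by simp
    then show "\<rho> j < \<rho> (Suc j)" unfolding \<rho>d[symmetric] by simp
    show "\<rho> j \<le> 2 * r" using r by (simp add: \<rho>_def)
  qed
  have tN: "t j powr (- N) = (\<tau> * (r / 2)) powr (- N) * \<beta> ^ j" for j
  proof -
    have "((1 / 2 :: real) ^ j) powr (- N) = \<beta> ^ j"
    proof -
      have "((1 / 2 :: real) ^ j) = 2 powr (- real j)"
        by (simp add: powr_minus powr_realpow power_one_over inverse_eq_divide)
      then have "((1 / 2 :: real) ^ j) powr (- N) = 2 powr (N * real j)"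
        by (simp add: powr_powr mult.commute)
      also have "\<dots> = \<beta> powr real j" by (simp add: \<beta>_def powr_powr)
      also have "\<dots> = \<beta> ^ j" using \<beta> by (simp add: powr_realpow)
      finally show ?thesis .
    qed
    then show ?thesis unfolding t_def using \<tau>(1) r by (simp only: powr_mult)
  qed
  have rest: "4 * 2 powr ?a * \<mu> j powr s * \<omega> * (2 * r) ^ (2 * ?n) / t j ^ ?n = A * \<beta> ^ j" for j
  proof -
    have tn: "t j ^ ?n = t j powr real ?n" using t[of j] by (simp add: powr_realpow)
    have "\<mu> j powr s = (8 * M / (\<theta> * \<omega>) / t j powr real ?n) powr (s / p)"
      using p by (simp add: \<mu>_def powr_powr tn)
    also have "\<dots> = (8 * M / (\<theta> * \<omega>)) powr (s / p) / t j powr (real ?n * (s / p))"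
      unfolding powr_divide powr_powr ..
    finally have 1: "\<mu> j powr s = (8 * M / (\<theta> * \<omega>)) powr (s / p) / t j powr (real ?n * (s / p))" .
    have 2: "t j powr (real ?n * (s / p)) * t j powr real ?n = inverse (t j powr (- N))"
      unfolding powr_add[symmetric] powr_minus inverse_inverse_eq by (simp add: N_def algebra_simps)
    have "4 * 2 powr ?a * \<mu> j powr s * \<omega> * (2 * r) ^ (2 * ?n) / t j ^ ?n
        = 4 * 2 powr ?a * \<omega> * (2 * r) ^ (2 * ?n) * (8 * M / (\<theta> * \<omega>)) powr (s / p) * inverse (t j powr (real ?n * (s / p)) * t j powr real ?n)"
      unfolding 1 tn by (simp only: divide_inverse inverse_mult_distrib ac_simps)
    also have "\<dots> = A * \<beta> ^ j" unfolding 2 inverse_inverse_eq tN A_def by (simp only: mult.assoc)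
    finally show ?thesis .
  qed
  have A: "0 \<le> A" using \<omega> r by (simp add: A_def)
  have A2: "2 * A = rh_const ?n s p C3 * M powr (s / p) * r powr (real ?n - real ?n * s / p)"
  proof -
    have 1: "(2 * r) ^ (2 * ?n) = 2 ^ (2 * ?n) * r powr (2 * real ?n)"
      using r powr_realpow[of r "2 * ?n"] by (simp add: power_mult_distrib)
    have 2: "(8 * M / (\<theta> * \<omega>)) powr (s / p) = (8 / (\<theta> * \<omega>)) powr (s / p) * M powr (s / p)"
      by (simp flip: powr_mult)
    have 3: "(\<tau> * (r / 2)) powr (- N) = (\<tau> / 2) powr (- N) * r powr (- N)"
      by (simp flip: powr_mult)
    \<comment> \<open>The exponent \<open>2 * n\<close> comes from the squared volume of the large
      ball; after subtracting \<open>N\<close> the power is the one that scaling dictates.\<close>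
    have 4: "r powr (2 * real ?n) * r powr (- N) = r powr (real ?n - real ?n * s / p)"
      unfolding powr_add[symmetric] by (simp add: N_def algebra_simps)
    have "2 * A = 8 * 2 powr ?a * \<omega> * 2 ^ (2 * ?n) * (8 / (\<theta> * \<omega>)) powr (s / p) * (\<tau> / 2) powr (- N)
        * M powr (s / p) * (r powr (2 * real ?n) * r powr (- N))"
      unfolding A_def 1 2 3 by (simp only: ac_simps)
    then show ?thesis
      unfolding 4 rh_const_def Let_def N_def[symmetric] \<beta>_def[symmetric] \<theta>_def[symmetric] \<omega>_def[symmetric] \<tau>_def[symmetric] .
  qed
  show thesis
  \<comment> \<open>One \<open>k\<close> has to satisfy \<open>1 / k <= (\<mu> j)^2\<close> for all
    \<open>j\<close>. The levels are smallest at \<open>j = 0\<close>, because the scales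
    \<open>t j\<close> shrink, so that case decides.\<close>
  proof (rule that[of "max 1 (1 / (\<mu> 0)\<^sup>2)"])
    fix k assume k: "max 1 (1 / (\<mu> 0)\<^sup>2) \<le> k"
    then have k1: "1 \<le> k" by simp
    have km: "1 / k \<le> (\<mu> j)\<^sup>2" for j
    proof -
      have "1 / k \<le> (\<mu> 0)\<^sup>2" using k k1 \<mu>[of 0] by (simp add: field_simps)
      also have "\<dots> \<le> (\<mu> j)\<^sup>2" using \<mu>0[of j] \<mu>[of 0] by (intro power_mono) auto
      finally show ?thesis .
    qed
    have "Hk k (\<rho> 0) \<le> 2 * A"
    proof (rule hole_filling[of "\<lambda>j. Hk k (\<rho> j)", OF _ \<theta>(1,2) _ \<theta>(3) A])
      show "Hk k (\<rho> j) \<le> \<theta> * Hk k (\<rho> (Suc j)) + A * \<beta> ^ j" for j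
      proof -
        have "64 * C3 * (t j)\<^sup>2 / (\<rho> (Suc j) - \<rho> j)\<^sup>2 = 64 * C3 * \<tau>\<^sup>2"
          unfolding \<rho>d t_def using r by (simp add: power_mult_distrib power_divide)
        also have "\<dots> = \<theta> / 2" unfolding \<tau>(2) using cut_const_pos[of c \<Lambda> s] by simp
        finally have 1: "64 * C3 * (t j)\<^sup>2 / (\<rho> (Suc j) - \<rho> j)\<^sup>2 = \<theta> / 2" .
        have 2: "4 * M / (\<mu> j powr p * \<omega> * t j ^ ?n) = \<theta> / 2"
          unfolding \<mu>p using M \<theta> \<omega> t[of j] by simp
        have "Hk k (\<rho> j) \<le> (\<theta> / 2 + \<theta> / 2) * Hk k (\<rho> (Suc j)) + A * \<beta> ^ j"
          using hole_step[OF k1 \<rho>(1)[of j] \<rho>(2)[of j] \<rho>(3)[of "Suc j"] t[of j] \<mu>[of j] km[of j] p less_imp_le[OF M(1)] M(2)]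
          unfolding \<omega>_def[symmetric] 1 2 rest .
        then show ?thesis by simp
      qed
      \<comment> \<open>This bound depends on \<open>k\<close>, but only its being finite enters. It
        is the place where the regularization is indispensable.\<close>
      show "Hk k (\<rho> j) \<le> Hk k (2 * r)" for j by (rule Hk_mono[OF k1 \<rho>(3)]) simp
      show "0 \<le> \<beta>" using \<beta> by simp
    qed
    then show "Hk k r \<le> rh_const ?n s p C3 * M powr (s / p) * r powr (real ?n - real ?n * s / p)"
      unfolding A2 by (simp add: \<rho>_def)
  qed simp
qed

text \<open>The truncated bound is the same for all large \<open>k\<close>, so Fatou transfers it to
  the true power. Finiteness of the left-hand side is part of the result.\<close>

lemma reverse_holder_ball:
  assumes p: "0 < p" and M: "0 < M"
    "(\<integral>\<^sup>+x. ennreal (norm (u x) powr p) * indicator (cball X (2 * r)) x \<partial>lborel) \<le> ennreal M"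
  shows "(\<integral>\<^sup>+x. ennreal (norm (u x) powr s) * indicator (cball X r) x \<partial>lborel)
    \<le> ennreal (rh_const CARD('n) s p C3 * M powr (s / p) * r powr (real CARD('n) - real CARD('n) * s / p))"
    (is "_ \<le> ennreal ?C")
proof -
  obtain k0 where k0: "1 \<le> k0" "\<And>k. k0 \<le> k \<Longrightarrow> Hk k r \<le> ?C"
    by (rule truncated_bound[OF p M]) (rule that)
  let ?k = "\<lambda>m. real (Suc m)"
  let ?f = "\<lambda>m x. ennreal (indicator (cball X r) x * (Fk (?k m) x * (norm (u x))\<^sup>2))"
  have k: "1 \<le> ?k m" for m by simp
  have [measurable]: "(\<lambda>x. Fk (?k m) x) \<in> borel_measurable borel" for m
    by (rule borel_measurable_tpow[OF k u])
  have [measurable]: "cball X r \<in> sets borel" by simp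
  have "(\<integral>\<^sup>+x. ennreal (norm (u x) powr s) * indicator (cball X r) x \<partial>lborel) \<le> (\<integral>\<^sup>+x. liminf (\<lambda>m. ?f m x) \<partial>lborel)"
  proof (rule nn_integral_mono)
    fix x
    show "ennreal (norm (u x) powr s) * indicator (cball X r) x \<le> liminf (\<lambda>m. ?f m x)"
    proof (cases "x \<in> cball X r")
      case True
      have "(\<lambda>m. ?f m x) \<longlonglongrightarrow> ennreal (indicator (cball X r) x * norm (u x) powr s)"
        by (intro tendsto_ennrealI tendsto_mult tendsto_const tpow_mult_tendsto) simp
      from lim_imp_Liminf[OF _ this] show ?thesis using True by simp
    qed simp
  qed
  also have "\<dots> \<le> liminf (\<lambda>m. \<integral>\<^sup>+x. ?f m x \<partial>lborel)"
    by (rule nn_integral_liminf) measurable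
  also have "\<dots> \<le> ennreal ?C"
  proof (rule Liminf_le)
    obtain m0 where m0: "k0 \<le> real m0" using real_arch_simple by blast
    show "\<forall>\<^sub>F m in sequentially. (\<integral>\<^sup>+x. ?f m x \<partial>lborel) \<le> ennreal ?C"
      unfolding eventually_sequentially
    proof (intro exI allI impI)
      fix m assume "m0 \<le> m"
      then have km: "k0 \<le> ?k m" using m0 by linarith
      have "(\<integral>\<^sup>+x. ?f m x \<partial>lborel) = ennreal (Hk (?k m) r)"
        using Fk_bounds(1)[OF k[of m]] r by (intro nn_integral_eq_integral Hk_integrable k) auto
      also have "\<dots> \<le> ennreal ?C" by (intro ennreal_leI k0(2) km)
      finally show "(\<integral>\<^sup>+x. ?f m x \<partial>lborel) \<le> ennreal ?C" .
    qed
  qed simp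
  finally show ?thesis .
qed

end

section \<open>Reduction of the weighted problem\<close>

lemma rh_const_pos:
  assumes "0 < C"
  shows "0 < rh_const n s p C"
proof -
  have w: "0 < unit_ball_vol (real n)" by (rule unit_ball_vol_pos) simp
  then have w0: "unit_ball_vol (real n) \<noteq> 0" and C0: "C \<noteq> 0" using assms by linarith+
  show ?thesis
    unfolding rh_const_def Let_def by (intro mult_pos_pos w) (simp_all add: w0 C0)
qed

text \<open>\<open>rh_const\<close> rewritten for averages over the weighted measure. In each factor
  one \<open>\<kappa>\<close> comes from the weight in the integral and one from the weighted
  measure of the ball.\<close>

definition rh_factor :: "nat \<Rightarrow> real \<Rightarrow> real \<Rightarrow> real \<Rightarrow> real \<Rightarrow> real \<Rightarrow> real" where
  "rh_factor n \<kappa> c \<Lambda> s p = (\<kappa>\<^sup>2 * rh_const n s p (cut_const c \<Lambda> s) / unit_ball_vol (real n))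
    * (\<kappa>\<^sup>2 * unit_ball_vol (real n) * 2 ^ n) powr (s / p)"

lemma rh_factor_pos:
  assumes "0 < \<kappa>"
  shows "0 < rh_factor n \<kappa> c \<Lambda> s p"
proof -
  have w: "0 < unit_ball_vol (real n)" by (rule unit_ball_vol_pos) simp
  have k: "0 < \<kappa>\<^sup>2" using assms by simp
  have "0 < \<kappa>\<^sup>2 * unit_ball_vol (real n) * 2 ^ n" by (intro mult_pos_pos k w) simp
  then have "0 < (\<kappa>\<^sup>2 * unit_ball_vol (real n) * 2 ^ n) powr (s / p)"
    unfolding powr_gt_zero by linarith
  then show ?thesis
    unfolding rh_factor_def by (intro mult_pos_pos divide_pos_pos k w rh_const_pos cut_const_pos)
qed

text \<open>The real number \<open>t\<close> links the two averages, so that the algebra of powers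
  takes place among reals. An infinite right-hand average is harmless because the constant is
  positive.\<close>

lemma epowr_le:
  assumes C: "0 < C" and s: "0 < s" and p: "0 < p" and t: "0 \<le> t"
    and a: "a \<le> ennreal (C * t powr (s / p))" and b: "ennreal t \<le> b"
  shows "epowr a (1 / s) \<le> ennreal (C powr (1 / s)) * epowr b (1 / p)"
proof (cases "b = \<infinity>")
  case True
  have "ennreal (C powr (1 / s)) * epowr b (1 / p) = \<infinity>"
    using C True by (simp add: epowr_def ennreal_mult_eq_top_iff)
  then show ?thesis by simp
next
  case False
  have af: "a < \<infinity>" using a by (rule le_less_trans) simp
  then obtain a' where a': "a = ennreal a'" "0 \<le> a'" by (cases a) auto
  obtain b' where b': "b = ennreal b'" "0 \<le> b'" using False by (cases b) auto
  have 1: "a' \<le> C * t powr (s / p)" using a C unfolding a'(1) by (subst (asm) ennreal_le_iff) auto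
  have 2: "t \<le> b'" using b b'(2) unfolding b'(1) by (subst (asm) ennreal_le_iff) auto
  have "a' powr (1 / s) \<le> (C * t powr (s / p)) powr (1 / s)"
    using 1 a'(2) s by (intro powr_mono2) auto
  also have "\<dots> = C powr (1 / s) * t powr (1 / p)"
    using s C by (simp add: powr_mult powr_powr)
  also have "\<dots> \<le> C powr (1 / s) * b' powr (1 / p)"
    using 2 t p by (intro mult_left_mono powr_mono2) auto
  finally have "ennreal (a' powr (1 / s)) \<le> ennreal (C powr (1 / s) * b' powr (1 / p))" by (rule ennreal_leI)
  then show ?thesis
    using a' b' by (simp add: epowr_def ennreal_mult)
qed

lemma weak_grad_props:
  assumes "W12_loc \<Omega> u"
  shows "L2_loc \<Omega> u" "L2_loc \<Omega> (weak_grad \<Omega> u)" "is_weak_gradient \<Omega> u (weak_grad \<Omega> u)"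
proof -
  have "\<exists>G. L2_loc \<Omega> G \<and> is_weak_gradient \<Omega> u G" using assms by (simp add: W12_loc_def)
  from someI_ex[OF this] show "L2_loc \<Omega> (weak_grad \<Omega> u)" "is_weak_gradient \<Omega> u (weak_grad \<Omega> u)"
    unfolding weak_grad_def by auto
  show "L2_loc \<Omega> u" using assms by (simp add: W12_loc_def)
qed

lemma hdot_scaleR_left: "hdot (r *\<^sub>R x) y = r *\<^sub>R hdot x y"
  by (simp add: hdot_def scaleR_sum_right)

lemma hdot_self: "hdot x x = complex_of_real ((norm x)\<^sup>2)"
proof -
  have "(norm x)\<^sup>2 = (\<Sum>i\<in>UNIV. (norm (x $ i))\<^sup>2)"
    unfolding norm_vec_def L2_set_def by (simp add: sum_nonneg)
  then show ?thesis by (simp add: hdot_def complex_norm_square[symmetric])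
qed

lemma matrix_scaleR_mult: "(r *\<^sub>R M) *v x = r *\<^sub>R (M *v (x :: complex^'n))"
  by (simp add: matrix_vector_mult_def vec_eq_iff scaleR_sum_right)

lemma J_form_2: "J_form 2 \<xi> = \<xi>"
  by (simp add: J_form_def vec_eq_iff)

text \<open>Multiplication by i exchanges q-ellipticity and q'-ellipticity.\<close>

lemma J_map_rotate:
  assumes "1 < q"
  shows "J_map q (\<i> *s \<xi>) = (1 / q) *\<^sub>R (\<i> *s J_form q \<xi>)"
  using assms by (simp add: J_map_def J_form_def conj_exponent_def vec_eq_iff complex_eq_iff)

lemma J_form_elliptic:
  fixes M :: "complex^'n^'n"
  assumes q: "1 < q" and M: "\<And>\<xi>. lam * (norm \<xi>)\<^sup>2 \<le> Re (hdot (M *v \<xi>) (J_map q \<xi>))"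
  shows "q * lam * (norm \<xi>)\<^sup>2 \<le> Re (hdot (M *v \<xi>) (J_form q \<xi>))"
proof -
  have "M *v (\<i> *s \<xi>) = \<i> *s (M *v \<xi>)"
    by (simp add: matrix_vector_mult_def vec_eq_iff sum_distrib_left mult.left_commute)
  then have "hdot (M *v (\<i> *s \<xi>)) (J_map q (\<i> *s \<xi>)) = (1 / q) *\<^sub>R hdot (M *v \<xi>) (J_form q \<xi>)"
    unfolding J_map_rotate[OF q] hdot_scaleR_right by (simp only: hdot_smult) simp
  with M[of "\<i> *s \<xi>"] have "lam * (norm \<xi>)\<^sup>2 \<le> Re (hdot (M *v \<xi>) (J_form q \<xi>)) / q"
    by (simp add: norm_smult)
  then show ?thesis using q by (simp add: field_simps)
qed

text \<open>On \<open>cball X (5/2 r)\<close> the distance to \<open>\<Gamma>\<close> changes by a factor at most 6, and the exponent of the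
  weight lies between \<open>-n\<close> and 0; this explains \<open>\<kappa>\<close>. \<open>cc\<close> and \<open>LL\<close> are the lower and upper ellipticity
  constants of \<open>A\<close> divided by the weight at the center.\<close>

locale weighted_solution =
  fixes \<Gamma> :: "(real^'n) set" and d K q lam0 lam r \<kappa> cc LL :: real and A :: "real^'n \<Rightarrow> complex^'n^'n" and X :: "real^'n"
    and u :: "real^'n \<Rightarrow> complex"
  assumes d: "0 < d" "d < real CARD('n) - 1" and reg: "ahlfors_regular d \<Gamma>"
    and qe: "q_elliptic_with \<Gamma> d q K lam A" and lam0: "0 < lam0" "lam0 \<le> lam" and q: "1 < q"
    and r: "0 < r" and ball3: "ball X (3 * r) \<subseteq> - \<Gamma>" and sol: "weak_solution \<Gamma> d A u"
    and \<kappa>_def: "\<kappa> = 6 ^ CARD('n)" and cc_def: "cc = min (1 / (K * \<kappa>)) (q * lam0 / \<kappa>)" and LL_def: "LL = K * \<kappa>"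
begin

lemma \<Gamma>: "closed \<Gamma>" "\<Gamma> \<noteq> {}"
  using reg by (auto simp: ahlfors_regular_def)

lemma K: "0 < K" and A_meas: "A \<in> borel_measurable (lebesgue_on (- \<Gamma>))"
  and A_ell: "\<And>Y \<xi>. Y \<in> - \<Gamma> \<Longrightarrow> inverse K * weight \<Gamma> d Y * (norm \<xi>)\<^sup>2 \<le> Re (hdot (A Y *v \<xi>) \<xi>)"
  and A_bdd: "\<And>Y \<xi> \<zeta>. Y \<in> - \<Gamma> \<Longrightarrow> cmod (hdot (A Y *v \<xi>) \<zeta>) \<le> K * weight \<Gamma> d Y * norm \<xi> * norm \<zeta>"
  using qe by (auto simp: q_elliptic_with_def elliptic_with_def)

text \<open>Three nested balls inside the tripled one. Estimates take place on \<open>S\<close>; the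
  open ball \<open>T\<close> leaves room to mollify test functions supported in \<open>S\<close>; on
  the compact \<open>S'\<close> both \<open>u\<close> and its weak gradient are square integrable
  and the weight is comparable to its value at the center.\<close>

abbreviation "S \<equiv> cball X (2 * r)"
abbreviation "T \<equiv> ball X (5 / 2 * r)"
abbreviation "S' \<equiv> cball X (5 / 2 * r)"
abbreviation "G \<equiv> weak_grad (- \<Gamma>) u"

lemma sets_inclusion: "S \<subseteq> T" "T \<subseteq> S'" "S' \<subseteq> - \<Gamma>" "S \<subseteq> - \<Gamma>"
proof -
  show "S \<subseteq> T" "T \<subseteq> S'" using r by auto
  have "S' \<subseteq> ball X (3 * r)" using r by auto
  with ball3 show "S' \<subseteq> - \<Gamma>" by blast
  with \<open>S \<subseteq> T\<close> \<open>T \<subseteq> S'\<close> show "S \<subseteq> - \<Gamma>" by blast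
qed

lemma infdist_pos: "Y \<in> - \<Gamma> \<Longrightarrow> 0 < infdist Y \<Gamma>"
  using in_closed_iff_infdist_zero[OF \<Gamma>, of Y] infdist_nonneg[of Y \<Gamma>] by auto

lemma weight_pos: "Y \<in> - \<Gamma> \<Longrightarrow> 0 < weight \<Gamma> d Y"
  using infdist_pos[of Y] by (simp add: weight_def)

definition "\<omega>0 = weight \<Gamma> d X"

lemma \<kappa>: "0 < \<kappa>" by (simp add: \<kappa>_def)

lemma \<omega>0: "0 < \<omega>0"
proof -
  have "X \<in> ball X (3 * r)" using r by simp
  then have "X \<in> - \<Gamma>" using ball3 by blast
  then show ?thesis unfolding \<omega>0_def by (rule weight_pos)
qed

lemma weight_bounds:
  assumes Y: "Y \<in> S'"
  shows "weight \<Gamma> d Y \<le> \<kappa> * \<omega>0" "\<omega>0 / \<kappa> \<le> weight \<Gamma> d Y"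
proof -
  let ?e = "d + 1 - real CARD('n)"
  have "3 * r \<le> infdist X \<Gamma>"
    unfolding infdist_notempty[OF \<Gamma>(2)]
  proof (rule cINF_greatest[OF \<Gamma>(2)])
    fix y assume "y \<in> \<Gamma>"
    then have "y \<notin> ball X (3 * r)" using ball3 by blast
    then show "3 * r \<le> dist X y" by simp
  qed
  moreover have "dist X Y \<le> 5 / 2 * r" using Y by simp
  moreover have "infdist X \<Gamma> \<le> infdist Y \<Gamma> + dist X Y" "infdist Y \<Gamma> \<le> infdist X \<Gamma> + dist Y X"
    by (rule infdist_triangle)+
  \<comment> \<open>Since \<open>dist X Y <= 5 / 2 * r\<close> is at most 5/6 of
    \<open>infdist X \<Gamma>\<close>, the distance at \<open>Y\<close> lies between 1/6 and 11/6 of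
    the distance at \<open>X\<close>.\<close>
  ultimately have *: "infdist X \<Gamma> / 6 \<le> infdist Y \<Gamma>" "infdist Y \<Gamma> \<le> 3 * infdist X \<Gamma>"
    by (simp_all add: dist_commute)
  then have **: "infdist Y \<Gamma> \<le> 6 * infdist X \<Gamma>" using infdist_nonneg[of X \<Gamma>] by linarith
  have \<delta>: "0 < infdist X \<Gamma>" using \<open>3 * r \<le> infdist X \<Gamma>\<close> r by linarith
  have \<delta>Y: "0 < infdist Y \<Gamma>" using *(1) \<delta> by linarith
  have e: "- real CARD('n) \<le> ?e" "?e \<le> 0" using d by auto
  have 6: "6 powr (- ?e) \<le> \<kappa>"
  proof -
    have "6 powr (- ?e) \<le> 6 powr real CARD('n)" using e by (intro powr_mono) auto
    then show ?thesis by (simp add: \<kappa>_def powr_realpow)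
  qed
  have "weight \<Gamma> d Y \<le> (infdist X \<Gamma> / 6) powr ?e"
    unfolding weight_def using *(1) \<delta> e by (intro powr_mono2') auto
  also have "\<dots> = 6 powr (- ?e) * \<omega>0"
    unfolding \<omega>0_def weight_def powr_divide powr_minus by (simp add: divide_inverse mult.commute)
  also have "\<dots> \<le> \<kappa> * \<omega>0" using 6 \<omega>0 by (intro mult_right_mono) auto
  finally show "weight \<Gamma> d Y \<le> \<kappa> * \<omega>0" .
  have "\<omega>0 / \<kappa> \<le> \<omega>0 / 6 powr (- ?e)" using 6 \<omega>0 by (intro divide_left_mono mult_pos_pos \<kappa>) auto
  also have "\<dots> = (6 * infdist X \<Gamma>) powr ?e"
    unfolding \<omega>0_def weight_def powr_mult powr_minus by (simp add: divide_inverse mult.commute)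
  also have "\<dots> \<le> weight \<Gamma> d Y"
    unfolding weight_def using ** \<delta>Y e by (intro powr_mono2') auto
  finally show "\<omega>0 / \<kappa> \<le> weight \<Gamma> d Y" .
qed

lemma weight_measurable [measurable]: "weight \<Gamma> d \<in> borel_measurable borel"
proof -
  have [measurable]: "(\<lambda>Y. infdist Y \<Gamma>) \<in> borel_measurable borel"
    by (intro borel_measurable_continuous_onI continuous_intros)
  show ?thesis unfolding weight_def[abs_def] by measurable
qed

lemma wmeasure_integral:
  assumes f: "(\<lambda>Y. f Y * indicator E Y) \<in> borel_measurable lebesgue"
  shows "(\<integral>\<^sup>+Y\<in>E. f Y \<partial>wmeasure \<Gamma> d) = (\<integral>\<^sup>+Y. ennreal (weight \<Gamma> d Y) * (f Y * indicator E Y) \<partial>lebesgue)"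
  unfolding wmeasure_def
  by (rule nn_integral_density[OF measurable_completion f]) simp

lemma wmeasure_integral_le:
  assumes f: "(\<lambda>Y. f Y * indicator E Y) \<in> borel_measurable lebesgue" and E: "E \<subseteq> S'"
  shows "(\<integral>\<^sup>+Y\<in>E. f Y \<partial>wmeasure \<Gamma> d) \<le> ennreal (\<kappa> * \<omega>0) * (\<integral>\<^sup>+Y\<in>E. f Y \<partial>lebesgue)"
    and "ennreal (\<omega>0 / \<kappa>) * (\<integral>\<^sup>+Y\<in>E. f Y \<partial>lebesgue) \<le> (\<integral>\<^sup>+Y\<in>E. f Y \<partial>wmeasure \<Gamma> d)"
  unfolding wmeasure_integral[OF f] nn_integral_cmult[OF f, symmetric]
proof -
  have *: "Y \<in> E \<Longrightarrow> Y \<in> S'" for Y using E by blast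
  show "(\<integral>\<^sup>+Y. ennreal (weight \<Gamma> d Y) * (f Y * indicator E Y) \<partial>lebesgue) \<le> (\<integral>\<^sup>+Y. ennreal (\<kappa> * \<omega>0) * (f Y * indicator E Y) \<partial>lebesgue)"
  proof (rule nn_integral_mono)
    fix Y
    show "ennreal (weight \<Gamma> d Y) * (f Y * indicator E Y) \<le> ennreal (\<kappa> * \<omega>0) * (f Y * indicator E Y)"
      using weight_bounds(1)[OF *] by (cases "Y \<in> E") (auto intro!: mult_right_mono ennreal_leI)
  qed
  show "(\<integral>\<^sup>+Y. ennreal (\<omega>0 / \<kappa>) * (f Y * indicator E Y) \<partial>lebesgue) \<le> (\<integral>\<^sup>+Y. ennreal (weight \<Gamma> d Y) * (f Y * indicator E Y) \<partial>lebesgue)"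
  proof (rule nn_integral_mono)
    fix Y
    show "ennreal (\<omega>0 / \<kappa>) * (f Y * indicator E Y) \<le> ennreal (weight \<Gamma> d Y) * (f Y * indicator E Y)"
      using weight_bounds(2)[OF *] by (cases "Y \<in> E") (auto intro!: mult_right_mono ennreal_leI)
  qed
qed

lemma wmeasure_ball:
  assumes \<rho>: "0 < \<rho>" "\<rho> \<le> 2 * r"
  obtains m where "emeasure (wmeasure \<Gamma> d) (ball X \<rho>) = ennreal m"
    "\<omega>0 / \<kappa> * (unit_ball_vol (real CARD('n)) * \<rho> ^ CARD('n)) \<le> m"
    "m \<le> \<kappa> * \<omega>0 * (unit_ball_vol (real CARD('n)) * \<rho> ^ CARD('n))" "0 < m"
proof -
  let ?B = "ball X \<rho>" and ?V = "unit_ball_vol (real CARD('n)) * \<rho> ^ CARD('n)"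
  have V: "0 < ?V" using \<rho> by (intro mult_pos_pos unit_ball_vol_pos) auto
  have f: "(\<lambda>Y. 1 * indicator ?B Y :: ennreal) \<in> borel_measurable lebesgue"
    by (simp add: borel_measurable_indicator borel_open)
  have E: "?B \<subseteq> S'" using \<rho> r by auto
  have em: "(\<integral>\<^sup>+Y\<in>?B. 1 \<partial>wmeasure \<Gamma> d) = emeasure (wmeasure \<Gamma> d) ?B" by (simp add: wmeasure_def)
  have el: "(\<integral>\<^sup>+Y\<in>?B. 1 \<partial>lebesgue) = ennreal ?V"
    using \<rho> emeasure_ball[of \<rho> X] by simp
  note b = wmeasure_integral_le[OF f E, unfolded em el]
  have "emeasure (wmeasure \<Gamma> d) ?B < \<infinity>"
    using b(1) by (rule le_less_trans) (simp add: ennreal_mult_less_top)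
  then obtain m where m: "emeasure (wmeasure \<Gamma> d) ?B = ennreal m" "0 \<le> m"
    by (cases "emeasure (wmeasure \<Gamma> d) ?B") auto
  have c: "0 < \<omega>0 / \<kappa>" "0 < \<kappa> * \<omega>0" using \<kappa> \<omega>0 by auto
  have 1: "\<omega>0 / \<kappa> * ?V \<le> m"
    using b(2) c m(2) unfolding m(1) by (subst (asm) ennreal_mult'[symmetric]) (auto simp: ennreal_le_iff simp del: times_divide_eq_left)
  have 2: "m \<le> \<kappa> * \<omega>0 * ?V"
    using b(1) c V unfolding m(1) by (subst (asm) ennreal_mult'[symmetric]) (auto simp: ennreal_le_iff)
  have "0 < m" using mult_pos_pos[OF c(1) V] 1 by linarith
  with m(1) 1 2 that show thesis by blast
qed

lemma cc: "0 < cc" and LL: "0 < LL"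
  using K \<kappa> q lam0 by (auto simp: cc_def LL_def)

lemma matrix_norm_le:
  assumes Y: "Y \<in> S'"
  shows "norm (((1 / \<omega>0) *\<^sub>R A Y) *v \<xi>) \<le> LL * norm \<xi>"
proof -
  let ?v = "A Y *v \<xi>"
  \<comment> \<open>The sesquilinear bound tested with the image vector itself yields the operator
    bound.\<close>
  have "(norm ?v)\<^sup>2 = cmod (hdot ?v ?v)" unfolding hdot_self norm_of_real by simp
  also have "\<dots> \<le> K * weight \<Gamma> d Y * norm \<xi> * norm ?v"
    using A_bdd[of Y \<xi> ?v] sets_inclusion Y by blast
  also have "\<dots> \<le> K * (\<kappa> * \<omega>0) * norm \<xi> * norm ?v"
    using weight_bounds(1)[OF Y] K by (intro mult_right_mono mult_left_mono) auto
  finally have "norm ?v \<le> K * (\<kappa> * \<omega>0) * norm \<xi>"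
    by (cases "norm ?v = 0") (use K \<kappa> \<omega>0 in \<open>auto simp: power2_eq_square\<close>)
  then have "norm ?v / \<omega>0 \<le> LL * norm \<xi>"
    using \<omega>0 by (simp add: LL_def divide_le_eq mult.assoc mult.commute mult.left_commute)
  then show ?thesis using \<omega>0 by (simp add: matrix_scaleR_mult)
qed

lemma normalized_eq:
  assumes "Y \<in> - \<Gamma>"
  shows "weight \<Gamma> d Y *\<^sub>R normalized \<Gamma> d A Y = A Y"
proof -
  have "infdist Y \<Gamma> powr (d + 1 - real CARD('n)) * infdist Y \<Gamma> powr (real CARD('n) - d - 1) = 1"
    using infdist_pos[OF assms] by (simp flip: powr_add)
  then show ?thesis by (simp add: weight_def normalized_def)
qed

text \<open>q-ellipticity concerns the normalized matrix; multiplying back by the weight and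
  dividing by its value at the center costs one factor \<open>\<kappa>\<close>. The bound is stated
  with \<open>lam0\<close> rather than \<open>lam\<close>, so that the constant depends only on the
  lower bound.\<close>

lemma matrix_elliptic:
  assumes s: "s = 2 \<or> s = q"
  shows "AE Y in lborel. Y \<in> S \<longrightarrow> (\<forall>\<xi>. cc * (norm \<xi>)\<^sup>2 \<le> Re (hdot (((1 / \<omega>0) *\<^sub>R A Y) *v \<xi>) \<xi>)) \<and>
        (\<forall>\<xi>. cc * (norm \<xi>)\<^sup>2 \<le> Re (hdot (((1 / \<omega>0) *\<^sub>R A Y) *v \<xi>) (J_form s \<xi>)))"
proof -
  have "- \<Gamma> \<inter> space lebesgue \<in> sets lebesgue" using \<Gamma>(1) by (simp add: borel_open)
  moreover have "AE Y in lebesgue_on (- \<Gamma>). \<forall>\<xi>. lam * (norm \<xi>)\<^sup>2 \<le> Re (hdot (normalized \<Gamma> d A Y *v \<xi>) (J_map q \<xi>))"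
    using qe by (simp add: q_elliptic_with_def)
  ultimately have "AE Y in lborel. Y \<in> - \<Gamma> \<longrightarrow> (\<forall>\<xi>. lam * (norm \<xi>)\<^sup>2 \<le> Re (hdot (normalized \<Gamma> d A Y *v \<xi>) (J_map q \<xi>)))"
    by (simp add: AE_restrict_space_iff AE_completion_iff)
  then show ?thesis
  proof eventually_elim
    fix Y
    assume H: "Y \<in> - \<Gamma> \<longrightarrow> (\<forall>\<xi>. lam * (norm \<xi>)\<^sup>2 \<le> Re (hdot (normalized \<Gamma> d A Y *v \<xi>) (J_map q \<xi>)))"
    show "Y \<in> S \<longrightarrow> (\<forall>\<xi>. cc * (norm \<xi>)\<^sup>2 \<le> Re (hdot (((1 / \<omega>0) *\<^sub>R A Y) *v \<xi>) \<xi>)) \<and>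
        (\<forall>\<xi>. cc * (norm \<xi>)\<^sup>2 \<le> Re (hdot (((1 / \<omega>0) *\<^sub>R A Y) *v \<xi>) (J_form s \<xi>)))"
    proof
      assume Y: "Y \<in> S"
      then have Y': "Y \<in> S'" "Y \<in> - \<Gamma>" using sets_inclusion by blast+
      let ?w = "weight \<Gamma> d Y / \<omega>0"
      have w: "1 / \<kappa> \<le> ?w" using weight_bounds(2)[OF Y'(1)] \<omega>0 \<kappa> by (simp add: field_simps)
      have e2: "cc * (norm \<xi>)\<^sup>2 \<le> Re (hdot (((1 / \<omega>0) *\<^sub>R A Y) *v \<xi>) \<xi>)" for \<xi>
      proof -
        have "cc * (norm \<xi>)\<^sup>2 \<le> 1 / (K * \<kappa>) * (norm \<xi>)\<^sup>2" by (intro mult_right_mono) (auto simp: cc_def)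
        also have "\<dots> = inverse K * (1 / \<kappa>) * (norm \<xi>)\<^sup>2" by (simp add: divide_inverse)
        also have "\<dots> \<le> inverse K * ?w * (norm \<xi>)\<^sup>2"
          using w K by (intro mult_right_mono mult_left_mono) auto
        also have "\<dots> = (1 / \<omega>0) * (inverse K * weight \<Gamma> d Y * (norm \<xi>)\<^sup>2)" by simp
        also have "\<dots> \<le> (1 / \<omega>0) * Re (hdot (A Y *v \<xi>) \<xi>)"
          using A_ell[OF Y'(2)] \<omega>0 by (intro mult_left_mono) auto
        finally show ?thesis by (simp add: matrix_scaleR_mult hdot_scaleR_left)
      qed
      moreover have "cc * (norm \<xi>)\<^sup>2 \<le> Re (hdot (((1 / \<omega>0) *\<^sub>R A Y) *v \<xi>) (J_form s \<xi>))" for \<xi>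
      proof (cases "s = 2")
        case True
        then show ?thesis using e2 by (simp add: J_form_2)
      next
        case False
        then have sq: "s = q" using s by simp
        have "q * lam * (norm \<xi>)\<^sup>2 \<le> Re (hdot (normalized \<Gamma> d A Y *v \<xi>) (J_form q \<xi>))"
          using H Y'(2) by (intro J_form_elliptic[OF q]) auto
        have "cc * (norm \<xi>)\<^sup>2 \<le> q * lam0 / \<kappa> * (norm \<xi>)\<^sup>2" by (intro mult_right_mono) (auto simp: cc_def)
        also have "\<dots> = 1 / \<kappa> * (q * lam0 * (norm \<xi>)\<^sup>2)" by simp
        also have "\<dots> \<le> ?w * (q * lam * (norm \<xi>)\<^sup>2)"
          using w q lam0 \<kappa> \<omega>0 weight_pos[OF Y'(2)] by (intro mult_mono mult_right_mono mult_left_mono) auto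
        also have "\<dots> \<le> ?w * Re (hdot (normalized \<Gamma> d A Y *v \<xi>) (J_form q \<xi>))"
          using \<omega>0 weight_pos[OF Y'(2)] by (intro mult_left_mono) (use \<open>q * lam * (norm \<xi>)\<^sup>2 \<le> _\<close> in auto)
        also have "\<dots> = Re (hdot (((1 / \<omega>0) *\<^sub>R A Y) *v \<xi>) (J_form s \<xi>))"
          unfolding normalized_eq[OF Y'(2), symmetric] sq by (simp add: matrix_scaleR_mult hdot_scaleR_left)
        finally show ?thesis .
      qed
      ultimately show "(\<forall>\<xi>. cc * (norm \<xi>)\<^sup>2 \<le> Re (hdot (((1 / \<omega>0) *\<^sub>R A Y) *v \<xi>) \<xi>)) \<and>
        (\<forall>\<xi>. cc * (norm \<xi>)\<^sup>2 \<le> Re (hdot (((1 / \<omega>0) *\<^sub>R A Y) *v \<xi>) (J_form s \<xi>)))" by blast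
    qed
  qed
qed

section \<open>The unweighted equation on the ball\<close>

lemma W12: "W12_loc (- \<Gamma>) u"
  using sol by (simp add: weak_solution_def)

lemma open_\<Omega>: "open (- \<Gamma>)"
  by (rule open_Compl[OF \<Gamma>(1)])

lemma borel_measurable_matrix_mult:
  assumes "f \<in> borel_measurable M" "g \<in> borel_measurable M"
  shows "(\<lambda>x. (f x :: complex^'n^'n) *v g x) \<in> borel_measurable M"
  using assms
  by (rule borel_measurable_continuous_Pair) (unfold matrix_vector_mult_def, intro continuous_intros)

lemma \<Omega>_measurable: "(\<lambda>Y. indicator (- \<Gamma>) Y *\<^sub>R A Y) \<in> borel_measurable lebesgue"
    "(\<lambda>Y. indicator (- \<Gamma>) Y *\<^sub>R u Y) \<in> borel_measurable lebesgue"
    "(\<lambda>Y. indicator (- \<Gamma>) Y *\<^sub>R G Y) \<in> borel_measurable lebesgue"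
proof -
  have \<Omega>: "- \<Gamma> \<inter> space lebesgue \<in> sets lebesgue" using open_\<Omega> by (simp add: borel_open)
  show "(\<lambda>Y. indicator (- \<Gamma>) Y *\<^sub>R A Y) \<in> borel_measurable lebesgue"
    using A_meas borel_measurable_restrict_space_iff[OF \<Omega>, of A] by simp
  show "(\<lambda>Y. indicator (- \<Gamma>) Y *\<^sub>R u Y) \<in> borel_measurable lebesgue"
    using weak_grad_props(1)[OF W12] borel_measurable_restrict_space_iff[OF \<Omega>, of u] by (simp add: L2_loc_def)
  show "(\<lambda>Y. indicator (- \<Gamma>) Y *\<^sub>R G Y) \<in> borel_measurable lebesgue"
    using weak_grad_props(2)[OF W12] borel_measurable_restrict_space_iff[OF \<Omega>, of G] by (simp add: L2_loc_def)
qed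

text \<open>Dividing by the weight at the center makes the ellipticity constants independent of the
  position and size of the ball; cutting to \<open>S'\<close> makes the field square integrable on
  the whole space.\<close>

definition "flux Y = (1 / \<omega>0) *\<^sub>R (indicator S' Y *\<^sub>R (A Y *v G Y))"

lemma flux_measurable: "flux \<in> borel_measurable lebesgue"
proof -
  have "flux = (\<lambda>Y. (1 / \<omega>0) *\<^sub>R ((indicator (- \<Gamma>) Y *\<^sub>R A Y) *v (indicator S' Y *\<^sub>R G Y)))"
  proof
    fix Y
    show "flux Y = (1 / \<omega>0) *\<^sub>R ((indicator (- \<Gamma>) Y *\<^sub>R A Y) *v (indicator S' Y *\<^sub>R G Y))"
    proof (cases "Y \<in> S'")
      case True
      then have "Y \<in> - \<Gamma>" using sets_inclusion(3) by blast
      with True show ?thesis by (simp add: flux_def)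
    qed (simp add: flux_def)
  qed
  moreover have "(\<lambda>Y. (1 / \<omega>0) *\<^sub>R ((indicator (- \<Gamma>) Y *\<^sub>R A Y) *v (indicator S' Y *\<^sub>R G Y))) \<in> borel_measurable lebesgue"
    by (intro borel_measurable_scaleR borel_measurable_const borel_measurable_matrix_mult \<Omega>_measurable(1)
        L2_loc_cut[OF weak_grad_props(2)[OF W12] open_\<Omega> compact_cball sets_inclusion(3)])
  ultimately show ?thesis by simp
qed

text \<open>The density of the weighted measure cancels the normalization of the matrix, since their
  product is \<open>A\<close>, so the weighted weak formulation is an unweighted one.\<close>

lemma test_flux:
  assumes \<Psi>: "test_function T \<Psi>"
  shows "(LINT Y|lebesgue. hdot (flux Y) (grad \<Psi> Y)) = 0"
proof -
  let ?h = "\<lambda>Y. hdot (normalized \<Gamma> d A Y *v G Y) (grad \<Psi> Y)"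
  have cl: "closure {Y. \<Psi> Y \<noteq> 0} \<subseteq> T" and ks: "k_smooth (Suc 0) \<Psi>"
    using \<Psi> by (auto simp: test_function_def simp del: k_smooth.simps)
  have "T \<subseteq> - \<Gamma>" using sets_inclusion by blast
  then have "test_function (- \<Gamma>) \<Psi>" using \<Psi> by (auto simp: test_function_def)
  then have z: "(LINT Y:(- \<Gamma>)|wmeasure \<Gamma> d. ?h Y) = 0"
    using sol by (simp add: weak_solution_def)
  have g0: "grad \<Psi> Y = 0" if "Y \<notin> S'" for Y
  proof -
    have "Y \<in> - closure {Y. \<Psi> Y \<noteq> 0}" using that cl sets_inclusion(2) by blast
    then have "partial i \<Psi> Y = 0" for i
      by (rule partial_eq_0_open[rotated]) (use closure_subset[of "{Y. \<Psi> Y \<noteq> 0}"] in auto)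
    then show ?thesis by (simp add: grad_def vec_eq_iff)
  qed
  have mg: "grad \<Psi> \<in> borel_measurable lebesgue"
    by (rule measurable_completion) (simp add: borel_measurable_continuous_onI[OF continuous_on_grad[OF ks]])
  have md: "(\<lambda>Y. infdist Y \<Gamma> powr (real CARD('n) - d - 1)) \<in> borel_measurable lebesgue"
  proof (rule measurable_completion)
    have [measurable]: "(\<lambda>Y. infdist Y \<Gamma>) \<in> borel_measurable borel"
      by (intro borel_measurable_continuous_onI continuous_intros)
    show "(\<lambda>Y. infdist Y \<Gamma> powr (real CARD('n) - d - 1)) \<in> borel_measurable lborel" by measurable
  qed
  have "(\<lambda>Y. indicator (- \<Gamma>) Y *\<^sub>R ?h Y) = (\<lambda>Y. hdot ((infdist Y \<Gamma> powr (real CARD('n) - d - 1)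
      *\<^sub>R (indicator (- \<Gamma>) Y *\<^sub>R A Y)) *v (indicator (- \<Gamma>) Y *\<^sub>R G Y)) (grad \<Psi> Y))"
    by (auto simp: fun_eq_iff normalized_def hdot_def indicator_def)
  moreover have "\<dots> \<in> borel_measurable lebesgue"
    by (intro borel_measurable_hdot borel_measurable_matrix_mult borel_measurable_scaleR md \<Omega>_measurable mg)
  ultimately have mh: "(\<lambda>Y. indicator (- \<Gamma>) Y *\<^sub>R ?h Y) \<in> borel_measurable lebesgue" by simp
  have "0 = (LINT Y|lebesgue. weight \<Gamma> d Y *\<^sub>R (indicator (- \<Gamma>) Y *\<^sub>R ?h Y))"
    using z unfolding set_lebesgue_integral_def wmeasure_def
    by (subst (asm) integral_density[OF mh]) (auto simp: measurable_completion weight_def)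
  also have "\<dots> = (LINT Y|lebesgue. \<omega>0 *\<^sub>R hdot (flux Y) (grad \<Psi> Y))"
  proof (rule Bochner_Integration.integral_cong[OF refl])
    fix Y
    show "weight \<Gamma> d Y *\<^sub>R (indicator (- \<Gamma>) Y *\<^sub>R ?h Y) = \<omega>0 *\<^sub>R hdot (flux Y) (grad \<Psi> Y)"
    proof (cases "Y \<in> S'")
      case True
      then have Y: "Y \<in> - \<Gamma>" using sets_inclusion(3) by blast
      have "weight \<Gamma> d Y *\<^sub>R ?h Y = hdot (A Y *v G Y) (grad \<Psi> Y)"
        unfolding hdot_scaleR_left[symmetric] matrix_scaleR_mult[symmetric] normalized_eq[OF Y] ..
      then show ?thesis using True Y \<omega>0 by (simp add: flux_def hdot_scaleR_left)
    qed (simp add: g0 hdot_def)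
  qed
  also have "\<dots> = \<omega>0 *\<^sub>R (LINT Y|lebesgue. hdot (flux Y) (grad \<Psi> Y))" by simp
  finally show ?thesis using \<omega>0 by simp
qed

text \<open>\<open>u\<close>, its weak gradient and the flux are replaced by Borel versions. The
  same data serve both exponents because \<open>s\<close> enters only through the ellipticity
  condition.\<close>

lemma approximable_solution_exists:
  obtains u' G' B U D where "\<And>s. s = 2 \<or> s = q \<Longrightarrow> approximable_solution S u' G' B U D cc LL s"
    "AE Y in lborel. Y \<in> S \<longrightarrow> u' Y = u Y \<and> G' Y = G Y"
proof -
  note wg = weak_grad_props[OF W12]
  obtain U D where U: "\<And>k. k_smooth (Suc 0) (U k)"
    and D: "D \<in> borel_measurable borel" "integrable lborel (\<lambda>x. (D x)\<^sup>2)" "\<And>x. 0 \<le> D x"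
    and dom: "AE x in lborel. x \<in> S \<longrightarrow> (\<forall>k. norm (U k x) \<le> D x \<and> norm (grad (U k) x) \<le> D x)"
    and lim: "AE x in lborel. x \<in> S \<longrightarrow> (\<lambda>k. U k x) \<longlonglongrightarrow> u x \<and> (\<lambda>k. grad (U k) x) \<longlonglongrightarrow> G x"
    by (rule weak_gradient_approximation[OF open_\<Omega> compact_cball sets_inclusion(4) wg]) (rule that)
  note mu = L2_loc_cut[OF wg(1) open_\<Omega> compact_cball sets_inclusion(3)]
    and mG = L2_loc_cut[OF wg(2) open_\<Omega> compact_cball sets_inclusion(3)]
  obtain u' where u': "u' \<in> borel_measurable borel" "AE Y in lborel. indicator S' Y *\<^sub>R u Y = u' Y"
    by (rule borel_version_exists[OF mu(1)])
  obtain G' where G': "G' \<in> borel_measurable borel" "AE Y in lborel. indicator S' Y *\<^sub>R G Y = G' Y"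
    by (rule borel_version_exists[OF mG(1)])
  obtain B where B: "B \<in> borel_measurable borel" "AE Y in lborel. flux Y = B Y"
    by (rule borel_version_exists[OF flux_measurable])
  have SS': "Y \<in> S \<Longrightarrow> Y \<in> S'" for Y using sets_inclusion by blast
  have eq: "AE Y in lborel. Y \<in> S \<longrightarrow> u' Y = u Y \<and> G' Y = G Y"
    using u'(2) G'(2)
  proof eventually_elim
    fix Y assume "indicator S' Y *\<^sub>R u Y = u' Y" "indicator S' Y *\<^sub>R G Y = G' Y"
    then show "Y \<in> S \<longrightarrow> u' Y = u Y \<and> G' Y = G Y"
      using SS'[of Y] by (cases "Y \<in> S'") auto
  qed
  have flux_le: "norm (flux Y) \<le> LL * norm (indicator S' Y *\<^sub>R G Y)" for Y
    using matrix_norm_le[of Y "G Y"] by (cases "Y \<in> S'") (auto simp: flux_def matrix_scaleR_mult)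
  have B2: "integrable lborel (\<lambda>x. (norm (B x))\<^sup>2)"
  proof (rule integrableI_nonneg)
    have "(\<integral>\<^sup>+x. ennreal ((norm (B x))\<^sup>2) \<partial>lborel) = (\<integral>\<^sup>+x. ennreal ((norm (flux x))\<^sup>2) \<partial>lborel)"
      using B(2) by (intro nn_integral_cong_AE) auto
    also have "\<dots> \<le> (\<integral>\<^sup>+x. ennreal (LL\<^sup>2) * ennreal ((norm (indicator S' x *\<^sub>R G x))\<^sup>2) \<partial>lborel)"
    proof (rule nn_integral_mono)
      fix x
      have "(norm (flux x))\<^sup>2 \<le> (LL * norm (indicator S' x *\<^sub>R G x))\<^sup>2" by (intro power_mono flux_le) simp
      then have "ennreal ((norm (flux x))\<^sup>2) \<le> ennreal (LL\<^sup>2 * (norm (indicator S' x *\<^sub>R G x))\<^sup>2)"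
        unfolding power_mult_distrib by (rule ennreal_leI)
      then show "ennreal ((norm (flux x))\<^sup>2) \<le> ennreal (LL\<^sup>2) * ennreal ((norm (indicator S' x *\<^sub>R G x))\<^sup>2)"
        by (simp only: ennreal_mult' zero_le_power2)
    qed
    also have "\<dots> = (\<integral>\<^sup>+x. ennreal (LL\<^sup>2) * ennreal ((norm (indicator S' x *\<^sub>R G x))\<^sup>2) \<partial>lebesgue)"
      by (rule nn_integral_completion[symmetric])
    also have "\<dots> = ennreal (LL\<^sup>2) * (\<integral>\<^sup>+x. ennreal ((norm (indicator S' x *\<^sub>R G x))\<^sup>2) \<partial>lebesgue)"
      by (intro nn_integral_cmult measurable_compose[OF _ measurable_ennreal] borel_measurable_power
          measurable_compose[OF mG(1) borel_measurable_norm])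
    also have "\<dots> < \<infinity>" using mG(2) by (simp add: ennreal_mult_less_top)
    finally show "(\<integral>\<^sup>+x. ennreal ((norm (B x))\<^sup>2) \<partial>lborel) < \<infinity>" .
  qed (use B(1) in auto)
  have test: "(LINT x|lborel. hdot (B x) (grad \<Psi> x)) = 0" if \<Psi>: "test_function T \<Psi>" for \<Psi>
  proof -
    have ks: "k_smooth (Suc 0) \<Psi>" using \<Psi> unfolding test_function_def by blast
    note g = borel_measurable_continuous_onI[OF continuous_on_grad[OF ks]]
    have "(LINT x|lebesgue. hdot (flux x) (grad \<Psi> x)) = (LINT x|lborel. hdot (B x) (grad \<Psi> x))"
    proof (rule integral_lebesgue_eq_lborel)
      show "(\<lambda>x. hdot (flux x) (grad \<Psi> x)) \<in> borel_measurable lebesgue"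
        by (rule borel_measurable_hdot[OF flux_measurable]) (rule measurable_completion, use g in simp)
      show "(\<lambda>x. hdot (B x) (grad \<Psi> x)) \<in> borel_measurable borel"
        by (rule borel_measurable_hdot[OF B(1) g])
      show "AE x in lborel. hdot (flux x) (grad \<Psi> x) = hdot (B x) (grad \<Psi> x)"
        using B(2) by eventually_elim simp
    qed
    then show ?thesis using test_flux[OF \<Psi>] by simp
  qed
  have "approximable_solution S u' G' B U D cc LL s" if s: "s = 2 \<or> s = q" for s
  proof
    show "AE x in lborel. x \<in> S \<longrightarrow> (\<lambda>j. U j x) \<longlonglongrightarrow> u' x \<and> (\<lambda>j. grad (U j) x) \<longlonglongrightarrow> G' x"
      using lim eq by eventually_elim auto
    show "AE x in lborel. x \<in> S \<longrightarrow> (\<exists>M. B x = M *v G' x \<and>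
        (\<forall>\<xi>. cc * (norm \<xi>)\<^sup>2 \<le> Re (hdot (M *v \<xi>) \<xi>)) \<and>
        (\<forall>\<xi>. cc * (norm \<xi>)\<^sup>2 \<le> Re (hdot (M *v \<xi>) (J_form s \<xi>))))"
      using matrix_elliptic[OF s] eq B(2)
    proof eventually_elim
      fix x
      assume e: "x \<in> S \<longrightarrow> (\<forall>\<xi>. cc * (norm \<xi>)\<^sup>2 \<le> Re (hdot (((1 / \<omega>0) *\<^sub>R A x) *v \<xi>) \<xi>)) \<and>
          (\<forall>\<xi>. cc * (norm \<xi>)\<^sup>2 \<le> Re (hdot (((1 / \<omega>0) *\<^sub>R A x) *v \<xi>) (J_form s \<xi>)))"
        and x: "x \<in> S \<longrightarrow> u' x = u x \<and> G' x = G x" and b: "flux x = B x"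
      show "x \<in> S \<longrightarrow> (\<exists>M. B x = M *v G' x \<and>
        (\<forall>\<xi>. cc * (norm \<xi>)\<^sup>2 \<le> Re (hdot (M *v \<xi>) \<xi>)) \<and>
        (\<forall>\<xi>. cc * (norm \<xi>)\<^sup>2 \<le> Re (hdot (M *v \<xi>) (J_form s \<xi>))))"
      proof
        assume xS: "x \<in> S"
        have "B x = ((1 / \<omega>0) *\<^sub>R A x) *v G' x"
          using x xS SS'[OF xS] unfolding b[symmetric] by (simp only: flux_def matrix_scaleR_mult indicator_simps scaleR_one)
        then show "\<exists>M. B x = M *v G' x \<and>
          (\<forall>\<xi>. cc * (norm \<xi>)\<^sup>2 \<le> Re (hdot (M *v \<xi>) \<xi>)) \<and>
          (\<forall>\<xi>. cc * (norm \<xi>)\<^sup>2 \<le> Re (hdot (M *v \<xi>) (J_form s \<xi>)))"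
          using e xS by blast
      qed
    qed
    show "AE x in lborel. x \<in> S \<longrightarrow> norm (B x) \<le> LL * norm (G' x)"
      using eq B(2)
    proof eventually_elim
      fix x assume "x \<in> S \<longrightarrow> u' x = u x \<and> G' x = G x" "flux x = B x"
      then show "x \<in> S \<longrightarrow> norm (B x) \<le> LL * norm (G' x)"
        using flux_le[of x] SS'[of x] by auto
    qed
    show "(LINT x|lborel. hdot (B x) (grad \<Psi> x)) = 0"
      if "k_smooth (Suc 0) \<Psi>" "\<And>x. x \<notin> S \<Longrightarrow> \<Psi> x = 0" for \<Psi>
      by (rule weak_identity_C1[OF open_ball compact_cball sets_inclusion(1) B(1) B2 test that])
    show "k_smooth (Suc 0) (U j)" for j by (rule U)
    show "0 \<le> D x" for x by (rule D(3))
  qed (fact compact_cball u'(1) G'(1) B(1) D(1,2) dom cc LL)+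
  then show thesis using eq by (rule that)
qed

text \<open>The theorem speaks of open balls, while the analysis needs compact ones; the sphere is a
  null set.\<close>

lemma indicator_ball_cball: "AE Y in lborel. indicator (ball X \<rho>) Y = (indicator (cball X \<rho>) Y :: ennreal)"
  using AE_lborel_not_in_negligible[OF negligible_sphere[of X \<rho>]]
  by eventually_elim (auto simp: indicator_def)

lemma transfer_integral:
  assumes eq: "AE Y in lborel. Y \<in> S \<longrightarrow> f Y = g Y" and \<rho>: "\<rho> \<le> 2 * r"
  shows "(\<integral>\<^sup>+Y\<in>ball X \<rho>. f Y \<partial>lebesgue) = (\<integral>\<^sup>+Y. g Y * indicator (cball X \<rho>) Y \<partial>lborel)"
  unfolding nn_integral_completion
proof (rule nn_integral_cong_AE)
  show "AE Y in lborel. f Y * indicator (ball X \<rho>) Y = g Y * indicator (cball X \<rho>) Y"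
    using eq indicator_ball_cball[of \<rho>]
  proof eventually_elim
    fix Y assume "Y \<in> S \<longrightarrow> f Y = g Y" "indicator (ball X \<rho>) Y = (indicator (cball X \<rho>) Y :: ennreal)"
    then show "f Y * indicator (ball X \<rho>) Y = g Y * indicator (cball X \<rho>) Y"
      using \<rho> by (cases "Y \<in> cball X \<rho>") auto
  qed
qed

lemma ball_inclusion: "\<rho> \<le> 2 * r \<Longrightarrow> ball X \<rho> \<subseteq> S'"
  using r by auto

lemma powr_measurable:
  assumes "\<rho> \<le> 2 * r"
  shows "(\<lambda>Y. ennreal (norm (u Y) powr p) * indicator (ball X \<rho>) Y) \<in> borel_measurable lebesgue"
proof -
  note [measurable] = \<Omega>_measurable(2)
  have [measurable]: "ball X \<rho> \<in> sets lebesgue" by (simp add: borel_open)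
  have "(\<lambda>Y. ennreal (norm (u Y) powr p) * indicator (ball X \<rho>) Y)
      = (\<lambda>Y. ennreal (norm (indicator (- \<Gamma>) Y *\<^sub>R u Y) powr p) * indicator (ball X \<rho>) Y)"
    using ball_inclusion[OF assms] sets_inclusion(3) by (auto simp: fun_eq_iff indicator_def)
  also have "\<dots> \<in> borel_measurable lebesgue" by measurable
  finally show ?thesis .
qed

lemma energy_weighted:
  "(\<integral>\<^sup>+Y\<in>ball X r. ennreal (energy_density (- \<Gamma>) q u Y) \<partial>wmeasure \<Gamma> d)
    \<le> ennreal (256 * \<kappa>\<^sup>2 * LL\<^sup>2 / cc\<^sup>2 / r\<^sup>2) * (\<integral>\<^sup>+Y\<in>ball X (2 * r). ennreal (cmod (u Y) powr q) \<partial>wmeasure \<Gamma> d)"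
proof -
  obtain u' G' B U D where ap: "\<And>s. s = 2 \<or> s = q \<Longrightarrow> approximable_solution S u' G' B U D cc LL s"
    and eq: "AE Y in lborel. Y \<in> S \<longrightarrow> u' Y = u Y \<and> G' Y = G Y"
    by (rule approximable_solution_exists) (rule that)
  interpret approximable_solution S u' G' B U D cc LL q by (rule ap) simp
  obtain \<eta> :: "real^'n \<Rightarrow> real" where \<eta>: "k_smooth (Suc 0) (\<lambda>x. complex_of_real (\<eta> x))"
    "\<And>x. 0 \<le> \<eta> x" "\<And>x. \<eta> x \<le> 1" "\<And>x. x \<in> cball X r \<Longrightarrow> \<eta> x = 1" "\<And>x. x \<notin> S \<Longrightarrow> \<eta> x = 0"
    "\<And>x. norm (grad (\<lambda>x. complex_of_real (\<eta> x)) x) \<le> 8 / (2 * r - r)"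
    by (rule cutoff_exists[of r "2 * r" X]) (use r in \<open>auto intro: that\<close>)
  have cut: "cutoff S (8 / r) \<eta>" using \<eta> r by (simp add: cutoff_def)
  let ?I = "\<integral>\<^sup>+Y. ennreal (norm (u' Y) powr q) * indicator S Y \<partial>lborel"
  have en: "(\<integral>\<^sup>+x. ennreal (if u' x = 0 then 0 else (norm (G' x))\<^sup>2 * norm (u' x) powr (q - 2)) * indicator (cball X r) x \<partial>lborel)
      \<le> ennreal (4 * LL\<^sup>2 / cc\<^sup>2 * (8 / r)\<^sup>2) * ?I"
    by (rule energy_estimate[OF cut]) (use r \<eta>(4) in auto)
  have me: "(\<lambda>Y. ennreal (energy_density (- \<Gamma>) q u Y) * indicator (ball X r) Y) \<in> borel_measurable lebesgue"
  proof -
    let ?u = "\<lambda>Y. indicator (- \<Gamma>) Y *\<^sub>R u Y" and ?G = "\<lambda>Y. indicator (- \<Gamma>) Y *\<^sub>R G Y"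
    note [measurable] = \<Omega>_measurable(2,3)
    have [measurable]: "ball X r \<in> sets lebesgue" by (simp add: borel_open)
    have "(\<lambda>Y. ennreal (energy_density (- \<Gamma>) q u Y) * indicator (ball X r) Y)
        = (\<lambda>Y. ennreal (if ?u Y = 0 then 0 else (norm (?G Y))\<^sup>2 * norm (?u Y) powr (q - 2)) * indicator (ball X r) Y)"
      using ball_inclusion[of r] sets_inclusion(3) r by (auto simp: fun_eq_iff indicator_def energy_density_def)
    also have "\<dots> \<in> borel_measurable lebesgue" by measurable
    finally show ?thesis .
  qed
  have r2: "r \<le> 2 * r" using r by simp
  have "(\<integral>\<^sup>+Y\<in>ball X r. ennreal (energy_density (- \<Gamma>) q u Y) \<partial>wmeasure \<Gamma> d)
      \<le> ennreal (\<kappa> * \<omega>0) * (\<integral>\<^sup>+Y\<in>ball X r. ennreal (energy_density (- \<Gamma>) q u Y) \<partial>lebesgue)"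
    by (rule wmeasure_integral_le(1)[OF me ball_inclusion[OF r2]])
  also have "(\<integral>\<^sup>+Y\<in>ball X r. ennreal (energy_density (- \<Gamma>) q u Y) \<partial>lebesgue)
      = (\<integral>\<^sup>+x. ennreal (if u' x = 0 then 0 else (norm (G' x))\<^sup>2 * norm (u' x) powr (q - 2)) * indicator (cball X r) x \<partial>lborel)"
    by (rule transfer_integral[OF _ r2]) (use eq in eventually_elim, auto simp: energy_density_def)
  also have "ennreal (\<kappa> * \<omega>0) * \<dots> \<le> ennreal (\<kappa> * \<omega>0) * (ennreal (4 * LL\<^sup>2 / cc\<^sup>2 * (8 / r)\<^sup>2) * ?I)"
    by (rule mult_left_mono[OF en]) simp
  also have "\<dots> = ennreal (256 * \<kappa>\<^sup>2 * LL\<^sup>2 / cc\<^sup>2 / r\<^sup>2) * (ennreal (\<omega>0 / \<kappa>) * ?I)"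
  proof -
    \<comment> \<open>Here \<open>256 = 4 * 8^2\<close>, from the Caccioppoli constant and the
      cutoff slope \<open>8 / r\<close>. One \<open>\<kappa>\<close> is paid for leaving the
      weighted measure and one for returning to it.\<close>
    have "\<kappa> * \<omega>0 * (4 * LL\<^sup>2 / cc\<^sup>2 * (8 / r)\<^sup>2) = 256 * \<kappa>\<^sup>2 * LL\<^sup>2 / cc\<^sup>2 / r\<^sup>2 * (\<omega>0 / \<kappa>)"
      using \<kappa> by (simp add: power2_eq_square ac_simps)
    then have "ennreal (\<kappa> * \<omega>0) * ennreal (4 * LL\<^sup>2 / cc\<^sup>2 * (8 / r)\<^sup>2) = ennreal (256 * \<kappa>\<^sup>2 * LL\<^sup>2 / cc\<^sup>2 / r\<^sup>2) * ennreal (\<omega>0 / \<kappa>)"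
      using \<kappa> \<omega>0 by (subst (1 2) ennreal_mult'[symmetric]) auto
    then show ?thesis by (simp only: mult.assoc[symmetric])
  qed
  also have "?I = (\<integral>\<^sup>+Y\<in>ball X (2 * r). ennreal (cmod (u Y) powr q) \<partial>lebesgue)"
    by (rule transfer_integral[symmetric, OF _ order_refl]) (use eq in eventually_elim, auto)
  also have "ennreal (256 * \<kappa>\<^sup>2 * LL\<^sup>2 / cc\<^sup>2 / r\<^sup>2) * (ennreal (\<omega>0 / \<kappa>) * \<dots>)
      \<le> ennreal (256 * \<kappa>\<^sup>2 * LL\<^sup>2 / cc\<^sup>2 / r\<^sup>2) * (\<integral>\<^sup>+Y\<in>ball X (2 * r). ennreal (cmod (u Y) powr q) \<partial>wmeasure \<Gamma> d)"
    by (intro mult_left_mono wmeasure_integral_le(2) powr_measurable ball_inclusion) auto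
  finally show ?thesis .
qed

lemma reverse_holder_weighted:
  assumes s: "s = 2 \<or> s = q" "2 \<le> s" and p: "0 < p" "p \<le> 2"
  shows "epowr (average (wmeasure \<Gamma> d) (ball X r) (\<lambda>Y. cmod (u Y) powr s)) (1 / s)
    \<le> ennreal (rh_factor CARD('n) \<kappa> cc LL s p powr (1 / s)) * epowr (average (wmeasure \<Gamma> d) (ball X (2 * r)) (\<lambda>Y. cmod (u Y) powr p)) (1 / p)"
proof -
  obtain u' G' B U D where ap: "\<And>s. s = 2 \<or> s = q \<Longrightarrow> approximable_solution S u' G' B U D cc LL s"
    and eq: "AE Y in lborel. Y \<in> S \<longrightarrow> u' Y = u Y \<and> G' Y = G Y"
    by (rule approximable_solution_exists) (rule that)
  interpret approximable_solution S u' G' B U D cc LL s by (rule ap[OF s(1)])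
  interpret ball_solution X r u' G' B U D cc LL s by unfold_locales (use r s in auto)
  let ?n = "CARD('n)" and ?C = "rh_const CARD('n) s p (cut_const cc LL s)"
  define w where "w = unit_ball_vol (real ?n)"
  have w: "0 < w" unfolding w_def by (rule unit_ball_vol_pos) simp
  have C: "0 < ?C" by (intro rh_const_pos cut_const_pos)
  let ?J = "\<integral>\<^sup>+Y. ennreal (norm (u' Y) powr p) * indicator S Y \<partial>lborel"
  let ?I = "\<integral>\<^sup>+Y. ennreal (norm (u' Y) powr s) * indicator (cball X r) Y \<partial>lborel"
  \<comment> \<open>Since \<open>p <= 2\<close>, the power is at most 1 plus the square, so the
    right-hand integral is finite and a real \<open>M\<close> exists.\<close>
  have "?J \<le> (\<integral>\<^sup>+Y. indicator S Y + ennreal (indicator S Y * (D Y)\<^sup>2) \<partial>lborel)"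
  proof (rule nn_integral_mono_AE)
    show "AE Y in lborel. ennreal (norm (u' Y) powr p) * indicator S Y \<le> indicator S Y + ennreal (indicator S Y * (D Y)\<^sup>2)"
      using solution_dom
    proof eventually_elim
      fix Y assume Y: "Y \<in> S \<longrightarrow> norm (u' Y) \<le> D Y \<and> norm (G' Y) \<le> D Y"
      show "ennreal (norm (u' Y) powr p) * indicator S Y \<le> indicator S Y + ennreal (indicator S Y * (D Y)\<^sup>2)"
      proof (cases "Y \<in> S")
        case True
        have "norm (u' Y) powr p \<le> 1 + (norm (u' Y))\<^sup>2"
        proof (cases "norm (u' Y) \<le> 1")
          case True
          then have "norm (u' Y) powr p \<le> 1 powr p" using p by (intro powr_mono2) auto
          then show ?thesis using zero_le_power2[of "norm (u' Y)"] unfolding powr_one_eq_one by linarith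
        next
          case False
          then have "norm (u' Y) powr p \<le> norm (u' Y) powr 2" using p by (intro powr_mono) auto
          also have "\<dots> = (norm (u' Y))\<^sup>2" using False by (intro powr_numeral) linarith
          finally show ?thesis by simp
        qed
        also have "\<dots> \<le> 1 + (D Y)\<^sup>2" using Y True by (intro add_left_mono power_mono) auto
        finally have "ennreal (norm (u' Y) powr p) \<le> ennreal (1 + (D Y)\<^sup>2)" by (rule ennreal_leI)
        then show ?thesis using True by (simp add: ennreal_plus)
      qed simp
    qed
  qed
  also have "\<dots> = emeasure lborel S + (\<integral>\<^sup>+Y. ennreal (indicator S Y * (D Y)\<^sup>2) \<partial>lborel)"
    by (subst nn_integral_add) auto
  also have "\<dots> < \<infinity>"
    using emeasure_bounded_finite[OF bounded_cball, of X "2 * r"] nn_integral_eq_integral[OF integrable_SD2] by simp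
  finally have "?J < \<infinity>" .
  then obtain M where M: "?J = ennreal M" "0 \<le> M" by (cases ?J) auto
  define Z where "Z = ?C * M powr (s / p) * r powr (real ?n - real ?n * s / p)"
  have Z: "0 \<le> Z" using C by (simp add: Z_def)
  have I: "?I \<le> ennreal Z"
  \<comment> \<open>\<open>reverse_holder_ball\<close> asks for positive \<open>M\<close>. If
    \<open>M = 0\<close>, the function vanishes almost everywhere on \<open>S\<close> and so does
    the left-hand integrand.\<close>
  proof (cases "M = 0")
    case False
    then show ?thesis unfolding Z_def using M p by (intro reverse_holder_ball) auto
  next
    case True
    then have "?J = 0" using M(1) by simp
    moreover have "(\<lambda>Y. ennreal (norm (u' Y) powr p) * indicator S Y) \<in> borel_measurable lborel" by measurable
    ultimately have "AE Y in lborel. ennreal (norm (u' Y) powr p) * indicator S Y = 0"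
      by (simp only: nn_integral_0_iff_AE)
    then have "AE Y in lborel. ennreal (norm (u' Y) powr s) * indicator (cball X r) Y = 0"
      by eventually_elim (use r in \<open>auto simp: indicator_def split: if_splits\<close>)
    then have "?I = (\<integral>\<^sup>+Y. 0 \<partial>(lborel :: (real^'n) measure))" by (rule nn_integral_cong_AE)
    then show ?thesis by simp
  qed
  have r2: "r \<le> 2 * r" "0 < 2 * r" using r by auto
  obtain m1 where m1: "emeasure (wmeasure \<Gamma> d) (ball X r) = ennreal m1" "\<omega>0 / \<kappa> * (w * r ^ ?n) \<le> m1" "0 < m1"
    using wmeasure_ball[OF r r2(1)] unfolding w_def by metis
  obtain m2 where m2: "emeasure (wmeasure \<Gamma> d) (ball X (2 * r)) = ennreal m2" "m2 \<le> \<kappa> * \<omega>0 * (w * (2 * r) ^ ?n)" "0 < m2"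
    using wmeasure_ball[OF r2(2) order_refl] unfolding w_def by metis
  \<comment> \<open>A lower bound for the average over the doubled ball: the integral is replaced by
    \<open>(\<omega>0 / \<kappa>) * M\<close> and the measure by its upper bound; the weight at the
    center cancels.\<close>
  define t where "t = M / (\<kappa>\<^sup>2 * w * (2 * r) ^ ?n)"
  have t: "0 \<le> t" unfolding t_def using M(2) w r \<kappa> by (intro divide_nonneg_pos mult_pos_pos) auto
  have up: "average (wmeasure \<Gamma> d) (ball X r) (\<lambda>Y. cmod (u Y) powr s) \<le> ennreal (rh_factor CARD('n) \<kappa> cc LL s p * t powr (s / p))"
  proof -
    have "(\<integral>\<^sup>+Y\<in>ball X r. ennreal (cmod (u Y) powr s) \<partial>wmeasure \<Gamma> d)
        \<le> ennreal (\<kappa> * \<omega>0) * (\<integral>\<^sup>+Y\<in>ball X r. ennreal (cmod (u Y) powr s) \<partial>lebesgue)"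
      by (rule wmeasure_integral_le(1)[OF powr_measurable[OF r2(1)] ball_inclusion[OF r2(1)]])
    also have "(\<integral>\<^sup>+Y\<in>ball X r. ennreal (cmod (u Y) powr s) \<partial>lebesgue) = ?I"
      by (rule transfer_integral[OF _ r2(1)]) (use eq in eventually_elim, auto)
    also have "ennreal (\<kappa> * \<omega>0) * ?I \<le> ennreal (\<kappa> * \<omega>0) * ennreal Z"
      by (rule mult_left_mono[OF I]) simp
    also have "\<dots> = ennreal (\<kappa> * \<omega>0 * Z)" using \<kappa> \<omega>0 by (subst ennreal_mult') auto
    finally have "average (wmeasure \<Gamma> d) (ball X r) (\<lambda>Y. cmod (u Y) powr s) \<le> ennreal (\<kappa> * \<omega>0 * Z) / ennreal m1"
      unfolding average_def m1(1) by (rule divide_right_mono_ennreal)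
    also have "\<dots> = ennreal (\<kappa> * \<omega>0 * Z / m1)"
      using \<kappa> \<omega>0 Z m1(3) by (intro divide_ennreal) auto
    also have "\<dots> \<le> ennreal (\<kappa> * \<omega>0 * Z / (\<omega>0 / \<kappa> * (w * r ^ ?n)))"
      using m1(2,3) \<kappa> \<omega>0 Z w r by (intro ennreal_leI divide_left_mono mult_pos_pos) auto
    also have "\<kappa> * \<omega>0 * Z / (\<omega>0 / \<kappa> * (w * r ^ ?n)) = \<kappa>\<^sup>2 * ?C / w * (M powr (s / p) * (r powr (real ?n - real ?n * s / p) / r ^ ?n))"
      using \<omega>0 by (simp add: Z_def power2_eq_square)
    \<comment> \<open>After division by the volume, the remaining power of \<open>r\<close> is
      exactly the one that turns \<open>M\<close> into an average, so the final constant does not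
      depend on the radius.\<close>
    also have "r powr (real ?n - real ?n * s / p) / r ^ ?n = inverse ((r ^ ?n) powr (s / p))"
    proof -
      have "r powr (real ?n - real ?n * s / p) / r ^ ?n = r powr (real ?n - real ?n * s / p - real ?n)"
        unfolding powr_realpow[OF r, symmetric] powr_diff[symmetric] ..
      also have "\<dots> = inverse ((r powr real ?n) powr (s / p))"
        unfolding powr_powr powr_minus[symmetric] by simp
      finally show ?thesis using r by (simp add: powr_realpow)
    qed
    also have "M powr (s / p) * inverse ((r ^ ?n) powr (s / p)) = (\<kappa>\<^sup>2 * w * 2 ^ ?n) powr (s / p) * t powr (s / p)"
    proof -
      have "\<kappa>\<^sup>2 * w * 2 ^ ?n * t = M / r ^ ?n"
        using w r \<kappa> by (simp add: t_def power_mult_distrib)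
      then have "(\<kappa>\<^sup>2 * w * 2 ^ ?n) powr (s / p) * t powr (s / p) = (M / r ^ ?n) powr (s / p)"
        by (simp only: powr_mult[symmetric])
      then show ?thesis unfolding divide_inverse[symmetric] powr_divide[symmetric] by (rule sym)
    qed
    finally show ?thesis by (simp only: rh_factor_def w_def mult.assoc)
  qed
  have lo: "ennreal t \<le> average (wmeasure \<Gamma> d) (ball X (2 * r)) (\<lambda>Y. cmod (u Y) powr p)"
  proof -
    have "t = \<omega>0 / \<kappa> * M / (\<kappa> * \<omega>0 * (w * (2 * r) ^ ?n))"
      using \<omega>0 by (simp add: t_def power2_eq_square)
    also have "\<dots> \<le> \<omega>0 / \<kappa> * M / m2"
      using m2 \<kappa> \<omega>0 M(2) w r by (intro divide_left_mono mult_pos_pos) auto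
    finally have "ennreal t \<le> ennreal (\<omega>0 / \<kappa> * M / m2)" by (rule ennreal_leI)
    also have "\<dots> = ennreal (\<omega>0 / \<kappa> * M) / ennreal m2"
      using \<kappa> \<omega>0 M(2) m2(3) by (intro divide_ennreal[symmetric]) auto
    also have "\<dots> \<le> average (wmeasure \<Gamma> d) (ball X (2 * r)) (\<lambda>Y. cmod (u Y) powr p)"
      unfolding average_def m2(1)
    proof (rule divide_right_mono_ennreal)
      have "ennreal (\<omega>0 / \<kappa> * M) = ennreal (\<omega>0 / \<kappa>) * ?J"
        unfolding M(1) using \<kappa> \<omega>0 by (intro ennreal_mult') auto
      also have "?J = (\<integral>\<^sup>+Y\<in>ball X (2 * r). ennreal (cmod (u Y) powr p) \<partial>lebesgue)"
        by (rule transfer_integral[symmetric, OF _ order_refl]) (use eq in eventually_elim, auto)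
      also have "ennreal (\<omega>0 / \<kappa>) * \<dots> \<le> (\<integral>\<^sup>+Y\<in>ball X (2 * r). ennreal (cmod (u Y) powr p) \<partial>wmeasure \<Gamma> d)"
        by (intro wmeasure_integral_le(2) powr_measurable ball_inclusion) auto
      finally show "ennreal (\<omega>0 / \<kappa> * M) \<le> (\<integral>\<^sup>+Y\<in>ball X (2 * r). ennreal (cmod (u Y) powr p) \<partial>wmeasure \<Gamma> d)" .
    qed
    finally show ?thesis .
  qed
  show ?thesis
    using s p by (intro epowr_le[OF rh_factor_pos[OF \<kappa>] _ _ t up lo]) auto
qed

end

theorem proposition1p10:
  fixes q lam0 K :: real
  assumes "1 < q" and "0 < lam0" and "0 < K"
  shows "\<exists>C>0. \<forall>(d::real) (\<Gamma>::(real^'n) set) (A::real^'n \<Rightarrow> complex^'n^'n) lam X r u.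
           0 < d \<and> d < real CARD('n) - 1 \<and> ahlfors_regular d \<Gamma> \<and>
           q_elliptic_with \<Gamma> d q K lam A \<and> lam0 \<le> lam \<and>
           0 < r \<and> ball X (3 * r) \<subseteq> - \<Gamma> \<and> weak_solution \<Gamma> d A u
         \<longrightarrow>
           (\<integral>\<^sup>+Y\<in>ball X r. ennreal (energy_density (- \<Gamma>) q u Y) \<partial>wmeasure \<Gamma> d)
             \<le> ennreal (C / r\<^sup>2) *
                (\<integral>\<^sup>+Y\<in>ball X (2 * r). ennreal (cmod (u Y) powr q) \<partial>wmeasure \<Gamma> d)
         \<and> (q > 2 \<longrightarrow>
             epowr (average (wmeasure \<Gamma> d) (ball X r) (\<lambda>Y. cmod (u Y) powr q)) (1 / q)
             \<le> ennreal C *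
                epowr (average (wmeasure \<Gamma> d) (ball X (2 * r)) (\<lambda>Y. (cmod (u Y))\<^sup>2)) (1 / 2))
         \<and> (q < 2 \<longrightarrow>
             epowr (average (wmeasure \<Gamma> d) (ball X r) (\<lambda>Y. (cmod (u Y))\<^sup>2)) (1 / 2)
             \<le> ennreal C *
                epowr (average (wmeasure \<Gamma> d) (ball X (2 * r)) (\<lambda>Y. cmod (u Y) powr q)) (1 / q))"
proof -
  \<comment> \<open>All constants are fixed here from n, \<open>q\<close>, \<open>lam0\<close> and
    \<open>K\<close>, before d, the set, the matrix, the ball and the solution are introduced. Their
    sum serves all three inequalities.\<close>
  define \<kappa> :: real where "\<kappa> = 6 ^ CARD('n)"
  define c where "c = min (1 / (K * \<kappa>)) (q * lam0 / \<kappa>)"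
  define \<Lambda> where "\<Lambda> = K * \<kappa>"
  define C1 where "C1 = 256 * \<kappa>\<^sup>2 * \<Lambda>\<^sup>2 / c\<^sup>2"
  define C2 where "C2 = rh_factor CARD('n) \<kappa> c \<Lambda> q 2 powr (1 / q)"
  define C3 where "C3 = rh_factor CARD('n) \<kappa> c \<Lambda> 2 q powr (1 / 2)"
  have \<kappa>: "0 < \<kappa>" by (simp add: \<kappa>_def)
  then have c: "0 < c" "0 < \<Lambda>" using assms by (auto simp: c_def \<Lambda>_def)
  have C1: "0 < C1" unfolding C1_def using \<kappa> c by (intro divide_pos_pos mult_pos_pos) auto
  have C2: "0 \<le> C2" and C3: "0 \<le> C3" by (simp_all add: C2_def C3_def)
  have sq: "(\<lambda>Y. (cmod (u Y))\<^sup>2) = (\<lambda>Y. cmod (u Y) powr 2)" for u :: "real^'n \<Rightarrow> complex"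
    by (rule ext) simp
  show ?thesis
  proof (intro exI[of _ "C1 + C2 + C3"] conjI allI impI)
    show "0 < C1 + C2 + C3" using C1 C2 C3 by linarith
    fix d and \<Gamma> :: "(real^'n) set" and A :: "real^'n \<Rightarrow> complex^'n^'n" and lam X r u
    assume H: "0 < d \<and> d < real CARD('n) - 1 \<and> ahlfors_regular d \<Gamma> \<and>
           q_elliptic_with \<Gamma> d q K lam A \<and> lam0 \<le> lam \<and>
           0 < r \<and> ball X (3 * r) \<subseteq> - \<Gamma> \<and> weak_solution \<Gamma> d A u"
    interpret weighted_solution \<Gamma> d K q lam0 lam r \<kappa> c \<Lambda> A X u
      by unfold_locales (use H assms in \<open>auto simp: \<kappa>_def c_def \<Lambda>_def\<close>)
    have "C1 / r\<^sup>2 \<le> (C1 + C2 + C3) / r\<^sup>2" using C2 C3 by (intro divide_right_mono) auto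
    then have "ennreal (C1 / r\<^sup>2) \<le> ennreal ((C1 + C2 + C3) / r\<^sup>2)" by (rule ennreal_leI)
    with energy_weighted
    show "(\<integral>\<^sup>+Y\<in>ball X r. ennreal (energy_density (- \<Gamma>) q u Y) \<partial>wmeasure \<Gamma> d)
             \<le> ennreal ((C1 + C2 + C3) / r\<^sup>2) *
                (\<integral>\<^sup>+Y\<in>ball X (2 * r). ennreal (cmod (u Y) powr q) \<partial>wmeasure \<Gamma> d)"
      unfolding C1_def[symmetric] by (rule order_trans[OF _ mult_right_mono]) simp
    show "epowr (average (wmeasure \<Gamma> d) (ball X r) (\<lambda>Y. cmod (u Y) powr q)) (1 / q)
             \<le> ennreal (C1 + C2 + C3) *
                epowr (average (wmeasure \<Gamma> d) (ball X (2 * r)) (\<lambda>Y. (cmod (u Y))\<^sup>2)) (1 / 2)" if "2 < q"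
    proof -
      have le: "ennreal C2 \<le> ennreal (C1 + C2 + C3)" using C1 C3 by (intro ennreal_leI) linarith
      have "epowr (average (wmeasure \<Gamma> d) (ball X r) (\<lambda>Y. cmod (u Y) powr q)) (1 / q)
          \<le> ennreal C2 * epowr (average (wmeasure \<Gamma> d) (ball X (2 * r)) (\<lambda>Y. cmod (u Y) powr 2)) (1 / 2)"
        unfolding C2_def by (rule reverse_holder_weighted) (use that in auto)
      from order_trans[OF this mult_right_mono[OF le]] show ?thesis unfolding sq by simp
    qed
    show "epowr (average (wmeasure \<Gamma> d) (ball X r) (\<lambda>Y. (cmod (u Y))\<^sup>2)) (1 / 2)
             \<le> ennreal (C1 + C2 + C3) *
                epowr (average (wmeasure \<Gamma> d) (ball X (2 * r)) (\<lambda>Y. cmod (u Y) powr q)) (1 / q)" if "q < 2"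
    proof -
      have le: "ennreal C3 \<le> ennreal (C1 + C2 + C3)" using C1 C2 by (intro ennreal_leI) linarith
      have "epowr (average (wmeasure \<Gamma> d) (ball X r) (\<lambda>Y. cmod (u Y) powr 2)) (1 / 2)
          \<le> ennreal C3 * epowr (average (wmeasure \<Gamma> d) (ball X (2 * r)) (\<lambda>Y. cmod (u Y) powr q)) (1 / q)"
        unfolding C3_def by (rule reverse_holder_weighted) (use that assms in auto)
      from order_trans[OF this mult_right_mono[OF le]] show ?thesis unfolding sq by simp
    qed
  qed
qed

end
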